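(* Let $E$ be a finite set and let $\lambda : E\to\mathbf{R}_+$ be a generic length function such that $\mathrm{Pol}(E,\lambda)\neq\emptyset$. Let $N(\lambda)$ be the minimal number of lopsided subsets which are necessary for a partition of $E$ (that is, the minimal number of blocks in a partition of $E$ all of whose blocks are lopsided). Then the maximal dimension of a bending torus for $\mathrm{Pol}(E,\lambda)$ is $|E|-\max\{3,N(\lambda)\}$.
   Context: For a finite set $E$ and a function $\lambda:E\to\mathbf{R}_+$ with strictly positive values (the length function), put $\widetilde{\mathrm{Pol}}(E,\lambda)=\{\rho:E\to\mathbf{R}^3 \mid \sum_{e\in E}\rho(e)=0,\ |\rho(e)|=\lambda(e)\ \forall e\in E\}$ and $\mathrm{Pol}(E,\lambda)=\widetilde{\mathrm{Pol}}(E,\lambda)/SO(3)$ (the polygon space). $\lambda$ is generic if there is no $\varepsilon:E\to\{\pm1\}$ with $\sum_{e\in E}\varepsilon(e)\lambda(e)=0$. For $\lambda$ generic and $\mathrm{Pol}(E,\lambda)\ne\emptyset$, $\mathrm{Pol}(E,\lambda)$ is a closed smooth symplectic manifold of dimension $2(|E|-3)$; its symplectic structure is that of the symplectic reduction at $0$ of $\prod_{e\in E}\mathcal{O}(\lambda(e))$ by the diagonal action of $SO(3)$, where $\mathcal{O}(s)$ is the coadjoint orbit of $SO(3)$ identified with the sphere of radius $s$ centered at $0$ in $\mathfrak{so}(3)^*\cong\mathbf{R}^3$, and the moment map is $(z_e)\mapsto\sum_{e\in E} z_e$. A subset $I\subset E$ is lopsided if there is $e_0\in I$ with $\lambda(e_0)>\sum_{e\in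 I-\{e_0\}}\lambda(e)$ (so $\emptyset$ is not lopsided and every singleton is lopsided). For $I\subset E$ let $f_I:\mathrm{Pol}(E,\lambda)\to\mathbf{R}$ be $f_I(\rho)=|\sum_{e\in I}\rho(e)|$. If $I$ is lopsided, $f_I$ is nowhere zero and smooth; its Hamiltonian flow $\Phi_I^t$ is the bending flow associated to $I$; it is periodic and rotates the vectors $\{\rho(e)\mid e\in I\}$ at constant speed around the axis $\rho_I=\sum_{e\in I}\rho(e)$. A Hamiltonian torus is a sub-torus of the group of symplectomorphisms of $\mathrm{Pol}(E,\lambda)$ (acting in a Hamiltonian fashion, which is automatic since polygon spaces are simply connected). A bending torus is a Hamiltonian torus generated by bending flows of lopsided subsets (the trivial torus, of dimension $0$, is allowed). *)

theory Defs
  imports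
    "HOL-Analysis.Analysis"
    "HOL-Library.Disjoint_Sets"
    "HOL-Algebra.Bij"
    "HOL-Algebra.Product_Groups"
    "HOL-Algebra.Generated_Groups"
begin

text \<open>
  The finite index set is the universe of a type \<open>'e\<close> of class \<open>finite\<close>, so that a configuration
  of vectors is a point of the Euclidean space \<open>real ^ 3 ^ 'e\<close>.
\<close>

section \<open>Polygon spaces\<close>

definition PolT :: "('e::finite \<Rightarrow> real) \<Rightarrow> (real ^ 3 ^ 'e) set" where
  "PolT len = {\<rho>. (\<Sum>e\<in>UNIV. \<rho> $ e) = 0 \<and> (\<forall>e. norm (\<rho> $ e) = len e)}"

definition so3_rel :: "('e::finite \<Rightarrow> real) \<Rightarrow> ((real ^ 3 ^ 'e) \<times> (real ^ 3 ^ 'e)) set" where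
  "so3_rel len = {(\<rho>, \<sigma>). \<rho> \<in> PolT len \<and> \<sigma> \<in> PolT len \<and>
     (\<exists>Q. rotation_matrix Q \<and> (\<forall>e. \<sigma> $ e = Q *v (\<rho> $ e)))}"

definition Pol :: "('e::finite \<Rightarrow> real) \<Rightarrow> (real ^ 3 ^ 'e) set set" where
  "Pol len = PolT len // so3_rel len"

definition pol_class :: "('e::finite \<Rightarrow> real) \<Rightarrow> real ^ 3 ^ 'e \<Rightarrow> (real ^ 3 ^ 'e) set" where
  "pol_class len \<rho> = so3_rel len `` {\<rho>}"

text \<open>The quotient topology.\<close>

definition pol_topology :: "('e::finite \<Rightarrow> real) \<Rightarrow> (real ^ 3 ^ 'e) set topology" where
  "pol_topology len =
     topology (\<lambda>W. W \<subseteq> Pol len \<and>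
       openin (top_of_set (PolT len)) {\<rho> \<in> PolT len. pol_class len \<rho> \<in> W})"

lemma openin_pol_topology:
  "openin (pol_topology len) W \<longleftrightarrow>
     W \<subseteq> Pol len \<and> openin (top_of_set (PolT len)) {\<rho> \<in> PolT len. pol_class len \<rho> \<in> W}"
proof -
  have "istopology (\<lambda>W. W \<subseteq> Pol len \<and>
          openin (top_of_set (PolT len)) {\<rho> \<in> PolT len. pol_class len \<rho> \<in> W})"
    unfolding istopology_def
  proof (intro conjI allI impI)
    fix S T
    assume "S \<subseteq> Pol len \<and> openin (top_of_set (PolT len)) {\<rho> \<in> PolT len. pol_class len \<rho> \<in> S}"
      and "T \<subseteq> Pol len \<and> openin (top_of_set (PolT len)) {\<rho> \<in> PolT len. pol_class len \<rho> \<in> T}"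
    moreover have "{\<rho> \<in> PolT len. pol_class len \<rho> \<in> S \<inter> T} =
      {\<rho> \<in> PolT len. pol_class len \<rho> \<in> S} \<inter> {\<rho> \<in> PolT len. pol_class len \<rho> \<in> T}" by auto
    ultimately show "S \<inter> T \<subseteq> Pol len"
      and "openin (top_of_set (PolT len)) {\<rho> \<in> PolT len. pol_class len \<rho> \<in> S \<inter> T}"
      by auto
  next
    fix K
    assume K: "\<forall>S\<in>K. S \<subseteq> Pol len \<and>
      openin (top_of_set (PolT len)) {\<rho> \<in> PolT len. pol_class len \<rho> \<in> S}"
    then show "\<Union>K \<subseteq> Pol len" by blast
    have "{\<rho> \<in> PolT len. pol_class len \<rho> \<in> \<Union>K} =
      (\<Union>S\<in>K. {\<rho> \<in> PolT len. pol_class len \<rho> \<in> S})" by auto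
    with K show "openin (top_of_set (PolT len)) {\<rho> \<in> PolT len. pol_class len \<rho> \<in> \<Union>K}"
      by (metis (no_types, lifting) openin_Union image_iff)
  qed
  then show ?thesis
    by (simp add: pol_topology_def topology_inverse')
qed

definition generic :: "('e::finite \<Rightarrow> real) \<Rightarrow> bool" where
  "generic len \<longleftrightarrow>
     \<not> (\<exists>\<epsilon>::'e \<Rightarrow> real. (\<forall>e. \<epsilon> e \<in> {1, -1}) \<and> (\<Sum>e\<in>UNIV. \<epsilon> e * len e) = 0)"

definition lopsided :: "('e::finite \<Rightarrow> real) \<Rightarrow> 'e set \<Rightarrow> bool" where
  "lopsided len I \<longleftrightarrow> (\<exists>e0\<in>I. len e0 > (\<Sum>e\<in>I - {e0}. len e))"

definition N_lopsided :: "('e::finite \<Rightarrow> real) \<Rightarrow> nat" where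
  "N_lopsided len =
     (LEAST n. \<exists>P. partition_on (UNIV::'e set) P \<and> (\<forall>I\<in>P. lopsided len I) \<and> card P = n)"


section \<open>Smoothness\<close>

text \<open>
  The smooth structure on \<^term>\<open>Pol len\<close> is the quotient one: for generic \<open>len\<close>, \<^term>\<open>PolT len\<close> is a
  submanifold of \<open>real ^ 3 ^ 'e\<close> and a smooth principal bundle over \<^term>\<open>Pol len\<close>. Hence a function
  on \<^term>\<open>Pol len\<close> is smooth iff its pullback locally extends to a smooth function on an open set
  of the Euclidean space, and a self-map is smooth iff it locally lifts to such a smooth map.
\<close>

primrec C_times :: "nat \<Rightarrow> 'a::euclidean_space set \<Rightarrow> ('a \<Rightarrow> 'b::euclidean_space) \<Rightarrow> bool" where
  "C_times 0 U F \<longleftrightarrow> continuous_on U F"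
| "C_times (Suc k) U F \<longleftrightarrow>
     F differentiable_on U \<and> (\<forall>v. C_times k U (\<lambda>x. frechet_derivative F (at x) v))"

definition smooth_on_open :: "'a::euclidean_space set \<Rightarrow> ('a \<Rightarrow> 'b::euclidean_space) \<Rightarrow> bool" where
  "smooth_on_open U F \<longleftrightarrow> open U \<and> (\<forall>k. C_times k U F)"

definition smooth_function :: "('e::finite \<Rightarrow> real) \<Rightarrow> ((real ^ 3 ^ 'e) set \<Rightarrow> real) \<Rightarrow> bool" where
  "smooth_function len f \<longleftrightarrow>
     (\<forall>\<rho>\<in>PolT len. \<exists>U F. \<rho> \<in> U \<and> smooth_on_open U F \<and>
        (\<forall>\<sigma>\<in>U \<inter> PolT len. F \<sigma> = f (pol_class len \<sigma>)))"

definition smooth_lift ::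
  "('e::finite \<Rightarrow> real) \<Rightarrow> ((real ^ 3 ^ 'e) set \<Rightarrow> (real ^ 3 ^ 'e) set) \<Rightarrow>
   (real ^ 3 ^ 'e) set \<Rightarrow> (real ^ 3 ^ 'e \<Rightarrow> real ^ 3 ^ 'e) \<Rightarrow> bool" where
  "smooth_lift len \<phi> U \<psi> \<longleftrightarrow>
     smooth_on_open U \<psi> \<and>
     (\<forall>\<sigma>\<in>U \<inter> PolT len. \<psi> \<sigma> \<in> PolT len \<and> pol_class len (\<psi> \<sigma>) = \<phi> (pol_class len \<sigma>))"


section \<open>The symplectic structure\<close>

text \<open>
  The Kirillov--Kostant--Souriau form of the coadjoint orbit through \<open>z\<close> (the sphere of radius
  \<open>norm z\<close>), written in terms of tangent vectors of the sphere. The two lemmas say that it is the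
  orbit form \<open>(ad\<^sub>a z, ad\<^sub>b z) \<mapsto> \<langle>z, [a, b]\<rangle>\<close> and that its moment map is the inclusion, with the sign
  convention that the Hamiltonian vector field \<open>X\<close> of \<open>f\<close> satisfies \<open>\<omega>(X, w) = df(w)\<close>.
\<close>

definition kks_form :: "real ^ 3 \<Rightarrow> real ^ 3 \<Rightarrow> real ^ 3 \<Rightarrow> real" where
  "kks_form z v w = inner z (cross3 v w) / (norm z)\<^sup>2"

lemma kks_form_orbit:
  assumes "z \<noteq> 0"
  shows "kks_form z (cross3 a z) (cross3 b z) = inner z (cross3 a b)"
proof -
  have "inner z (cross3 (cross3 a z) (cross3 b z)) = inner z z * inner z (cross3 a b)"
    by (simp add: cross3_simps)
  with assms show ?thesis
    by (simp add: kks_form_def power2_norm_eq_inner)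
qed

lemma kks_form_moment_map:
  assumes "z \<noteq> 0" and "inner z w = 0"
  shows "kks_form z (cross3 a z) w = inner a w"
proof -
  have "inner z (cross3 (cross3 a z) w) = inner z z * inner a w - inner z w * inner a z"
    by (simp add: cross3_simps)
  with assms show ?thesis
    by (simp add: kks_form_def power2_norm_eq_inner)
qed

definition omega :: "real ^ 3 ^ 'e::finite \<Rightarrow> real ^ 3 ^ 'e \<Rightarrow> real ^ 3 ^ 'e \<Rightarrow> real" where
  "omega \<rho> v w = (\<Sum>e\<in>UNIV. kks_form (\<rho> $ e) (v $ e) (w $ e))"

text \<open>
  The tangent space of \<^term>\<open>PolT len\<close>, the zero level of the moment map, at \<open>\<rho>\<close>. The reduced
  symplectic form of \<^term>\<open>Pol len\<close> is the one whose pullback to \<^term>\<open>PolT len\<close> is the restriction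
  of \<^term>\<open>omega\<close> to these spaces.
\<close>

definition tangent :: "real ^ 3 ^ 'e::finite \<Rightarrow> (real ^ 3 ^ 'e) set" where
  "tangent \<rho> = {v. (\<Sum>e\<in>UNIV. v $ e) = 0 \<and> (\<forall>e. inner (\<rho> $ e) (v $ e) = 0)}"

text \<open>
  The group of symplectomorphisms, as a set of extensional bijections. Preservation of the reduced
  form is tested on a local lift; since the pulled back form is basic, the choice of the lift does
  not matter.
\<close>

definition Symp :: "('e::finite \<Rightarrow> real) \<Rightarrow> ((real ^ 3 ^ 'e) set \<Rightarrow> (real ^ 3 ^ 'e) set) set" where
  "Symp len = {\<phi> \<in> Bij (Pol len).
     (\<forall>\<rho>\<in>PolT len. \<exists>U \<psi>. \<rho> \<in> U \<and> smooth_lift len \<phi> U \<psi> \<and>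
        (\<forall>v\<in>tangent \<rho>. \<forall>w\<in>tangent \<rho>.
           omega (\<psi> \<rho>) (frechet_derivative \<psi> (at \<rho>) v) (frechet_derivative \<psi> (at \<rho>) w)
             = omega \<rho> v w)) \<and>
     (\<forall>\<rho>\<in>PolT len. \<exists>U \<psi>. \<rho> \<in> U \<and> smooth_lift len (inv_into (Pol len) \<phi>) U \<psi>)}"


section \<open>Hamiltonian flows\<close>

text \<open>
  A curve \<open>c\<close> in \<^term>\<open>Pol len\<close> is an integral curve of the Hamiltonian vector field of \<open>f\<close> if it
  lifts to a curve in \<^term>\<open>PolT len\<close> whose velocity represents that vector field. The derivative of
  the pullback of \<open>f\<close> is taken within \<^term>\<open>PolT len\<close>; only its values on tangent vectors, where it
  is uniquely determined, are used.
\<close>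

definition hamiltonian_curve ::
  "('e::finite \<Rightarrow> real) \<Rightarrow> ((real ^ 3 ^ 'e) set \<Rightarrow> real) \<Rightarrow> (real \<Rightarrow> (real ^ 3 ^ 'e) set) \<Rightarrow> bool" where
  "hamiltonian_curve len f c \<longleftrightarrow>
     (\<exists>\<gamma> \<gamma>'. \<forall>t. \<gamma> t \<in> PolT len \<and> c t = pol_class len (\<gamma> t) \<and>
        (\<gamma> has_vector_derivative \<gamma>' t) (at t) \<and>
        (\<exists>D. ((\<lambda>\<sigma>. f (pol_class len \<sigma>)) has_derivative D) (at (\<gamma> t) within PolT len) \<and>
             (\<forall>w\<in>tangent (\<gamma> t). omega (\<gamma> t) (\<gamma>' t) w = D w)))"

definition is_hamiltonian_flow ::
  "('e::finite \<Rightarrow> real) \<Rightarrow> ((real ^ 3 ^ 'e) set \<Rightarrow> real) \<Rightarrow>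
   (real \<Rightarrow> (real ^ 3 ^ 'e) set \<Rightarrow> (real ^ 3 ^ 'e) set) \<Rightarrow> bool" where
  "is_hamiltonian_flow len f \<Phi> \<longleftrightarrow>
     (\<forall>t. \<Phi> t \<in> extensional (Pol len)) \<and>
     (\<forall>p\<in>Pol len. \<Phi> 0 p = p \<and> hamiltonian_curve len f (\<lambda>t. \<Phi> t p))"

text \<open>The flow is unique because of extensionality.\<close>

definition hamiltonian_flow ::
  "('e::finite \<Rightarrow> real) \<Rightarrow> ((real ^ 3 ^ 'e) set \<Rightarrow> real) \<Rightarrow>
   real \<Rightarrow> (real ^ 3 ^ 'e) set \<Rightarrow> (real ^ 3 ^ 'e) set" where
  "hamiltonian_flow len f = (THE \<Phi>. is_hamiltonian_flow len f \<Phi>)"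

definition f_len :: "'e::finite set \<Rightarrow> (real ^ 3 ^ 'e) set \<Rightarrow> real" where
  "f_len I p = the_elem ((\<lambda>\<rho>. norm (\<Sum>e\<in>I. \<rho> $ e)) ` p)"

definition bending_flow ::
  "('e::finite \<Rightarrow> real) \<Rightarrow> 'e set \<Rightarrow> real \<Rightarrow> (real ^ 3 ^ 'e) set \<Rightarrow> (real ^ 3 ^ 'e) set" where
  "bending_flow len I = hamiltonian_flow len (f_len I)"


section \<open>Hamiltonian tori and bending tori\<close>

definition circle_group :: "complex monoid" where
  "circle_group = \<lparr>carrier = sphere 0 1, mult = (*), one = 1\<rparr>"

definition torus_group :: "nat \<Rightarrow> (nat \<Rightarrow> complex) monoid" where
  "torus_group d = product_group {..<d} (\<lambda>_. circle_group)"

definition torus_topology :: "nat \<Rightarrow> (nat \<Rightarrow> complex) topology" where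
  "torus_topology d = product_topology (\<lambda>_. top_of_set (sphere 0 1)) {..<d}"

text \<open>
  \<open>T\<close> is a \<open>d\<close>-dimensional torus of symplectomorphisms, parametrized by \<open>\<theta>\<close>, with moment map
  \<open>(\<mu>\<^sub>0, \<dots>, \<mu>\<^sub>d\<^sub>-\<^sub>1)\<close>: the one-parameter subgroup in direction \<open>x\<close> is the flow of \<open>\<Sum> x\<^sub>k \<mu>\<^sub>k\<close>.
\<close>

definition hamiltonian_torus ::
  "('e::finite \<Rightarrow> real) \<Rightarrow> ((real ^ 3 ^ 'e) set \<Rightarrow> (real ^ 3 ^ 'e) set) set \<Rightarrow> nat \<Rightarrow> bool" where
  "hamiltonian_torus len T d \<longleftrightarrow>
     subgroup T (BijGroup (Pol len)) \<and> T \<subseteq> Symp len \<and>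
     (\<exists>\<theta> \<mu>. \<theta> \<in> iso (torus_group d) ((BijGroup (Pol len))\<lparr>carrier := T\<rparr>) \<and>
        continuous_map (prod_topology (torus_topology d) (pol_topology len)) (pol_topology len)
          (\<lambda>(z, p). \<theta> z p) \<and>
        (\<forall>k<d. smooth_function len (\<mu> k)) \<and>
        (\<forall>x::nat \<Rightarrow> real. is_hamiltonian_flow len (\<lambda>p. \<Sum>k<d. x k * \<mu> k p)
           (\<lambda>t. \<theta> (\<lambda>k\<in>{..<d}. cis (t * x k)))))"

definition bending_torus ::
  "('e::finite \<Rightarrow> real) \<Rightarrow> ((real ^ 3 ^ 'e) set \<Rightarrow> (real ^ 3 ^ 'e) set) set \<Rightarrow> nat \<Rightarrow> bool" where
  "bending_torus len T d \<longleftrightarrow>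
     hamiltonian_torus len T d \<and>
     (\<exists>\<I>. (\<forall>I\<in>\<I>. lopsided len I) \<and>
        T = generate (BijGroup (Pol len)) {bending_flow len I t | I t. I \<in> \<I>})"

end

theory Submission
  imports Defs
begin
text \<open>
  Two polygons are congruent iff their inner products and triple products agree. If a curve is driven
  by the Hamiltonian \<open>\<bar>\<rho>\<^sub>I\<bar>\<close>, these invariants are constant after the block \<open>I\<close> has been rotated back
  about \<open>\<rho>\<^sub>I\<close>; so the bending flow is the unit speed rotation of the block.

  Lower bound: split \<open>E\<close> into \<open>max 3 N\<close> lopsided blocks and, in each block, add the elements to the
  dominating one step by step. The flows of these nested or disjoint lopsided sets commute, and they
  act effectively, because some polygon has no two parallel sums \<open>\<rho>\<^sub>X\<close>, \<open>\<rho>\<^sub>Y\<close> for disjoint lopsided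
  \<open>X\<close>, \<open>Y\<close> that do not cover \<open>E\<close>.

  Upper bound: if \<open>I \<inter> J\<close>, \<open>I - J\<close>, \<open>J - I\<close> and \<open>- (I \<union> J)\<close> are all nonempty, then the flows of \<open>I\<close> and
  \<open>J\<close> do not commute: stretch \<open>I\<close> (or its complement) to a straight segment, which is a fixed point of
  the flow of \<open>I\<close>; bending along \<open>J\<close> moves it to a point that is not fixed. So a bending torus comes
  from pairwise compatible splits of \<open>E\<close> with a lopsided side, and there are at most \<open>|E| - max 3 N\<close>
  nontrivial ones of these.
\<close>

section \<open>Rotations of space\<close>

text \<open>No manifold structure on \<open>Pol len\<close> is used: all work is done on
  \<open>PolT len\<close> with maps that commute with rotations. Genericity enters mainly through
  the fact that no polygon lies on a line. It makes the invariants separate classes, and it makes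
  the sum of the projections orthogonal to the edges an invertible map. That inverse serves twice:
  for the kernel of \<open>omega\<close> on tangent vectors, and for realising tangent vectors by
  polygons. The obstacle in identifying the flow is that \<open>hamiltonian_curve\<close> fixes the
  velocity of a lift only up to an infinitesimal rotation depending on time without any known
  regularity. It cannot be integrated to a curve of rotations, but invariants do not see it. A
  bending torus comes with two unrelated descriptions, angles and generating flows. They are
  compared by showing that each flow is a linear winding in the angles. A block and its complement
  bend classes in the same way, so the count concerns splits and not subsets.\<close>

notation cross3 (infixr "\<times>\<^sub>3" 80)

lemma inner_cross3_left: "(x \<times>\<^sub>3 y) \<bullet> z = x \<bullet> (y \<times>\<^sub>3 z)" for x y z :: "real ^ 3"
  by (simp add: cross3_simps)

lemma cross3_cross3_left: "(x \<times>\<^sub>3 y) \<times>\<^sub>3 z = (x \<bullet> z) *\<^sub>R y - (y \<bullet> z) *\<^sub>R x" for x y z :: "real ^ 3"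
  by (subst cross_skew, simp add: Lagrange inner_commute)

text \<open>Rodrigues' formula for the rotation about a unit vector \<open>u\<close>. The angle is a
  unit complex number, so that composition becomes multiplication (\<open>rot_rot\<close>) and
  angles match the coordinates of a torus.\<close>

definition rot :: "complex \<Rightarrow> real ^ 3 \<Rightarrow> real ^ 3 \<Rightarrow> real ^ 3" where
  "rot z u x = Re z *\<^sub>R x + Im z *\<^sub>R (u \<times>\<^sub>3 x) + ((1 - Re z) * (u \<bullet> x)) *\<^sub>R u"

text \<open>The group SO(3), with orientation expressed by the cross product instead of a
  determinant; \<open>rotf_mult_vec\<close> and \<open>rotf_matrix\<close> link it to
  \<open>rotation_matrix\<close>.\<close>

definition rotf :: "(real ^ 3 \<Rightarrow> real ^ 3) \<Rightarrow> bool" where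
  "rotf f \<longleftrightarrow> linear f \<and> (\<forall>x y. f x \<bullet> f y = x \<bullet> y) \<and> (\<forall>x y. f (x \<times>\<^sub>3 y) = f x \<times>\<^sub>3 f y)"

lemma linear_rot: "linear (rot z u)"
  by (rule linearI) (simp_all add: rot_def cross_add_right cross_mult_right inner_add_right algebra_simps)

lemma rot_one [simp]: "rot 1 u x = x"
  by (simp add: rot_def)

lemma rot_axis:
  assumes "norm u = 1" shows "rot z u u = u"
  using assms by (simp add: rot_def algebra_simps dot_square_norm)

lemma inner_rot_axis:
  assumes "norm u = 1" shows "u \<bullet> rot z u x = u \<bullet> x"
  using assms by (simp add: rot_def inner_add_right dot_cross_self dot_square_norm algebra_simps)

lemma rot_rot:
  assumes "norm u = 1" shows "rot z u (rot w u x) = rot (z * w) u x"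
proof -
  have uu: "u \<bullet> u = 1" using assms by (simp add: dot_square_norm)
  have c: "u \<times>\<^sub>3 rot w u x = Re w *\<^sub>R (u \<times>\<^sub>3 x) + Im w *\<^sub>R ((u \<bullet> x) *\<^sub>R u - x)"
    by (simp add: rot_def cross_add_right cross_mult_right Lagrange uu)
  show ?thesis
    unfolding rot_def[of z u "rot w u x"] c inner_rot_axis[OF assms]
    by (simp add: rot_def algebra_simps)
qed

lemma inner_rot_rot:
  assumes "norm u = 1" "norm z = 1" shows "rot z u x \<bullet> rot z u y = x \<bullet> y"
proof -
  have uu: "u \<bullet> u = 1" using assms by (simp add: dot_square_norm)
  have z: "(Re z)\<^sup>2 + (Im z)\<^sup>2 = 1" using assms(2) by (simp add: cmod_def)
  have d: "(u \<times>\<^sub>3 x) \<bullet> (u \<times>\<^sub>3 y) = x \<bullet> y - (u \<bullet> x) * (u \<bullet> y)"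
    by (simp add: dot_cross uu inner_commute)
  have "x \<bullet> (u \<times>\<^sub>3 y) + (u \<times>\<^sub>3 x) \<bullet> y = 0" by (simp add: cross3_simps)
  then have e: "(u \<times>\<^sub>3 x) \<bullet> y = - (x \<bullet> (u \<times>\<^sub>3 y))" by simp
  have "rot z u x \<bullet> rot z u y = ((Re z)\<^sup>2 + (Im z)\<^sup>2) * (x \<bullet> y) + (1 - ((Re z)\<^sup>2 + (Im z)\<^sup>2)) * (u \<bullet> x) * (u \<bullet> y)"
    by (simp add: rot_def inner_add_left inner_add_right dot_cross_self uu d e)
      (simp add: algebra_simps power2_eq_square inner_commute)
  then show ?thesis by (simp add: z)
qed

lemma cross3_expand:
  fixes x y u :: "real ^ 3"
  shows "(c *\<^sub>R x + s *\<^sub>R x' + p *\<^sub>R u) \<times>\<^sub>3 (c *\<^sub>R y + s *\<^sub>R y' + q *\<^sub>R u) =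
     (c * c) *\<^sub>R (x \<times>\<^sub>3 y) + (c * s) *\<^sub>R (x \<times>\<^sub>3 y' + x' \<times>\<^sub>3 y)
     + c *\<^sub>R (q *\<^sub>R (x \<times>\<^sub>3 u) + p *\<^sub>R (u \<times>\<^sub>3 y))
     + (s * s) *\<^sub>R (x' \<times>\<^sub>3 y') + s *\<^sub>R (q *\<^sub>R (x' \<times>\<^sub>3 u) + p *\<^sub>R (u \<times>\<^sub>3 y'))"
  by (simp add: cross_add_left cross_add_right cross_mult_left cross_mult_right algebra_simps)

lemma rot_cross3:
  assumes "norm u = 1" "norm z = 1" shows "rot z u (x \<times>\<^sub>3 y) = rot z u x \<times>\<^sub>3 rot z u y"
proof -
  have uu: "u \<bullet> u = 1" using assms by (simp add: dot_square_norm)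
  have z: "(Re z)\<^sup>2 + (Im z)\<^sup>2 = 1" using assms(2) by (simp add: cmod_def)
  then have z': "Im z * Im z = 1 - Re z * Re z" by (simp add: power2_eq_square)
  define w where "w = x \<times>\<^sub>3 y"
  define t where "t = u \<bullet> w"
  have a: "(u \<times>\<^sub>3 x) \<times>\<^sub>3 (u \<times>\<^sub>3 y) = t *\<^sub>R u"
    by (simp add: Lagrange inner_cross3_left dot_cross_self t_def w_def)
  have b1: "x \<times>\<^sub>3 (u \<times>\<^sub>3 y) = (x \<bullet> y) *\<^sub>R u - (u \<bullet> x) *\<^sub>R y"
    and b2: "(u \<times>\<^sub>3 x) \<times>\<^sub>3 y = (u \<bullet> y) *\<^sub>R x - (x \<bullet> y) *\<^sub>R u"
    and b3: "(u \<times>\<^sub>3 x) \<times>\<^sub>3 u = x - (u \<bullet> x) *\<^sub>R u"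
    and b4: "u \<times>\<^sub>3 (u \<times>\<^sub>3 y) = (u \<bullet> y) *\<^sub>R u - y"
    and b5: "u \<times>\<^sub>3 w = (u \<bullet> y) *\<^sub>R x - (u \<bullet> x) *\<^sub>R y"
    by (simp_all add: cross3_cross3_left Lagrange uu inner_commute w_def)
  \<comment> \<open>Expanding this product once directly and once through \<open>b5\<close> gives
    the relation \<open>d\<close>, which removes the product of \<open>x\<close> with
    \<open>u\<close>; all others are already reduced.\<close>
  have "(u \<times>\<^sub>3 w) \<times>\<^sub>3 u = w - t *\<^sub>R u"
    by (simp add: cross3_cross3_left uu t_def inner_commute)
  then have d: "(u \<bullet> y) *\<^sub>R (x \<times>\<^sub>3 u) = w - t *\<^sub>R u - (u \<bullet> x) *\<^sub>R (u \<times>\<^sub>3 y)"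
    by (simp add: b5 Cross3.left_diff_distrib cross_mult_left cross_skew[of y u] algebra_simps)
  have "rot z u x \<times>\<^sub>3 rot z u y =
     (Re z * Re z) *\<^sub>R w + (Re z * Im z) *\<^sub>R (x \<times>\<^sub>3 (u \<times>\<^sub>3 y) + (u \<times>\<^sub>3 x) \<times>\<^sub>3 y)
     + (Re z * (1 - Re z)) *\<^sub>R ((u \<bullet> y) *\<^sub>R (x \<times>\<^sub>3 u) + (u \<bullet> x) *\<^sub>R (u \<times>\<^sub>3 y))
     + (Im z * Im z) *\<^sub>R ((u \<times>\<^sub>3 x) \<times>\<^sub>3 (u \<times>\<^sub>3 y))
     + (Im z * (1 - Re z)) *\<^sub>R ((u \<bullet> y) *\<^sub>R ((u \<times>\<^sub>3 x) \<times>\<^sub>3 u) + (u \<bullet> x) *\<^sub>R (u \<times>\<^sub>3 (u \<times>\<^sub>3 y)))"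
    unfolding rot_def w_def cross3_expand
    by (simp add: scaleR_add_right mult.assoc)
  also have "\<dots> = Re z *\<^sub>R w + Im z *\<^sub>R (u \<times>\<^sub>3 w) + ((1 - Re z) * t) *\<^sub>R u"
    unfolding a b1 b2 b3 b4 b5 d z'
    by (simp add: algebra_simps)
  finally show ?thesis by (simp add: rot_def t_def w_def)
qed

lemma rotf_rot: "norm u = 1 \<Longrightarrow> norm z = 1 \<Longrightarrow> rotf (rot z u)"
  by (simp add: rotf_def linear_rot inner_rot_rot rot_cross3)

lemma rotf_linear: "rotf f \<Longrightarrow> linear f"
  by (simp add: rotf_def)

lemma rotf_norm: "rotf f \<Longrightarrow> norm (f x) = norm x"
  by (simp add: rotf_def norm_eq_sqrt_inner)

lemma rotf_sgn: "rotf f \<Longrightarrow> sgn (f x) = f (sgn x)"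
  by (simp add: sgn_div_norm rotf_norm linear_scale rotf_linear)

lemma rotf_sum: "rotf f \<Longrightarrow> (\<Sum>e\<in>I. f (g e)) = f (\<Sum>e\<in>I. g e)"
  by (simp add: linear_sum rotf_linear)

lemma rotf_rot_commute: "rotf f \<Longrightarrow> f (rot z u x) = rot z (f u) (f x)"
  by (simp add: rotf_def rot_def linear_add linear_scale)

lemma rotf_comp: "rotf f \<Longrightarrow> rotf g \<Longrightarrow> rotf (\<lambda>x. f (g x))"
  using linear_compose[of g f] by (simp add: rotf_def o_def)

lemma rotf_id: "rotf (\<lambda>x. x)"
  by (simp add: rotf_def linear_id[unfolded id_def])

lemma rotf_mult_vec: "rotation_matrix Q \<Longrightarrow> rotf ((*v) Q)"
  unfolding rotf_def
proof (intro conjI allI)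
  assume Q: "rotation_matrix Q"
  show "linear ((*v) Q)" by (rule matrix_vector_mul_linear)
  fix x y
  show "Q *v (x \<times>\<^sub>3 y) = (Q *v x) \<times>\<^sub>3 (Q *v y)"
    using Q by (rule cross_rotation_matrix[symmetric])
  have "orthogonal_transformation ((*v) Q)"
    using Q by (simp add: orthogonal_transformation_matrix rotation_matrix_def matrix_vector_mul_linear)
  then show "(Q *v x) \<bullet> (Q *v y) = x \<bullet> y"
    unfolding orthogonal_transformation_def by blast
qed

lemma rotf_matrix:
  assumes "rotf f" shows "rotation_matrix (matrix f)" and "matrix f *v x = f x"
proof -
  show "matrix f *v x = f x" for x
    using assms by (simp add: matrix_works rotf_linear)
  have "orthogonal_transformation f"
    using assms by (simp add: orthogonal_transformation_def rotf_def)
  then have orth: "orthogonal_matrix (matrix f)"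
    by (simp add: orthogonal_transformation_matrix)
  have h: "f (x \<times>\<^sub>3 y) = f x \<times>\<^sub>3 f y" for x y
    using assms by (simp add: rotf_def)
  \<comment> \<open>For an orthogonal map the cross product of two images is the determinant times
    the image of the cross product. As \<open>f\<close> also respects cross products, one nonzero
    value forces determinant 1.\<close>
  have "f (axis 1 1 \<times>\<^sub>3 axis 2 1) = det (matrix f) *\<^sub>R f (axis 1 1 \<times>\<^sub>3 axis 2 1)"
    unfolding h[of "axis 1 1" "axis 2 1"]
    by (subst cross_orthogonal_transformation[OF \<open>orthogonal_transformation f\<close>]) (simp only: h)
  then have "(1 - det (matrix f)) *\<^sub>R f (axis 3 1) = 0"
    unfolding cross_basis by (simp add: scaleR_left_diff_distrib)
  moreover have "f (axis 3 1) \<noteq> 0"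
    using rotf_norm[OF assms, of "axis 3 1"] by (metis norm_axis_1 norm_zero zero_neq_one)
  ultimately have "det (matrix f) = 1" by simp
  with orth show "rotation_matrix (matrix f)" by (simp add: rotation_matrix_def)
qed

text \<open>The rows form a right-handed orthonormal frame, and the matrix yields the coordinates
  with respect to it.\<close>

lemma rotation_frame:
  assumes "norm u = 1" "norm w = 1" "u \<bullet> w = 0"
  shows "rotation_matrix (vector [u, w \<times>\<^sub>3 u, w] :: real ^ 3 ^ 3)"
proof -
  let ?N = "vector [u, w \<times>\<^sub>3 u, w] :: real ^ 3 ^ 3"
  have r: "row 1 ?N = u" "row 2 ?N = w \<times>\<^sub>3 u" "row 3 ?N = w"
    by (simp_all add: row_def vec_nth_inverse)
  have uu: "u \<bullet> u = 1" "w \<bullet> w = 1" using assms by (simp_all add: dot_square_norm)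
  have "(norm (w \<times>\<^sub>3 u))\<^sup>2 = 1"
    by (simp add: norm_cross assms inner_commute[of w u])
  then have "norm (w \<times>\<^sub>3 u) = 1" by (simp add: power2_eq_1_iff) (smt (verit) norm_ge_zero)
  then have "orthogonal_matrix ?N"
    using assms by (auto simp: orthogonal_matrix_orthonormal_rows forall_3 r orthogonal_def dot_cross_self inner_commute[of w u])
  moreover have "det ?N = u \<bullet> ((w \<times>\<^sub>3 u) \<times>\<^sub>3 w)"
    by (simp add: dot_cross_det)
  moreover have "u \<bullet> ((w \<times>\<^sub>3 u) \<times>\<^sub>3 w) = 1"
    using assms by (simp add: cross3_cross3_left uu inner_diff_right inner_commute[of w u])
  ultimately show ?thesis by (simp add: rotation_matrix_def)
qed

lemma vector3_mult: "(vector [a, b, c] :: real ^ 3 ^ 3) *v x = vector [a \<bullet> x, b \<bullet> x, c \<bullet> x]"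
  by (simp add: vec_eq_iff forall_3 matrix_vector_mult_def inner_vec_def)

text \<open>The frame \<open>fr\<close> is made from the vectors at \<open>e\<close> and
  \<open>f\<close> and their normal. Coordinates in it are combinations of inner and triple
  products, hence equal for \<open>a\<close> and \<open>b\<close>, and the rotation between the two
  frames works. The triple products exclude a reflection.\<close>

lemma congruent_by_rotation:
  fixes a b :: "'e \<Rightarrow> real ^ 3"
  assumes nz: "a e \<times>\<^sub>3 a f \<noteq> 0"
    and inn: "\<And>g h. a g \<bullet> a h = b g \<bullet> b h"
    and tri: "\<And>g h k. a g \<bullet> (a h \<times>\<^sub>3 a k) = b g \<bullet> (b h \<times>\<^sub>3 b k)"
  obtains Q where "rotf Q" "\<And>g. b g = Q (a g)"
proof -
  define fr where "fr c = (vector [sgn (c e), sgn (c e \<times>\<^sub>3 c f) \<times>\<^sub>3 sgn (c e), sgn (c e \<times>\<^sub>3 c f)] :: real ^ 3 ^ 3)"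
    for c :: "'e \<Rightarrow> real ^ 3"
  have nrm: "norm (a g) = norm (b g)" for g by (simp add: norm_eq_sqrt_inner inn)
  have "(norm (a g \<times>\<^sub>3 a h))\<^sup>2 = (norm (b g \<times>\<^sub>3 b h))\<^sup>2" for g h by (simp add: norm_cross nrm inn)
  then have nrmc: "norm (a g \<times>\<^sub>3 a h) = norm (b g \<times>\<^sub>3 b h)" for g h
    by (metis norm_ge_zero power2_eq_imp_eq)
  have fr: "rotation_matrix (fr c)" if "c e \<times>\<^sub>3 c f \<noteq> 0" for c
  proof -
    have "c e \<noteq> 0" using that by auto
    with that show ?thesis
      unfolding fr_def by (intro rotation_frame) (auto simp: norm_sgn sgn_div_norm dot_cross_self)
  qed
  have nzb: "b e \<times>\<^sub>3 b f \<noteq> 0" using nz nrmc[of e f] by auto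
  have eq: "fr a *v a g = fr b *v b g" for g
  proof -
    have 1: "sgn (a e) \<bullet> a g = sgn (b e) \<bullet> b g" by (simp add: sgn_div_norm nrm inn)
    have 2: "sgn (a e \<times>\<^sub>3 a f) \<bullet> a g = sgn (b e \<times>\<^sub>3 b f) \<bullet> b g"
      using tri[of g e f] by (simp add: sgn_div_norm nrmc inner_commute)
    have 3: "(sgn (a e \<times>\<^sub>3 a f) \<times>\<^sub>3 sgn (a e)) \<bullet> a g = (sgn (b e \<times>\<^sub>3 b f) \<times>\<^sub>3 sgn (b e)) \<bullet> b g"
      by (simp add: sgn_div_norm nrm nrmc cross_mult_left cross_mult_right cross3_cross3_left inner_diff_left inn)
    show ?thesis unfolding fr_def vector3_mult 1 2 3 ..
  qed
  let ?Q = "transpose (fr b) ** fr a"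
  have "rotation_matrix ?Q"
    using fr[OF nz] fr[OF nzb] unfolding rotation_matrix_def
    by (metis det_mul det_transpose mult_1 orthogonal_matrix_mul orthogonal_matrix_transpose)
  moreover have "b g = ?Q *v a g" for g
  proof -
    have "?Q *v a g = transpose (fr b) *v (fr b *v b g)"
      by (simp add: matrix_vector_mul_assoc[symmetric] eq)
    also have "\<dots> = b g"
      using fr[OF nzb] by (simp add: matrix_vector_mul_assoc orthogonal_matrix rotation_matrix_def)
    finally show ?thesis ..
  qed
  ultimately show thesis using that[of "(*v) ?Q"] rotf_mult_vec by blast
qed

section \<open>Classes of polygons\<close>

lemma PolT_rotf:
  assumes "rotf f" "\<rho> \<in> PolT len" "\<And>e. \<sigma> $ e = f (\<rho> $ e)"
  shows "\<sigma> \<in> PolT len"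
  using assms by (simp add: PolT_def rotf_norm rotf_sum linear_0 rotf_linear)

lemma so3_rel_rotf:
  "(\<rho>, \<sigma>) \<in> so3_rel len \<longleftrightarrow> \<rho> \<in> PolT len \<and> (\<exists>f. rotf f \<and> (\<forall>e. \<sigma> $ e = f (\<rho> $ e)))" (is "?L \<longleftrightarrow> ?R")
proof
  assume ?L then show ?R unfolding so3_rel_def using rotf_mult_vec by blast
next
  assume ?R
  then obtain f where f: "\<rho> \<in> PolT len" "rotf f" "\<forall>e. \<sigma> $ e = f (\<rho> $ e)" by blast
  with PolT_rotf[of f \<rho> len \<sigma>] rotf_matrix[of f] show ?L
    unfolding so3_rel_def by auto
qed

lemma equiv_so3_rel: "equiv (PolT len) (so3_rel len)"
proof (rule equivI)
  show "so3_rel len \<subseteq> PolT len \<times> PolT len" by (auto simp: so3_rel_def)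
  show "refl_on (PolT len) (so3_rel len)"
    unfolding refl_on_def using rotf_id by (auto simp: so3_rel_rotf)
  show "sym (so3_rel len)"
  proof (rule symI)
    fix \<rho> \<sigma> assume "(\<rho>, \<sigma>) \<in> so3_rel len"
    then obtain Q where Q: "\<rho> \<in> PolT len" "\<sigma> \<in> PolT len" "rotation_matrix Q" "\<forall>e. \<sigma> $ e = Q *v (\<rho> $ e)"
      unfolding so3_rel_def by blast
    then have "rotation_matrix (transpose Q)"
      by (simp add: rotation_matrix_def orthogonal_matrix_transpose det_transpose)
    moreover have "\<rho> $ e = transpose Q *v (\<sigma> $ e)" for e
      using Q by (simp add: matrix_vector_mul_assoc orthogonal_matrix rotation_matrix_def)
    ultimately show "(\<sigma>, \<rho>) \<in> so3_rel len"
      unfolding so3_rel_def using Q by blast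
  qed
  show "trans (so3_rel len)"
  proof (rule transI)
    fix \<rho> \<sigma> \<tau> assume "(\<rho>, \<sigma>) \<in> so3_rel len" "(\<sigma>, \<tau>) \<in> so3_rel len"
    then obtain f g where "\<rho> \<in> PolT len" "rotf f" "\<forall>e. \<sigma> $ e = f (\<rho> $ e)" "rotf g" "\<forall>e. \<tau> $ e = g (\<sigma> $ e)"
      unfolding so3_rel_rotf by blast
    moreover from this have "rotf (\<lambda>x. g (f x)) \<and> (\<forall>e. \<tau> $ e = g (f (\<rho> $ e)))"
      by (simp add: rotf_comp)
    ultimately show "(\<rho>, \<tau>) \<in> so3_rel len"
      unfolding so3_rel_rotf by blast
  qed
qed

lemma pol_class_eq_iff:
  assumes "\<rho> \<in> PolT len" "\<sigma> \<in> PolT len"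
  shows "pol_class len \<rho> = pol_class len \<sigma> \<longleftrightarrow> (\<exists>f. rotf f \<and> (\<forall>e. \<sigma> $ e = f (\<rho> $ e)))"
  unfolding pol_class_def eq_equiv_class_iff[OF equiv_so3_rel assms] so3_rel_rotf using assms(1) by blast

lemma pol_class_mem [simp]: "\<rho> \<in> PolT len \<Longrightarrow> pol_class len \<rho> \<in> Pol len"
  by (simp add: pol_class_def Pol_def quotientI)

lemma Pol_cases:
  assumes "p \<in> Pol len" obtains \<rho> where "\<rho> \<in> PolT len" "p = pol_class len \<rho>"
  using assms unfolding Pol_def by (rule quotientE) (rule that, simp_all add: pol_class_def)

section \<open>Bending a block\<close>

definition bsum :: "'e::finite set \<Rightarrow> real ^ 3 ^ 'e \<Rightarrow> real ^ 3" where
  "bsum I \<rho> = (\<Sum>e\<in>I. \<rho> $ e)"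

text \<open>If \<open>bsum I \<rho> = 0\<close>, then \<open>sgn\<close> returns 0 and the block is
  merely scaled by \<open>Re z\<close>; hence the nonvanishing assumptions in what follows.\<close>

definition bend :: "'e::finite set \<Rightarrow> complex \<Rightarrow> real ^ 3 ^ 'e \<Rightarrow> real ^ 3 ^ 'e" where
  "bend I z \<rho> = (\<chi> e. if e \<in> I then rot z (sgn (bsum I \<rho>)) (\<rho> $ e) else \<rho> $ e)"

lemma bsum_UNIV: "\<rho> \<in> PolT len \<Longrightarrow> bsum UNIV \<rho> = 0"
  by (simp add: PolT_def bsum_def)

lemma bsum_Un: "I \<inter> J = {} \<Longrightarrow> bsum (I \<union> J) \<rho> = bsum I \<rho> + bsum J \<rho>"
  by (simp add: bsum_def sum.union_disjoint)

lemma bsum_Compl: "\<rho> \<in> PolT len \<Longrightarrow> bsum (- I) \<rho> = - bsum I \<rho>"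
  using bsum_Un[of I "- I" \<rho>] bsum_UNIV[of \<rho> len] by (simp add: add_eq_0_iff)

lemma bsum_rotf:
  assumes "rotf f" "\<And>e. \<sigma> $ e = f (\<rho> $ e)" shows "bsum I \<sigma> = f (bsum I \<rho>)"
  using assms by (simp add: bsum_def rotf_sum)

lemma bsum_rotf_on:
  assumes "rotf f" "\<And>e. e \<in> I \<Longrightarrow> \<sigma> $ e = f (\<rho> $ e)" shows "bsum I \<sigma> = f (bsum I \<rho>)"
proof -
  have "bsum I \<sigma> = (\<Sum>e\<in>I. f (\<rho> $ e))" unfolding bsum_def using assms(2) by (intro sum.cong) auto
  with assms show ?thesis by (simp add: bsum_def rotf_sum)
qed

lemma bend_nth: "bend I z \<rho> $ e = (if e \<in> I then rot z (sgn (bsum I \<rho>)) (\<rho> $ e) else \<rho> $ e)"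
  by (simp add: bend_def)

lemma rotf_axis:
  assumes "bsum I \<rho> \<noteq> 0" "norm z = 1" shows "rotf (rot z (sgn (bsum I \<rho>)))"
  using assms by (intro rotf_rot) (simp_all add: norm_sgn)

lemma rot_sgn_self: "v \<noteq> 0 \<Longrightarrow> rot z (sgn v) v = v"
proof -
  assume "v \<noteq> 0"
  then have v: "v = norm v *\<^sub>R sgn v" by (simp add: sgn_div_norm)
  have "rot z (sgn v) (norm v *\<^sub>R sgn v) = norm v *\<^sub>R sgn v"
    using rot_axis[of "sgn v" z] \<open>v \<noteq> 0\<close> by (simp add: linear_scale[OF linear_rot] norm_sgn)
  with v show ?thesis by metis
qed

lemma bsum_bend_subset:
  assumes "bsum I \<rho> \<noteq> 0" "norm z = 1" "J \<subseteq> I"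
  shows "bsum J (bend I z \<rho>) = rot z (sgn (bsum I \<rho>)) (bsum J \<rho>)"
  using assms by (intro bsum_rotf_on rotf_axis) (auto simp: bend_nth)

lemma bsum_bend_disjoint: "I \<inter> J = {} \<Longrightarrow> bsum J (bend I z \<rho>) = bsum J \<rho>"
  unfolding bsum_def by (intro sum.cong) (auto simp: bend_nth)

lemma bsum_bend_self:
  assumes "bsum I \<rho> \<noteq> 0" "norm z = 1"
  shows "bsum I (bend I z \<rho>) = bsum I \<rho>"
  using assms by (simp add: bsum_bend_subset rot_sgn_self)

lemma bsum_bend_superset:
  assumes "bsum I \<rho> \<noteq> 0" "norm z = 1" "I \<subseteq> J"
  shows "bsum J (bend I z \<rho>) = bsum J \<rho>"
proof -
  have J: "J = I \<union> (J - I)" "I \<inter> (J - I) = {}" using assms(3) by auto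
  show ?thesis
    by (subst (1 2) J(1)) (simp only: bsum_Un[OF J(2)] bsum_bend_self[OF assms(1,2)] bsum_bend_disjoint[OF J(2)])
qed

lemma norm_bend:
  assumes "bsum I \<rho> \<noteq> 0" "norm z = 1" shows "norm (bend I z \<rho> $ e) = norm (\<rho> $ e)"
  using rotf_norm[OF rotf_axis[OF assms]] by (simp add: bend_nth)

lemma bend_PolT:
  assumes "\<rho> \<in> PolT len" "bsum I \<rho> \<noteq> 0" "norm z = 1" shows "bend I z \<rho> \<in> PolT len"
  using assms bsum_bend_superset[OF assms(2,3), of UNIV] norm_bend[OF assms(2,3)]
  by (simp add: PolT_def bsum_def)

lemma bend_one [simp]: "bend I 1 \<rho> = \<rho>"
  by (simp add: vec_eq_iff[of "bend I 1 \<rho>"] bend_nth)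

lemma bend_bend:
  assumes "bsum I \<rho> \<noteq> 0" "norm w = 1"
  shows "bend I z (bend I w \<rho>) = bend I (z * w) \<rho>"
  using assms
  by (simp add: vec_eq_iff[of "bend I z (bend I w \<rho>)"] bend_nth bsum_bend_self rot_rot norm_sgn)

lemma bend_rotf:
  assumes "rotf f" "\<And>e. \<sigma> $ e = f (\<rho> $ e)"
  shows "bend I z \<sigma> $ e = f (bend I z \<rho> $ e)"
  using assms by (simp add: bend_nth bsum_rotf[OF assms] rotf_sgn rotf_rot_commute)

lemma bend_commute_disjoint:
  assumes "I \<inter> J = {}" shows "bend I z (bend J w \<rho>) = bend J w (bend I z \<rho>)"
proof -
  have "J \<inter> I = {}" using assms by auto
  with assms show ?thesis
    by (auto simp add: vec_eq_iff[of "bend I z (bend J w \<rho>)"] bend_nth bsum_bend_disjoint)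
qed

text \<open>Bending the outer block carries the axis of \<open>I\<close> along, and a rotation
  conjugates the rotation about an axis into the one about the rotated axis. Conversely, bending
  \<open>I\<close> leaves the sum over \<open>J\<close> alone.\<close>

lemma bend_commute_subset:
  assumes "I \<subseteq> J" "bsum I \<rho> \<noteq> 0" "bsum J \<rho> \<noteq> 0" "norm z = 1" "norm w = 1"
  shows "bend I z (bend J w \<rho>) = bend J w (bend I z \<rho>)"
  unfolding vec_eq_iff[of "bend I z (bend J w \<rho>)"]
proof
  fix e
  note r = rotf_axis[OF assms(3,5)]
  have "rot z (sgn (bsum I (bend J w \<rho>))) (rot w (sgn (bsum J \<rho>)) x)
      = rot w (sgn (bsum J \<rho>)) (rot z (sgn (bsum I \<rho>)) x)" for x
    by (simp add: bsum_bend_subset[OF assms(3,5,1)] rotf_sgn[OF r] rotf_rot_commute[OF r])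
  then show "bend I z (bend J w \<rho>) $ e = bend J w (bend I z \<rho>) $ e"
    using assms(1) by (auto simp: bend_nth bsum_bend_superset[OF assms(2,4,1)])
qed

text \<open>The axes of the two blocks are opposite, so a global rotation undoes one bending and performs the other.\<close>

lemma bend_Compl:
  assumes "\<rho> \<in> PolT len" "bsum I \<rho> \<noteq> 0" "norm z = 1"
  shows "\<exists>f. rotf f \<and> (\<forall>e. bend (- I) z \<rho> $ e = f (bend I z \<rho> $ e))"
proof -
  let ?u = "sgn (bsum I \<rho>)"
  have u: "norm ?u = 1" using assms by (simp add: norm_sgn)
  have s: "sgn (bsum (- I) \<rho>) = - ?u" using bsum_Compl[OF assms(1)] by (simp add: sgn_minus)
  have m: "rot z (- ?u) x = rot (cnj z) ?u x" for x by (simp add: rot_def)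
  have z: "cnj z * z = 1" using assms(3) by (metis complex_norm_square mult.commute of_real_1 one_power2)
  have "rotf (rot z (- ?u))" using u assms(3) by (intro rotf_rot) auto
  moreover have "bend (- I) z \<rho> $ e = rot z (- ?u) (bend I z \<rho> $ e)" for e
    by (auto simp: bend_nth s) (simp add: m rot_rot[OF u] z)
  ultimately show ?thesis by blast
qed

section \<open>Rotation-equivariant maps of polygons and the maps that they induce on
  classes\<close>

definition equivariant :: "('e::finite \<Rightarrow> real) \<Rightarrow> (real ^ 3 ^ 'e \<Rightarrow> real ^ 3 ^ 'e) \<Rightarrow> bool" where
  "equivariant len \<psi> \<longleftrightarrow> \<psi> ` PolT len \<subseteq> PolT len \<and>
     (\<forall>f. rotf f \<longrightarrow> (\<forall>\<rho>\<in>PolT len. \<forall>\<sigma>. (\<forall>e. \<sigma> $ e = f (\<rho> $ e)) \<longrightarrow> (\<forall>e. \<psi> \<sigma> $ e = f (\<psi> \<rho> $ e))))"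

lemma equivariantI:
  assumes "\<And>\<rho>. \<rho> \<in> PolT len \<Longrightarrow> \<psi> \<rho> \<in> PolT len"
    "\<And>f \<rho> \<sigma> e. rotf f \<Longrightarrow> \<rho> \<in> PolT len \<Longrightarrow> (\<And>e. \<sigma> $ e = f (\<rho> $ e)) \<Longrightarrow> \<psi> \<sigma> $ e = f (\<psi> \<rho> $ e)"
  shows "equivariant len \<psi>"
  unfolding equivariant_def
proof (intro conjI allI impI ballI)
  show "\<psi> ` PolT len \<subseteq> PolT len" using assms(1) by blast
  fix f \<rho> \<sigma> e assume "rotf f" "\<rho> \<in> PolT len" "\<forall>e. \<sigma> $ e = f (\<rho> $ e)"
  then show "\<psi> \<sigma> $ e = f (\<psi> \<rho> $ e)" by (intro assms(2)) (assumption, assumption, rule spec)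
qed

lemma equivariantD: "equivariant len \<psi> \<Longrightarrow> \<rho> \<in> PolT len \<Longrightarrow> \<psi> \<rho> \<in> PolT len"
  by (simp add: equivariant_def image_subset_iff)

lemma equivariant_rotf:
  assumes "equivariant len \<psi>" "rotf f" "\<rho> \<in> PolT len" "\<And>e. \<sigma> $ e = f (\<rho> $ e)"
  shows "\<psi> \<sigma> $ e = f (\<psi> \<rho> $ e)"
  by (rule assms(1)[unfolded equivariant_def, THEN conjunct2, rule_format, OF assms(2,3)]) (rule assms(4))

lemma equivariant_comp:
  assumes "equivariant len \<phi>" "equivariant len \<psi>" shows "equivariant len (\<lambda>\<rho>. \<phi> (\<psi> \<rho>))"
proof (rule equivariantI)
  show "\<phi> (\<psi> \<rho>) \<in> PolT len" if "\<rho> \<in> PolT len" for \<rho>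
    using that by (blast intro: equivariantD[OF assms(1)] equivariantD[OF assms(2)])
  fix f \<rho> \<sigma> e assume *: "rotf f" "\<rho> \<in> PolT len" "\<And>e. \<sigma> $ e = f (\<rho> $ e)"
  show "\<phi> (\<psi> \<sigma>) $ e = f (\<phi> (\<psi> \<rho>) $ e)"
    by (rule equivariant_rotf[OF assms(1) *(1) equivariantD[OF assms(2) *(2)]])
      (rule equivariant_rotf[OF assms(2) *])
qed

text \<open>For an equivariant \<open>\<psi>\<close> all members of the union are the same class, so
  no representative has to be chosen. The restriction provides the extensionality that
  \<open>Bij\<close> and the flows ask for.\<close>

definition class_map :: "('e::finite \<Rightarrow> real) \<Rightarrow> (real ^ 3 ^ 'e \<Rightarrow> real ^ 3 ^ 'e) \<Rightarrow> (real ^ 3 ^ 'e) set \<Rightarrow> (real ^ 3 ^ 'e) set" where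
  "class_map len \<psi> = (\<lambda>p\<in>Pol len. \<Union>\<rho>\<in>p. pol_class len (\<psi> \<rho>))"

lemma class_map:
  assumes "equivariant len \<psi>" "\<rho> \<in> PolT len"
  shows "class_map len \<psi> (pol_class len \<rho>) = pol_class len (\<psi> \<rho>)"
proof -
  have "pol_class len (\<psi> \<sigma>) = pol_class len (\<psi> \<rho>)" if "\<sigma> \<in> pol_class len \<rho>" for \<sigma>
  proof -
    have "(\<rho>, \<sigma>) \<in> so3_rel len" using that by (simp add: pol_class_def)
    then obtain f where f: "rotf f" "\<forall>e. \<sigma> $ e = f (\<rho> $ e)"
      unfolding so3_rel_rotf by blast
    then have f': "\<forall>e. \<psi> \<sigma> $ e = f (\<psi> \<rho> $ e)"
      by (intro allI equivariant_rotf[OF assms(1) f(1) assms(2)]) simp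
    have "\<psi> \<rho> \<in> PolT len" using assms by (rule equivariantD)
    moreover have "\<psi> \<sigma> \<in> PolT len"
      by (rule PolT_rotf[OF f(1) \<open>\<psi> \<rho> \<in> PolT len\<close>]) (simp add: f')
    ultimately show ?thesis
      using f(1) f' by (subst eq_commute, subst pol_class_eq_iff) blast+
  qed
  moreover have "\<rho> \<in> pol_class len \<rho>"
    using assms(2) equiv_class_self[OF equiv_so3_rel] by (simp add: pol_class_def)
  ultimately have "(\<Union>\<sigma>\<in>pol_class len \<rho>. pol_class len (\<psi> \<sigma>)) = pol_class len (\<psi> \<rho>)"
    by (intro UN_constant_eq) blast+
  with assms(2) show ?thesis by (simp add: class_map_def)
qed

lemma class_map_extensional [simp]: "class_map len \<psi> \<in> extensional (Pol len)"
  by (simp add: class_map_def)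

lemma class_map_eqI:
  assumes "f \<in> extensional (Pol len)" "equivariant len \<psi>"
    "\<And>\<rho>. \<rho> \<in> PolT len \<Longrightarrow> f (pol_class len \<rho>) = pol_class len (\<psi> \<rho>)"
  shows "f = class_map len \<psi>"
proof (rule extensionalityI[OF assms(1)])
  fix p assume "p \<in> Pol len"
  then obtain \<rho> where "\<rho> \<in> PolT len" "p = pol_class len \<rho>" by (rule Pol_cases)
  then show "f p = class_map len \<psi> p" by (simp add: assms class_map)
qed simp

lemma class_map_comp:
  assumes "equivariant len \<phi>" "equivariant len \<psi>"
  shows "compose (Pol len) (class_map len \<phi>) (class_map len \<psi>) = class_map len (\<lambda>\<rho>. \<phi> (\<psi> \<rho>))"
  by (rule class_map_eqI)
    (simp_all add: compose_eq class_map assms equivariantD[OF assms(1)] equivariantD[OF assms(2)] equivariant_comp)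

lemma class_map_cong:
  assumes "\<And>\<rho>. \<rho> \<in> PolT len \<Longrightarrow> \<exists>f. rotf f \<and> (\<forall>e. \<psi> \<rho> $ e = f (\<phi> \<rho> $ e))"
    "equivariant len \<phi>" "equivariant len \<psi>"
  shows "class_map len \<phi> = class_map len \<psi>"
  by (rule class_map_eqI)
    (simp_all add: class_map assms equivariantD[OF assms(2)] equivariantD[OF assms(3)] pol_class_eq_iff)

lemma equivariant_bend:
  assumes "\<And>\<rho>. \<rho> \<in> PolT len \<Longrightarrow> bsum I \<rho> \<noteq> 0" "norm z = 1"
  shows "equivariant len (bend I z)"
  by (rule equivariantI) (rule bend_PolT bend_rotf, simp_all add: assms)+

lemma equivariant_id: "equivariant len (\<lambda>\<rho>. \<rho>)"
  by (simp add: equivariant_def)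

text \<open>The dominating vector is too long to be cancelled by the others.\<close>

lemma lopsided_bsum_nonzero:
  assumes "lopsided len I" "\<rho> \<in> PolT len" shows "bsum I \<rho> \<noteq> 0"
proof
  assume z: "bsum I \<rho> = 0"
  obtain e0 where e0: "e0 \<in> I" "len e0 > (\<Sum>e\<in>I - {e0}. len e)"
    using assms(1) by (auto simp: lopsided_def)
  have n: "\<And>e. norm (\<rho> $ e) = len e" using assms(2) by (simp add: PolT_def)
  have "\<rho> $ e0 = - (\<Sum>e\<in>I - {e0}. \<rho> $ e)"
    using z e0(1) by (simp add: bsum_def sum.remove add_eq_0_iff2)
  then have "len e0 \<le> (\<Sum>e\<in>I - {e0}. len e)"
    using norm_sum[of "\<lambda>e. \<rho> $ e" "I - {e0}"] n[of e0] by (simp add: n)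
  with e0(2) show False by simp
qed

text \<open>The dominating element still dominates after others have been removed. This supplies the
  nested lopsided sets of the lower bound.\<close>

lemma lopsided_subset:
  assumes "\<And>e. len e > 0" "lopsided len I" shows "\<exists>e0\<in>I. \<forall>J. J \<subseteq> I \<longrightarrow> e0 \<in> J \<longrightarrow> lopsided len J"
proof -
  obtain e0 where e0: "e0 \<in> I" "len e0 > (\<Sum>e\<in>I - {e0}. len e)"
    using assms(2) by (auto simp: lopsided_def)
  have "lopsided len J" if "J \<subseteq> I" "e0 \<in> J" for J
  proof -
    have "(\<Sum>e\<in>J - {e0}. len e) \<le> (\<Sum>e\<in>I - {e0}. len e)"
      using that assms(1) by (intro sum_mono2) (auto simp: less_imp_le)
    with e0 that show ?thesis unfolding lopsided_def by (intro bexI[of _ e0]) linarith+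
  qed
  with e0 show ?thesis by blast
qed

lemma lopsided_singleton: "len e > 0 \<Longrightarrow> lopsided len {e}"
  by (simp add: lopsided_def)

locale polygon_space =
  fixes len :: "'e::finite \<Rightarrow> real"
  assumes len_pos: "\<And>e. len e > 0"
    and generic: "generic len"
    and nonempty: "PolT len \<noteq> {}"
begin

lemma PolT_norm: "\<rho> \<in> PolT len \<Longrightarrow> norm (\<rho> $ e) = len e"
  by (simp add: PolT_def)

lemma PolT_nonzero: "\<rho> \<in> PolT len \<Longrightarrow> \<rho> $ e \<noteq> 0"
  using PolT_norm[of \<rho> e] len_pos[of e] by auto

text \<open>On a line every edge is a signed multiple of one vector, and closing up would be a
  choice of signs that \<open>generic\<close> forbids.\<close>

lemma not_on_line:
  assumes \<rho>: "\<rho> \<in> PolT len" and u: "u \<noteq> 0" shows "\<exists>e. u \<times>\<^sub>3 (\<rho> $ e) \<noteq> 0"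
proof (rule ccontr)
  assume "\<not> ?thesis"
  then have "u \<times>\<^sub>3 (u \<times>\<^sub>3 (\<rho> $ e)) = 0" for e by simp
  then have "(u \<bullet> \<rho> $ e) *\<^sub>R u = (u \<bullet> u) *\<^sub>R \<rho> $ e" for e by (simp add: Lagrange)
  then have r: "\<rho> $ e = ((u \<bullet> \<rho> $ e) / (u \<bullet> u)) *\<^sub>R u" for e
  proof -
    have "((u \<bullet> \<rho> $ e) / (u \<bullet> u)) *\<^sub>R u = (1 / (u \<bullet> u)) *\<^sub>R ((u \<bullet> \<rho> $ e) *\<^sub>R u)" by simp
    also have "\<dots> = \<rho> $ e" using u by (simp only: \<open>(u \<bullet> \<rho> $ e) *\<^sub>R u = (u \<bullet> u) *\<^sub>R \<rho> $ e\<close>) simp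
    finally show ?thesis ..
  qed
  define c where "c e = (u \<bullet> \<rho> $ e) / (u \<bullet> u)" for e
  have c: "\<rho> $ e = c e *\<^sub>R u" for e using r[of e] by (simp add: c_def)
  have ln: "len e = \<bar>c e\<bar> * norm u" for e using PolT_norm[OF \<rho>, of e] by (simp add: c)
  have "(\<Sum>e\<in>UNIV. c e) *\<^sub>R u = 0" using \<rho> by (simp add: PolT_def c scaleR_left.sum)
  then have "(\<Sum>e\<in>UNIV. c e) = 0" using u by simp
  moreover have "c e = sgn (c e) * len e / norm u" for e
    using u sgn_mult_abs[of "c e"] by (simp add: ln)
  ultimately have "(\<Sum>e\<in>UNIV. sgn (c e) * len e / norm u) = 0" by simp
  then have "(\<Sum>e\<in>UNIV. sgn (c e) * len e) = 0"
    using u by (simp flip: sum_divide_distrib)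
  moreover have "sgn (c e) \<in> {1, -1}" for e
  proof -
    have "c e \<noteq> 0" using ln[of e] len_pos[of e] by auto
    then show ?thesis by (auto simp: sgn_if)
  qed
  ultimately have "(\<forall>e. sgn (c e) \<in> {1, -1}) \<and> (\<Sum>e\<in>UNIV. sgn (c e) * len e) = 0" by blast
  then show False using generic[unfolded generic_def, THEN notE, OF exI[of _ "\<lambda>e. sgn (c e)"]] by simp
qed

lemma not_collinear:
  assumes "\<rho> \<in> PolT len" obtains f where "\<rho> $ e \<times>\<^sub>3 (\<rho> $ f) \<noteq> 0"
proof -
  from not_on_line[OF assms PolT_nonzero[OF assms, of e]]
  obtain f where "\<rho> $ e \<times>\<^sub>3 (\<rho> $ f) \<noteq> 0" ..
  then show thesis by (rule that)
qed

end

lemma the_elem_image_class: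
  assumes "\<rho> \<in> PolT len" "\<And>f \<rho> \<sigma>. rotf f \<Longrightarrow> \<forall>e. \<sigma> $ e = f (\<rho> $ e) \<Longrightarrow> F \<sigma> = F \<rho>"
  shows "the_elem (F ` pol_class len \<rho>) = F \<rho>"
proof -
  have "F \<sigma> = F \<rho>" if "\<sigma> \<in> pol_class len \<rho>" for \<sigma>
  proof -
    have "(\<rho>, \<sigma>) \<in> so3_rel len" using that by (simp add: pol_class_def)
    then obtain f where f: "rotf f" "\<forall>e. \<sigma> $ e = f (\<rho> $ e)"
      unfolding so3_rel_rotf by blast
    then show ?thesis by (rule assms(2))
  qed
  moreover have "\<rho> \<in> pol_class len \<rho>"
    using assms(1) equiv_class_self[OF equiv_so3_rel] by (simp add: pol_class_def)
  ultimately have "F ` pol_class len \<rho> = {F \<rho>}" by blast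
  then show ?thesis by simp
qed

lemma f_len_class:
  assumes "\<rho> \<in> PolT len" shows "f_len I (pol_class len \<rho>) = norm (bsum I \<rho>)"
  unfolding f_len_def bsum_def[symmetric]
proof (rule the_elem_image_class[OF assms])
  fix f :: "real ^ 3 \<Rightarrow> real ^ 3" and \<rho> \<sigma> :: "real ^ 3 ^ 'a"
  assume "rotf f" "\<forall>e. \<sigma> $ e = f (\<rho> $ e)"
  then show "norm (bsum I \<sigma>) = norm (bsum I \<rho>)" by (simp add: bsum_rotf rotf_norm)
qed

section \<open>Invariants and the topology of the polygon space\<close>

text \<open>Inner products (\<open>True\<close>) and triple products (\<open>False\<close>) share
  one index type, so that a class is encoded by a single function of the index.\<close>

definition invar :: "bool \<times> 'e \<times> 'e \<times> 'e \<Rightarrow> real ^ 3 ^ 'e::finite \<Rightarrow> real" where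
  "invar = (\<lambda>(b, e, f, g) \<rho>. if b then \<rho> $ e \<bullet> \<rho> $ f else \<rho> $ e \<bullet> (\<rho> $ f \<times>\<^sub>3 (\<rho> $ g)))"

lemma invar_rotf:
  assumes "rotf f" "\<forall>e. \<sigma> $ e = f (\<rho> $ e)" shows "invar i \<sigma> = invar i \<rho>"
proof -
  have "f x \<bullet> f y = x \<bullet> y" "f x \<times>\<^sub>3 f y = f (x \<times>\<^sub>3 y)" for x y
    using assms(1) by (simp_all add: rotf_def)
  then show ?thesis using assms(2) by (simp add: invar_def split: prod.split)
qed

text \<open>\<open>congruent_by_rotation\<close> asks for two edges that are not parallel;
  genericity provides them through \<open>not_collinear\<close>.\<close>

lemma (in polygon_space) pol_class_eq_invar:
  assumes "\<rho> \<in> PolT len" "\<sigma> \<in> PolT len"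
  shows "pol_class len \<rho> = pol_class len \<sigma> \<longleftrightarrow> (\<forall>i. invar i \<rho> = invar i \<sigma>)"
proof
  assume "pol_class len \<rho> = pol_class len \<sigma>"
  then obtain f where "rotf f" "\<forall>e. \<sigma> $ e = f (\<rho> $ e)"
    unfolding pol_class_eq_iff[OF assms] by blast
  then show "\<forall>i. invar i \<rho> = invar i \<sigma>" using invar_rotf[of f \<sigma> \<rho>] by simp
next
  assume i: "\<forall>i. invar i \<rho> = invar i \<sigma>"
  obtain e f where "\<rho> $ e \<times>\<^sub>3 (\<rho> $ f) \<noteq> 0" using not_collinear[OF assms(1)] by blast
  moreover have "\<rho> $ g \<bullet> \<rho> $ h = \<sigma> $ g \<bullet> \<sigma> $ h" for g h
    using i[rule_format, of "(True, g, h, h)"] by (simp add: invar_def)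
  moreover have "\<rho> $ g \<bullet> (\<rho> $ h \<times>\<^sub>3 (\<rho> $ k)) = \<sigma> $ g \<bullet> (\<sigma> $ h \<times>\<^sub>3 (\<sigma> $ k))" for g h k
    using i[rule_format, of "(False, g, h, k)"] by (simp add: invar_def)
  ultimately obtain Q where "rotf Q" "\<And>g. \<sigma> $ g = Q (\<rho> $ g)"
    using congruent_by_rotation[of "\<lambda>e. \<rho> $ e" e f "\<lambda>e. \<sigma> $ e"] by metis
  then show "pol_class len \<rho> = pol_class len \<sigma>"
    unfolding pol_class_eq_iff[OF assms] by blast
qed

lemma topspace_pol_topology [simp]: "topspace (pol_topology len) = Pol len"
proof -
  have e: "{\<rho> \<in> PolT len. pol_class len \<rho> \<in> Pol len} = PolT len" by auto
  have "openin (pol_topology len) (Pol len)"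
    unfolding openin_pol_topology e using openin_topspace[of "top_of_set (PolT len)"] by simp
  then show ?thesis
    using openin_subset openin_topspace[of "pol_topology len"] openin_pol_topology by blast
qed

lemma quotient_map_pol_class: "quotient_map (top_of_set (PolT len)) (pol_topology len) (pol_class len)"
  unfolding quotient_map_def
proof (intro conjI allI impI)
  show "pol_class len ` topspace (top_of_set (PolT len)) = topspace (pol_topology len)"
    by (auto elim!: Pol_cases)
qed (simp add: openin_pol_topology)

lemma continuous_map_pol_class: "continuous_map (top_of_set (PolT len)) (pol_topology len) (pol_class len)"
  by (rule quotient_imp_continuous_map[OF quotient_map_pol_class])

lemma continuous_on_invar: "continuous_on S (invar i)"
proof -
  obtain b e f g where "i = (b, e, f, g)" by (cases i) blast
  then show ?thesis
    by (cases b) (simp_all add: invar_def continuous_on_inner continuous_on_cross continuous_on_component continuous_on_id)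
qed

text \<open>The invariants give a continuous injection into a product of real lines. The Hausdorff
  property later makes the inverse of the parametrisation of a torus continuous.\<close>

lemma (in polygon_space) Hausdorff_pol_topology: "Hausdorff_space (pol_topology len)"
proof -
  define F where "F p = (\<lambda>i. the_elem (invar i ` p))" for p :: "(real ^ 3 ^ 'e) set"
  have F: "F (pol_class len \<rho>) = (\<lambda>i. invar i \<rho>)" if "\<rho> \<in> PolT len" for \<rho>
    unfolding F_def using the_elem_image_class[OF that] invar_rotf by (intro ext) blast
  have "continuous_map (top_of_set (PolT len)) (product_topology (\<lambda>_. euclideanreal) UNIV) (F \<circ> pol_class len)"
    unfolding continuous_map_componentwise_UNIV
  proof
    fix i :: "bool \<times> 'e \<times> 'e \<times> 'e"
    have "continuous_map (top_of_set (PolT len)) euclideanreal (invar i)"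
      by (simp add: continuous_on_invar)
    then show "continuous_map (top_of_set (PolT len)) euclideanreal (\<lambda>x. (F \<circ> pol_class len) x i)"
      by (rule continuous_map_eq) (simp add: F)
  qed
  then have "continuous_map (pol_topology len) (product_topology (\<lambda>_. euclideanreal) UNIV) F"
    using continuous_compose_quotient_map_eq[OF quotient_map_pol_class] by blast
  moreover have "inj_on F (Pol len)"
  proof (rule inj_onI)
    fix p q assume "p \<in> Pol len" "q \<in> Pol len" and eq: "F p = F q"
    then obtain \<rho> \<sigma> where *: "\<rho> \<in> PolT len" "p = pol_class len \<rho>" "\<sigma> \<in> PolT len" "q = pol_class len \<sigma>"
      by (metis Pol_cases)
    have "\<forall>i. invar i \<rho> = invar i \<sigma>"
      using eq unfolding *(2,4) F[OF *(1)] F[OF *(3)] by (rule fun_cong[THEN allI])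
    with * show "p = q" by (simp add: pol_class_eq_invar)
  qed
  ultimately show ?thesis
    by (intro Hausdorff_space_injective_preimage[of "product_topology (\<lambda>_. euclideanreal) UNIV" _ F])
      (auto simp: Hausdorff_space_product_topology)
qed

section \<open>Tangent vectors\<close>

lemma bounded_bilinear_cross3: "bounded_bilinear (\<times>\<^sub>3)"
  using bilinear_cross by (simp add: bilinear_conv_bounded_bilinear)

lemma bounded_linear_bsum: "bounded_linear (bsum I)"
  unfolding bsum_def[abs_def] by (intro bounded_linear_sum bounded_linear_vec_nth)

lemmas bsum_diff = linear_diff[OF bounded_linear.linear[OF bounded_linear_bsum]]

lemma norm_bsum_le: "norm (bsum UNIV x) \<le> real CARD('e) * norm x" for x :: "real ^ 3 ^ 'e::finite"
proof -
  have "norm (bsum UNIV x) \<le> (\<Sum>e\<in>(UNIV::'e set). norm x)"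
    unfolding bsum_def by (intro sum_norm_le Finite_Cartesian_Product.norm_nth_le)
  then show ?thesis by simp
qed

lemma has_derivative_sgn:
  fixes x :: "'a::real_inner" assumes "x \<noteq> 0"
  shows "(sgn has_derivative (\<lambda>h. (h - (sgn x \<bullet> h) *\<^sub>R sgn x) /\<^sub>R norm x)) (at x)"
proof -
  have "((\<lambda>x. x /\<^sub>R norm x) has_derivative (\<lambda>h. (h - (sgn x \<bullet> h) *\<^sub>R sgn x) /\<^sub>R norm x)) (at x)"
    using assms
    by (auto intro!: derivative_eq_intros has_derivative_norm simp: sgn_div_norm fun_eq_iff algebra_simps power2_eq_square inner_commute)
  moreover have "sgn = (\<lambda>x::'a. x /\<^sub>R norm x)" by (auto simp: sgn_div_norm)
  ultimately show ?thesis by simp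
qed

lemma bounded_linear_axis: "bounded_linear (axis e :: 'b::euclidean_space \<Rightarrow> 'b ^ 'e::finite)"
  unfolding linear_conv_bounded_linear[symmetric]
  by (rule linearI) (simp_all add: axis_def vec_eq_iff)

lemma vec_lambda_eq_sum_axis: "(\<chi> e. v e) = (\<Sum>e\<in>UNIV. axis e (v e))"
  by (simp add: vec_eq_iff axis_def if_distrib sum_component cong: if_cong)

lemma has_derivative_vec_lambda:
  fixes f :: "'a::real_normed_vector \<Rightarrow> 'e::finite \<Rightarrow> 'b::euclidean_space"
  assumes "\<And>e. ((\<lambda>x. f x e) has_derivative (\<lambda>h. f' h e)) F"
  shows "((\<lambda>x. \<chi> e. f x e) has_derivative (\<lambda>h. \<chi> e. f' h e)) F"
  unfolding vec_lambda_eq_sum_axis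
  by (intro has_derivative_sum bounded_linear.has_derivative[OF bounded_linear_axis] assms)

definition oproj :: "real ^ 3 \<Rightarrow> real ^ 3 \<Rightarrow> real ^ 3" where
  "oproj u x = x - (u \<bullet> x) *\<^sub>R u"

lemma linear_oproj: "linear (oproj u)"
  by (rule linearI) (simp_all add: oproj_def inner_add_right algebra_simps)

lemma inner_oproj: "norm u = 1 \<Longrightarrow> u \<bullet> oproj u x = 0"
  by (simp add: oproj_def inner_diff_right dot_square_norm)

lemma oproj_inner_self: "norm u = 1 \<Longrightarrow> x \<bullet> oproj u x = oproj u x \<bullet> oproj u x"
  using inner_oproj[of u x] by (simp add: oproj_def[of u x] inner_diff_left)

lemma norm_oproj_le:
  assumes "norm u = 1" shows "norm (oproj u x) \<le> norm x"
proof -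
  have "(norm (oproj u x))\<^sup>2 = x \<bullet> oproj u x"
    by (simp add: oproj_inner_self[OF assms] power2_norm_eq_inner)
  also have "\<dots> = (norm x)\<^sup>2 - (u \<bullet> x)\<^sup>2"
    by (simp add: oproj_def inner_diff_right dot_square_norm power2_eq_square inner_commute)
  finally have "(norm (oproj u x))\<^sup>2 \<le> (norm x)\<^sup>2" by simp
  then show ?thesis by (rule power2_le_imp_le) simp
qed

context polygon_space
begin

lemma norm_sgn_PolT: "\<rho> \<in> PolT len \<Longrightarrow> norm (sgn (\<rho> $ e)) = 1"
  using PolT_nonzero by (simp add: norm_sgn)

lemma sgn_PolT: "\<rho> \<in> PolT len \<Longrightarrow> \<rho> $ e = len e *\<^sub>R sgn (\<rho> $ e)"
  using len_pos[of e] by (simp add: sgn_div_norm PolT_norm)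

text \<open>Pairing \<open>x\<close> with its image gives the sum of the squared norms of its
  projections, so a kernel vector is parallel to all edges. The map is the first-order change of the
  sum of the edges when all are shifted by \<open>x\<close> and rescaled to their lengths.\<close>

lemma sum_oproj_inverse:
  assumes \<rho>: "\<rho> \<in> PolT len"
  obtains N where "linear N" "\<And>x. N (\<Sum>e\<in>UNIV. oproj (sgn (\<rho> $ e)) x) = x"
    "\<And>x. (\<Sum>e\<in>UNIV. oproj (sgn (\<rho> $ e)) (N x)) = x"
proof -
  let ?M = "\<lambda>x. \<Sum>e\<in>UNIV. oproj (sgn (\<rho> $ e)) x"
  have lin: "linear ?M"
    by (intro linear_compose_sum ballI linear_oproj)
  have "inj ?M"
    unfolding linear_injective_0[OF lin]
  proof (intro allI impI)
    fix x assume "?M x = 0"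
    then have "(\<Sum>e\<in>UNIV. x \<bullet> oproj (sgn (\<rho> $ e)) x) = 0"
      by (simp flip: inner_sum_right)
    then have "(\<Sum>e\<in>UNIV. (norm (oproj (sgn (\<rho> $ e)) x))\<^sup>2) = 0"
      by (simp add: oproj_inner_self norm_sgn_PolT[OF \<rho>] power2_norm_eq_inner)
    then have "oproj (sgn (\<rho> $ e)) x = 0" for e
      by (simp add: sum_nonneg_eq_0_iff)
    then have xe: "x = (sgn (\<rho> $ e) \<bullet> x) *\<^sub>R sgn (\<rho> $ e)" for e by (simp add: oproj_def)
    have "x \<times>\<^sub>3 (\<rho> $ e) = 0" for e
      by (subst xe[of e], subst (2) sgn_PolT[OF \<rho>]) (simp add: cross_mult_left cross_mult_right)
    then show "x = 0" using not_on_line[OF \<rho>, of x] by auto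
  qed
  then obtain N where "linear N" "\<forall>x. N (?M x) = x" "\<forall>x. ?M (N x) = x"
    using linear_injective_isomorphism[OF lin] by blast
  then show thesis using that[of N] by simp
qed

lemma omega_kernel:
  assumes \<rho>: "\<rho> \<in> PolT len" and v: "v \<in> tangent \<rho>"
    and z: "\<And>w. w \<in> tangent \<rho> \<Longrightarrow> omega \<rho> v w = 0"
  shows "\<exists>a. \<forall>e. v $ e = a \<times>\<^sub>3 (\<rho> $ e)"
proof -
  define c where "c e = (1 / (\<rho> $ e \<bullet> \<rho> $ e)) *\<^sub>R (\<rho> $ e \<times>\<^sub>3 (v $ e))" for e
  have nz: "\<rho> $ e \<bullet> \<rho> $ e \<noteq> 0" for e using PolT_nonzero[OF \<rho>, of e] by simp
  have "v $ e \<bullet> \<rho> $ e = 0" for e using v by (simp add: tangent_def inner_commute)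
  then have cv: "c e \<times>\<^sub>3 (\<rho> $ e) = v $ e" for e
    using nz[of e] by (simp add: c_def cross_mult_left cross3_cross3_left)
  obtain N where "linear N" "\<And>x. N (\<Sum>e\<in>UNIV. oproj (sgn (\<rho> $ e)) x) = x"
    and N: "\<And>x. (\<Sum>e\<in>UNIV. oproj (sgn (\<rho> $ e)) (N x)) = x"
    by (rule sum_oproj_inverse[OF \<rho>], rule that)
  \<comment> \<open>\<open>a\<close> makes the parts of \<open>c e - a\<close> orthogonal to the
    edges add up to 0. They then form a tangent vector \<open>w\<close>, and
    \<open>omega \<rho> v w\<close> is the sum of their squared norms.\<close>
  define a where "a = N (\<Sum>e\<in>UNIV. oproj (sgn (\<rho> $ e)) (c e))"
  define w :: "real ^ 3 ^ 'e" where "w = (\<chi> e. oproj (sgn (\<rho> $ e)) (c e - a))"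
  have "(\<Sum>e\<in>UNIV. w $ e) = 0"
    by (simp add: w_def linear_diff[OF linear_oproj] sum_subtractf a_def N)
  moreover have orth: "\<rho> $ e \<bullet> w $ e = 0" for e
    using inner_oproj[OF norm_sgn_PolT[OF \<rho>, of e], of "c e - a"]
    by (subst sgn_PolT[OF \<rho>]) (simp add: w_def)
  ultimately have "w \<in> tangent \<rho>" by (simp add: tangent_def)
  then have "0 = omega \<rho> v w" using z by simp
  also have "\<dots> = (\<Sum>e\<in>UNIV. c e \<bullet> w $ e)"
    unfolding omega_def
    by (intro sum.cong refl) (metis cv kks_form_moment_map orth PolT_nonzero[OF \<rho>])
  also have "\<dots> = (\<Sum>e\<in>UNIV. (c e - a) \<bullet> w $ e) + a \<bullet> (\<Sum>e\<in>UNIV. w $ e)"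
    by (simp add: inner_diff_left sum_subtractf inner_sum_right)
  also have "\<dots> = (\<Sum>e\<in>UNIV. (norm (w $ e))\<^sup>2)"
    using \<open>(\<Sum>e\<in>UNIV. w $ e) = 0\<close>
    by (simp add: w_def oproj_inner_self norm_sgn_PolT[OF \<rho>] power2_norm_eq_inner)
  finally have "w $ e = 0" for e
    by (simp add: eq_commute[of 0] sum_nonneg_eq_0_iff)
  then have k: "c e - a = (sgn (\<rho> $ e) \<bullet> (c e - a)) *\<^sub>R sgn (\<rho> $ e)" for e
    using oproj_def[of "sgn (\<rho> $ e)" "c e - a"] by (simp add: w_def)
  have "(c e - a) \<times>\<^sub>3 (\<rho> $ e) = 0" for e
    by (subst k, subst (3) sgn_PolT[OF \<rho>]) (simp add: cross_mult_left cross_mult_right)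
  then have "v $ e = a \<times>\<^sub>3 (\<rho> $ e)" for e
    using cv[of e] by (simp add: Cross3.left_diff_distrib)
  then show ?thesis by blast
qed

text \<open>Tangent vectors are realised by polygons up to first order: rescaling \<open>\<rho> + t w + b\<close> to the
  prescribed lengths, a translation \<open>b\<close> of size \<open>o(t)\<close> that closes the polygon is a Brouwer fixed point.\<close>

lemma tangent_realised:
  assumes \<rho>: "\<rho> \<in> PolT len" and w: "w \<in> tangent \<rho>" and eps: "\<epsilon> > 0"
  shows "\<exists>\<delta>>0. \<forall>t. 0 < t \<and> t < \<delta> \<longrightarrow> (\<exists>\<sigma>\<in>PolT len. norm (\<sigma> - \<rho> - t *\<^sub>R w) \<le> \<epsilon> * t)"
proof -
  define n where "n = real CARD('e)"
  have n: "n \<ge> 1" by (simp add: n_def Suc_leI)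
  let ?P = "\<lambda>e. oproj (sgn (\<rho> $ e))"
  define \<Gamma> :: "real \<times> (real ^ 3) \<Rightarrow> real ^ 3 ^ 'e" where
    "\<Gamma> y = (\<chi> e. len e *\<^sub>R sgn (\<rho> $ e + fst y *\<^sub>R (w $ e) + snd y))" for y
  define L :: "real \<times> (real ^ 3) \<Rightarrow> real ^ 3 ^ 'e" where
    "L y = (\<chi> e. fst y *\<^sub>R (w $ e) + ?P e (snd y))" for y
  have ww: "sgn (\<rho> $ e) \<bullet> w $ e = 0" for e using w by (simp add: tangent_def sgn_div_norm)
  have "(\<Gamma> has_derivative L) (at 0)"
    unfolding \<Gamma>_def[abs_def] L_def[abs_def]
  proof (rule has_derivative_vec_lambda)
    fix e
    have "((\<lambda>y::real \<times> (real ^ 3). \<rho> $ e + fst y *\<^sub>R (w $ e) + snd y) has_derivative (\<lambda>y. fst y *\<^sub>R (w $ e) + snd y)) (at 0)"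
      by (auto intro!: derivative_eq_intros)
    then have "((\<lambda>y. sgn (\<rho> $ e + fst y *\<^sub>R (w $ e) + snd y)) has_derivative
        (\<lambda>y. ((fst y *\<^sub>R (w $ e) + snd y) - (sgn (\<rho> $ e) \<bullet> (fst y *\<^sub>R (w $ e) + snd y)) *\<^sub>R sgn (\<rho> $ e)) /\<^sub>R norm (\<rho> $ e))) (at 0)"
      using has_derivative_compose[of "\<lambda>y::real \<times> (real ^ 3). \<rho> $ e + fst y *\<^sub>R (w $ e) + snd y" "\<lambda>y. fst y *\<^sub>R (w $ e) + snd y" 0 UNIV sgn]
        has_derivative_sgn[OF PolT_nonzero[OF \<rho>, of e]] by simp
    from has_derivative_scaleR_right[OF this, of "len e"]
    show "((\<lambda>y. len e *\<^sub>R sgn (\<rho> $ e + fst y *\<^sub>R (w $ e) + snd y)) has_derivative (\<lambda>y. fst y *\<^sub>R (w $ e) + ?P e (snd y))) (at 0)"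
      using len_pos[of e] by (simp add: PolT_norm[OF \<rho>] oproj_def inner_add_right ww algebra_simps flip: mult.assoc)
  qed
  moreover have "\<Gamma> 0 = \<rho>" by (simp add: \<Gamma>_def vec_eq_iff[of _ \<rho>] flip: sgn_PolT[OF \<rho>])
  ultimately have der: "\<exists>d>0. \<forall>y. norm y < d \<longrightarrow> norm (\<Gamma> y - \<rho> - L y) \<le> \<eta> * norm y" if "\<eta> > 0" for \<eta>
    using that unfolding has_derivative_at_alt by simp
  obtain N where N: "linear N" "\<And>x. N (\<Sum>e\<in>UNIV. ?P e x) = x" "\<And>x. (\<Sum>e\<in>UNIV. ?P e (N x)) = x"
    by (rule sum_oproj_inverse[OF \<rho>], rule that)
  obtain K where K: "K > 0" "\<And>x. norm (N x) \<le> K * norm x"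
    by (rule linear_bounded_pos[OF N(1)], rule that)
  have SL: "bsum UNIV (L y) = (\<Sum>e\<in>UNIV. ?P e (snd y))" for y
    using w by (simp add: bsum_def L_def sum.distrib tangent_def flip: scaleR_sum_right)
  define \<epsilon>' where "\<epsilon>' = min 1 (\<epsilon> / (2 * n))"
  have \<epsilon>': "0 < \<epsilon>'" "\<epsilon>' \<le> 1" "n * \<epsilon>' \<le> \<epsilon> / 2"
  proof -
    show "0 < \<epsilon>'" "\<epsilon>' \<le> 1" using n eps by (simp_all add: \<epsilon>'_def)
    have "n * \<epsilon>' \<le> n * (\<epsilon> / (2 * n))" using n by (intro mult_left_mono) (auto simp: \<epsilon>'_def)
    then show "n * \<epsilon>' \<le> \<epsilon> / 2" using n by simp
  qed
  \<comment> \<open>\<open>\<eta>\<close> controls the remainder of \<open>\<Gamma>\<close>: the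
    bound by \<open>\<epsilon> / 4\<close> leaves it half of the final error, and the bound with
    \<open>K\<close> and \<open>n\<close> keeps the correction inside the ball of radius
    \<open>\<epsilon>' * t\<close>. The factors 2 come from
    \<open>norm (t, b) \<le> 2 * t\<close>.\<close>
  define \<eta> where "\<eta> = min (\<epsilon> / 4) (\<epsilon>' / (2 * K * n))"
  have \<eta>: "0 < \<eta>" "\<eta> * 2 \<le> \<epsilon> / 2" "K * n * \<eta> * 2 \<le> \<epsilon>'"
  proof -
    show "0 < \<eta>" "\<eta> * 2 \<le> \<epsilon> / 2" using n eps K \<epsilon>' by (simp_all add: \<eta>_def)
    have "(K * n * 2) * \<eta> \<le> (K * n * 2) * (\<epsilon>' / (2 * K * n))"
      using n K by (intro mult_left_mono) (auto simp: \<eta>_def)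
    also have "\<dots> = \<epsilon>'" using n K by simp
    finally show "K * n * \<eta> * 2 \<le> \<epsilon>'" by (simp add: mult_ac)
  qed
  obtain d where d: "d > 0" "\<And>y. norm y < d \<Longrightarrow> norm (\<Gamma> y - \<rho> - L y) \<le> \<eta> * norm y"
    using der[OF \<eta>(1)] by blast
  define m where "m = Min (range len)"
  have m: "m > 0" "\<And>e. m \<le> len e" using len_pos by (auto simp: m_def)
  \<comment> \<open>The first bound keeps \<open>(t, b)\<close> in the range of the derivative
    estimate, the second keeps every shifted edge nonzero, so that it can be rescaled.\<close>
  define \<delta> where "\<delta> = min (d / 2) (m / (norm w + 1))"
  have nw: "norm w + 1 > 0" by (simp add: add_nonneg_pos)
  have "\<delta> > 0" using d m nw by (simp add: \<delta>_def)
  moreover have "\<exists>\<sigma>\<in>PolT len. norm (\<sigma> - \<rho> - t *\<^sub>R w) \<le> \<epsilon> * t" if t: "0 < t" "t < \<delta>" for t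
  proof -
    have t': "2 * t < d" "t * (norm w + 1) < m"
      using t nw by (simp_all add: \<delta>_def pos_less_divide_eq)
    have bt: "norm b \<le> t" "norm (t, b) \<le> 2 * t" if "norm b \<le> \<epsilon>' * t" for b :: "real ^ 3"
    proof -
      have "\<epsilon>' * t \<le> 1 * t" using \<epsilon>'(2) t by (intro mult_right_mono) auto
      with that show "norm b \<le> t" by linarith
      then show "norm (t, b) \<le> 2 * t" using norm_Pair_le[of t b] t by simp
    qed
    have nz: "\<rho> $ e + t *\<^sub>R (w $ e) + b \<noteq> 0" if "norm b \<le> \<epsilon>' * t" for b e
    proof
      assume "\<rho> $ e + t *\<^sub>R (w $ e) + b = 0"
      then have "\<rho> $ e + (t *\<^sub>R (w $ e) + b) = 0" by (simp add: add.assoc)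
      then have "\<rho> $ e = - (t *\<^sub>R (w $ e) + b)" by (rule eq_neg_iff_add_eq_0[THEN iffD2])
      then have "len e = norm (t *\<^sub>R (w $ e) + b)" using PolT_norm[OF \<rho>, of e] by (metis norm_minus_cancel)
      also have "\<dots> \<le> norm (t *\<^sub>R (w $ e)) + norm b" by (rule norm_triangle_ineq)
      also have "\<dots> = t * norm (w $ e) + norm b" using t by simp
      also have "\<dots> \<le> t * norm w + t"
        using t bt(1)[OF that] by (intro add_mono mult_left_mono Finite_Cartesian_Product.norm_nth_le) auto
      also have "\<dots> < len e" using t'(2) m(2)[of e] by (simp add: algebra_simps)
      finally show False by simp
    qed
    let ?G = "\<lambda>b. bsum UNIV (\<Gamma> (t, b))"
    have err: "norm (?G b - (\<Sum>e\<in>UNIV. ?P e b)) \<le> n * (\<eta> * (2 * t))" if "norm b \<le> \<epsilon>' * t" for b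
    proof -
      have "bsum UNIV (\<Gamma> (t, b) - \<rho> - L (t, b)) = ?G b - (\<Sum>e\<in>UNIV. ?P e b)"
        by (simp add: bsum_diff bsum_UNIV[OF \<rho>] SL)
      then have "norm (?G b - (\<Sum>e\<in>UNIV. ?P e b)) \<le> n * norm (\<Gamma> (t, b) - \<rho> - L (t, b))"
        using norm_bsum_le[of "\<Gamma> (t, b) - \<rho> - L (t, b)"] by (simp add: n_def)
      also have "\<dots> \<le> n * (\<eta> * norm (t, b))"
        using n bt(2)[OF that] t' by (intro mult_left_mono d(2)) auto
      also have "\<dots> \<le> n * (\<eta> * (2 * t))"
        using n bt(2)[OF that] \<eta> by (intro mult_left_mono) auto
      finally show ?thesis .
    qed
    have "continuous_on (cball 0 (\<epsilon>' * t)) (\<lambda>b. \<Gamma> (t, b))"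
      unfolding \<Gamma>_def using nz
      by (auto intro!: continuous_intros)
    then have cont: "continuous_on (cball 0 (\<epsilon>' * t)) (\<lambda>b. b - N (?G b))"
      by (intro continuous_intros linear_continuous_on_compose[OF _ N(1)]
          linear_continuous_on_compose[OF _ bounded_linear.linear[OF bounded_linear_bsum]])
    have maps: "(\<lambda>b. b - N (?G b)) \<in> cball 0 (\<epsilon>' * t) \<rightarrow> cball 0 (\<epsilon>' * t)"
    proof (rule Pi_I)
      fix b :: "real ^ 3" assume "b \<in> cball 0 (\<epsilon>' * t)"
      then have b: "norm b \<le> \<epsilon>' * t" by simp
      have "b - N (?G b) = - N (?G b - (\<Sum>e\<in>UNIV. ?P e b))"
        by (simp add: linear_diff[OF N(1)] N(2))
      then have "norm (b - N (?G b)) = norm (N (?G b - (\<Sum>e\<in>UNIV. ?P e b)))" by (simp only: norm_minus_cancel)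
      also have "\<dots> \<le> K * norm (?G b - (\<Sum>e\<in>UNIV. ?P e b))" by (rule K(2))
      also have "\<dots> \<le> K * (n * (\<eta> * (2 * t)))"
        using K(1) by (intro mult_left_mono err[OF b]) auto
      also have "\<dots> = (K * n * \<eta> * 2) * t" by simp
      also have "\<dots> \<le> \<epsilon>' * t" using \<eta>(3) t by (intro mult_right_mono) auto
      finally show "b - N (?G b) \<in> cball 0 (\<epsilon>' * t)" by simp
    qed
    \<comment> \<open>The map is a Newton step with the inverse derivative \<open>N\<close> frozen
      at \<open>\<rho>\<close>. At a fixed point \<open>N (?G b) = 0\<close>, hence
      \<open>?G b = 0\<close>, and the rescaled polygon closes.\<close>
    obtain b where b: "b \<in> cball 0 (\<epsilon>' * t)" "b - N (?G b) = b"
      by (rule brouwer_ball[OF _ cont maps]) (use \<epsilon>' t in simp)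
    then have nb: "norm b \<le> \<epsilon>' * t" and "N (?G b) = 0" by simp_all
    then have "?G b = 0" using N(3)[of "?G b"] linear_0[OF linear_oproj] by simp
    moreover have "norm (\<Gamma> (t, b) $ e) = len e" for e
      using nz[OF nb, of e] len_pos[of e] by (simp add: \<Gamma>_def norm_sgn)
    ultimately have "\<Gamma> (t, b) \<in> PolT len" by (simp add: PolT_def bsum_def)
    moreover have "norm (\<Gamma> (t, b) - \<rho> - t *\<^sub>R w) \<le> \<epsilon> * t"
    proof -
      have "norm (L (t, b) - t *\<^sub>R w) \<le> (\<Sum>e\<in>UNIV. norm ((L (t, b) - t *\<^sub>R w) $ e))"
        unfolding norm_vec_def[of "L (t, b) - t *\<^sub>R w"] by (rule L2_set_le_sum) simp
      also have "\<dots> \<le> (\<Sum>e\<in>(UNIV::'e set). norm b)"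
        using norm_oproj_le[OF norm_sgn_PolT[OF \<rho>]] by (intro sum_mono) (simp add: L_def)
      also have "\<dots> = n * norm b" by (simp add: n_def)
      also have "\<dots> \<le> n * (\<epsilon>' * t)" using n nb by (intro mult_left_mono) auto
      also have "\<dots> \<le> (\<epsilon> / 2) * t" using mult_right_mono[OF \<epsilon>'(3), of t] t by simp
      finally have 1: "norm (L (t, b) - t *\<^sub>R w) \<le> (\<epsilon> / 2) * t" .
      have "norm (\<Gamma> (t, b) - \<rho> - L (t, b)) \<le> \<eta> * norm (t, b)"
        using bt(2)[OF nb] t' by (intro d(2)) auto
      also have "\<dots> \<le> \<eta> * (2 * t)" using bt(2)[OF nb] \<eta>(1) by (intro mult_left_mono) auto
      also have "\<dots> \<le> (\<epsilon> / 2) * t" using mult_right_mono[OF \<eta>(2), of t] t by simp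
      finally have 2: "norm (\<Gamma> (t, b) - \<rho> - L (t, b)) \<le> (\<epsilon> / 2) * t" .
      have "\<Gamma> (t, b) - \<rho> - t *\<^sub>R w = (\<Gamma> (t, b) - \<rho> - L (t, b)) + (L (t, b) - t *\<^sub>R w)" by simp
      then show ?thesis using norm_triangle_le[OF add_mono[OF 2 1]] by (simp add: algebra_simps)
    qed
    ultimately show ?thesis by blast
  qed
  ultimately show ?thesis by blast
qed

text \<open>Along polygons that realise \<open>t *\<^sub>R w\<close> up to a small multiple of
  \<open>t\<close>, the difference \<open>Q\<close> of the two derivatives is small compared with
  \<open>t\<close>, which forces \<open>Q w = 0\<close>.\<close>

lemma derivative_tangent_unique:
  fixes F :: "real ^ 3 ^ 'e \<Rightarrow> real"
  assumes \<rho>: "\<rho> \<in> PolT len" and w: "w \<in> tangent \<rho>"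
    and D: "(F has_derivative D) (at \<rho> within PolT len)" and D': "(F has_derivative D') (at \<rho> within PolT len)"
  shows "D w = D' w"
proof (rule ccontr)
  assume ne: "D w \<noteq> D' w"
  define Q where "Q h = D h - D' h" for h
  have "((\<lambda>\<sigma>. F \<sigma> - F \<sigma>) has_derivative Q) (at \<rho> within PolT len)"
    unfolding Q_def[abs_def] by (intro has_derivative_diff D D')
  then have "((\<lambda>\<sigma>. 0) has_derivative Q) (at \<rho> within PolT len)" by simp
  then have bl: "bounded_linear Q" and
    Q: "\<And>\<eta>. \<eta> > 0 \<Longrightarrow> \<exists>d>0. \<forall>\<sigma>\<in>PolT len. norm (\<sigma> - \<rho>) < d \<longrightarrow> \<bar>Q (\<sigma> - \<rho>)\<bar> \<le> \<eta> * norm (\<sigma> - \<rho>)"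
    unfolding has_derivative_within_alt by auto
  interpret Q: bounded_linear Q by (rule bl)
  have Qw: "\<bar>Q w\<bar> > 0" using ne by (simp add: Q_def)
  obtain B where B: "B > 0" "\<And>x. \<bar>Q x\<bar> \<le> norm x * B"
    using Q.pos_bounded unfolding real_norm_def by auto
  \<comment> \<open>With \<open>\<eta>\<close> below, each of the two error terms becomes a quarter
    of \<open>t * \<bar>Q w\<bar>\<close>, so their sum cannot reach it.\<close>
  define \<epsilon> where "\<epsilon> = \<bar>Q w\<bar> / (4 * B)"
  have eps: "\<epsilon> > 0" using Qw B by (simp add: \<epsilon>_def)
  define s where "s = norm w + \<epsilon>"
  define \<eta> where "\<eta> = \<bar>Q w\<bar> / (4 * s)"
  have we: "s > 0" using eps by (simp add: s_def add_nonneg_pos)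
  have eta: "\<eta> > 0" "\<eta> * s = \<bar>Q w\<bar> / 4"
    using Qw we by (simp_all add: \<eta>_def)
  obtain d where d: "d > 0" "\<And>\<sigma>. \<sigma> \<in> PolT len \<Longrightarrow> norm (\<sigma> - \<rho>) < d \<Longrightarrow> \<bar>Q (\<sigma> - \<rho>)\<bar> \<le> \<eta> * norm (\<sigma> - \<rho>)"
    using Q[OF eta(1)] by blast
  obtain \<delta> where \<delta>: "\<delta> > 0" "\<And>t. 0 < t \<Longrightarrow> t < \<delta> \<Longrightarrow> \<exists>\<sigma>\<in>PolT len. norm (\<sigma> - \<rho> - t *\<^sub>R w) \<le> \<epsilon> * t"
    using tangent_realised[OF \<rho> w eps] by blast
  define t where "t = min (\<delta> / 2) (d / (2 * s))"
  have t: "0 < t" "t < \<delta>" using \<delta>(1) d(1) we by (auto simp: t_def)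
  have "t * s \<le> d / (2 * s) * s"
    using we by (intro mult_right_mono) (auto simp: t_def)
  also have "\<dots> = d / 2"
    using we by simp
  finally have tw: "t * s < d" using d(1) by simp
  obtain \<sigma> where \<sigma>: "\<sigma> \<in> PolT len" "norm (\<sigma> - \<rho> - t *\<^sub>R w) \<le> \<epsilon> * t"
    using \<delta>(2)[OF t] by blast
  have ns: "norm (\<sigma> - \<rho>) \<le> t * s"
    using norm_triangle_ineq[of "\<sigma> - \<rho> - t *\<^sub>R w" "t *\<^sub>R w"] \<sigma>(2) t by (simp add: s_def algebra_simps)
  have "t * Q w = Q (\<sigma> - \<rho>) - Q (\<sigma> - \<rho> - t *\<^sub>R w)"
    by (simp add: Q.diff Q.scaleR)
  moreover have "t * \<bar>Q w\<bar> = \<bar>t * Q w\<bar>" using t by (simp add: abs_mult)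
  ultimately have "t * \<bar>Q w\<bar> \<le> \<bar>Q (\<sigma> - \<rho>)\<bar> + \<bar>Q (\<sigma> - \<rho> - t *\<^sub>R w)\<bar>"
    using abs_triangle_ineq4[of "Q (\<sigma> - \<rho>)" "Q (\<sigma> - \<rho> - t *\<^sub>R w)"] by (simp only:)
  also have "\<dots> \<le> \<eta> * (t * s) + (\<epsilon> * t) * B"
  proof (intro add_mono)
    show "\<bar>Q (\<sigma> - \<rho>)\<bar> \<le> \<eta> * (t * s)"
      by (rule order_trans[OF d(2)[OF \<sigma>(1)] mult_left_mono[OF ns]]) (use ns tw eta(1) in auto)
    show "\<bar>Q (\<sigma> - \<rho> - t *\<^sub>R w)\<bar> \<le> (\<epsilon> * t) * B"
      by (rule order_trans[OF B(2) mult_right_mono[OF \<sigma>(2)]]) (use B(1) in auto)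
  qed
  also have "\<dots> = t * (\<eta> * s) + t * (\<epsilon> * B)" by (simp add: algebra_simps)
  also have "\<dots> = t * (\<bar>Q w\<bar> / 4) + t * (\<bar>Q w\<bar> / 4)"
    using B(1) by (simp only: eta(2)) (simp add: \<epsilon>_def)
  finally have "t * \<bar>Q w\<bar> \<le> t * (\<bar>Q w\<bar> / 2)" by simp
  with t Qw show False by simp
qed

end

section \<open>Uniqueness of the bending flow\<close>

text \<open>The velocity of \<open>bend I (cis t) \<rho>\<close> at \<open>t = 0\<close>. By
  \<open>omega_bend_field\<close> it represents the Hamiltonian vector field of
  \<open>f_len I\<close>.\<close>

definition bend_field :: "'e::finite set \<Rightarrow> real ^ 3 ^ 'e \<Rightarrow> real ^ 3 ^ 'e" where
  "bend_field I \<rho> = (\<chi> e. if e \<in> I then sgn (bsum I \<rho>) \<times>\<^sub>3 (\<rho> $ e) else 0)"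

lemma bend_field_nth: "bend_field I \<rho> $ e = (if e \<in> I then sgn (bsum I \<rho>) \<times>\<^sub>3 (\<rho> $ e) else 0)"
  by (simp add: bend_field_def)

lemma sum_cross3_right: "(\<Sum>e\<in>I. a \<times>\<^sub>3 f e) = a \<times>\<^sub>3 (\<Sum>e\<in>I. f e)"
  using linear_sum[OF bounded_linear.linear[OF bounded_bilinear.bounded_linear_right[OF bounded_bilinear_cross3, of a]], of f I]
  by simp

lemma cross3_sgn_self: "sgn v \<times>\<^sub>3 v = 0"
  by (simp add: sgn_div_norm cross_mult_left)

lemma bend_field_tangent: "bend_field I \<rho> \<in> tangent \<rho>"
proof -
  have "(\<Sum>e\<in>UNIV. bend_field I \<rho> $ e) = (\<Sum>e\<in>I. sgn (bsum I \<rho>) \<times>\<^sub>3 (\<rho> $ e))"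
    by (simp add: bend_field_nth sum.If_cases)
  also have "\<dots> = 0" by (simp add: sum_cross3_right cross3_sgn_self flip: bsum_def)
  finally show ?thesis by (simp add: tangent_def bend_field_nth dot_cross_self)
qed

lemma omega_add_left: "omega \<rho> (v + v') w = omega \<rho> v w + omega \<rho> v' w"
  by (simp add: omega_def kks_form_def cross_add_left inner_add_right add_divide_distrib sum.distrib)

lemma omega_scaleR_left: "omega \<rho> (c *\<^sub>R v) w = c * omega \<rho> v w"
  by (simp add: omega_def kks_form_def cross_mult_left sum_distrib_left)

lemma omega_diff_left: "omega \<rho> (v - v') w = omega \<rho> v w - omega \<rho> v' w"
  using omega_add_left[of \<rho> "v - v'" v' w] by simp

lemma tangent_add: "v \<in> tangent \<rho> \<Longrightarrow> w \<in> tangent \<rho> \<Longrightarrow> v + w \<in> tangent \<rho>"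
  by (simp add: tangent_def sum.distrib inner_add_right)

lemma tangent_scaleR: "v \<in> tangent \<rho> \<Longrightarrow> c *\<^sub>R v \<in> tangent \<rho>"
  by (simp add: tangent_def flip: scaleR_sum_right)

lemma tangent_diff: "v \<in> tangent \<rho> \<Longrightarrow> w \<in> tangent \<rho> \<Longrightarrow> v - w \<in> tangent \<rho>"
  using tangent_add[of v \<rho> "(-1) *\<^sub>R w"] tangent_scaleR[of w \<rho> "-1"] by simp

lemma has_vector_derivative_nth:
  "(\<gamma> has_vector_derivative \<gamma>') F \<Longrightarrow> ((\<lambda>t. \<gamma> t $ e) has_vector_derivative \<gamma>' $ e) F"
  by (rule bounded_linear.has_vector_derivative[OF bounded_linear_vec_nth])

lemma has_vector_derivative_bsum:
  "(\<gamma> has_vector_derivative \<gamma>') F \<Longrightarrow> ((\<lambda>t. bsum I (\<gamma> t)) has_vector_derivative bsum I \<gamma>') F"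
  by (rule bounded_linear.has_vector_derivative[OF bounded_linear_bsum])

lemmas has_vector_derivative_inner = bounded_bilinear.has_vector_derivative[OF bounded_bilinear_inner]
lemmas has_vector_derivative_cross3 = bounded_bilinear.has_vector_derivative[OF bounded_bilinear_cross3]
lemmas has_vector_derivative_scaleR' = bounded_bilinear.has_vector_derivative[OF bounded_bilinear_scaleR]

lemma has_vector_derivative_sgn:
  fixes v :: "real \<Rightarrow> 'a::real_inner"
  assumes "(v has_vector_derivative v') (at t)" "v t \<noteq> 0"
  shows "((\<lambda>t. sgn (v t)) has_vector_derivative (v' - (sgn (v t) \<bullet> v') *\<^sub>R sgn (v t)) /\<^sub>R norm (v t)) (at t)"
proof -
  have "((\<lambda>t. sgn (v t)) has_derivative (\<lambda>h. ((h *\<^sub>R v') - (sgn (v t) \<bullet> (h *\<^sub>R v')) *\<^sub>R sgn (v t)) /\<^sub>R norm (v t))) (at t)"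
    using has_derivative_compose[OF assms(1)[unfolded has_vector_derivative_def] has_derivative_sgn[OF assms(2)]] .
  moreover have "(\<lambda>h. ((h *\<^sub>R v') - (sgn (v t) \<bullet> (h *\<^sub>R v')) *\<^sub>R sgn (v t)) /\<^sub>R norm (v t))
     = (\<lambda>h. h *\<^sub>R ((v' - (sgn (v t) \<bullet> v') *\<^sub>R sgn (v t)) /\<^sub>R norm (v t)))"
    by (rule ext) (simp add: algebra_simps)
  ultimately show ?thesis by (simp only: has_vector_derivative_def)
qed

text \<open>The two terms of the derivative of a rotated vector that come from the rotation speed cancel.\<close>

lemma has_vector_derivative_unbend:
  assumes u: "(u has_vector_derivative a \<times>\<^sub>3 u t) (at t)" and n: "norm (u t) = 1"
    and x: "(x has_vector_derivative (u t + a) \<times>\<^sub>3 x t) (at t)"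
  shows "((\<lambda>s. rot (cis (- s)) (u s) (x s)) has_vector_derivative a \<times>\<^sub>3 rot (cis (- t)) (u t) (x t)) (at t)"
proof -
  have uu: "u t \<bullet> u t = 1" using n by (simp add: dot_square_norm)
  have c: "(cos has_vector_derivative - sin t) (at t)" "(sin has_vector_derivative cos t) (at t)"
    using DERIV_cos[of t] DERIV_sin[of t] by (simp_all add: has_real_derivative_iff_has_vector_derivative)
  have c1: "((\<lambda>s. 1 - cos s) has_vector_derivative sin t) (at t)"
    using has_vector_derivative_diff[OF has_vector_derivative_const c(1), of 1] by simp
  let ?p = "u t \<bullet> x t" and ?x' = "(u t + a) \<times>\<^sub>3 x t"
  note d = has_vector_derivative_add[OF has_vector_derivative_diff[OF
      has_vector_derivative_scaleR'[OF c(1) x]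
      has_vector_derivative_scaleR'[OF c(2) has_vector_derivative_cross3[OF u x]]]
      has_vector_derivative_scaleR'[OF has_vector_derivative_mult[OF c1 has_vector_derivative_inner[OF u x]] u]]
  have e: "rot (cis (- s)) (u s) (x s) = cos s *\<^sub>R x s - sin s *\<^sub>R (u s \<times>\<^sub>3 x s) + ((1 - cos s) * (u s \<bullet> x s)) *\<^sub>R u s" for s
    by (simp add: rot_def)
  have i: "u t \<bullet> ?x' + (a \<times>\<^sub>3 u t) \<bullet> x t = 0"
    by (simp add: cross3_simps)
  have j: "u t \<times>\<^sub>3 ?x' + (a \<times>\<^sub>3 u t) \<times>\<^sub>3 x t = (?p *\<^sub>R u t - x t) + a \<times>\<^sub>3 (u t \<times>\<^sub>3 x t)"
  proof -
    \<comment> \<open>The Jacobi identity, obtained by expanding the double products.\<close>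
    have "u t \<times>\<^sub>3 (a \<times>\<^sub>3 x t) + (a \<times>\<^sub>3 u t) \<times>\<^sub>3 x t = a \<times>\<^sub>3 (u t \<times>\<^sub>3 x t)"
      by (simp add: Lagrange cross3_cross3_left inner_commute)
    moreover have "u t \<times>\<^sub>3 ?x' = (?p *\<^sub>R u t - x t) + u t \<times>\<^sub>3 (a \<times>\<^sub>3 x t)"
      by (simp only: cross_add_left cross_add_right Lagrange[of "u t" "u t"] uu scaleR_one)
    ultimately show ?thesis by (simp add: add.assoc)
  qed
  have "cos t *\<^sub>R ?x' + (- sin t) *\<^sub>R x t
      - (sin t *\<^sub>R (u t \<times>\<^sub>3 ?x' + (a \<times>\<^sub>3 u t) \<times>\<^sub>3 x t) + cos t *\<^sub>R (u t \<times>\<^sub>3 x t))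
      + (((1 - cos t) * ?p) *\<^sub>R (a \<times>\<^sub>3 u t) + ((1 - cos t) * (u t \<bullet> ?x' + (a \<times>\<^sub>3 u t) \<bullet> x t) + sin t * ?p) *\<^sub>R u t)
    = a \<times>\<^sub>3 rot (cis (- t)) (u t) (x t)"
    unfolding i j e
    by (simp add: cross_add_left cross_add_right cross_mult_right Cross3.right_diff_distrib algebra_simps)
  with d show ?thesis unfolding e by simp
qed

context polygon_space
begin

lemma f_len_has_derivative:
  assumes \<rho>: "\<rho> \<in> PolT len" and I: "bsum I \<rho> \<noteq> 0"
  shows "((\<lambda>\<sigma>. f_len I (pol_class len \<sigma>)) has_derivative (\<lambda>w. sgn (bsum I \<rho>) \<bullet> bsum I w)) (at \<rho> within PolT len)"
proof (rule has_derivative_transform[OF \<rho> f_len_class])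
  have "(norm has_derivative (\<lambda>h. sgn (bsum I \<rho>) \<bullet> h)) (at (bsum I \<rho>))"
    using has_derivative_norm[of "bsum I \<rho>"] I by (simp add: inner_commute)
  from has_derivative_compose[OF bounded_linear.has_derivative[OF bounded_linear_bsum has_derivative_ident] this]
  show "((\<lambda>\<sigma>. norm (bsum I \<sigma>)) has_derivative (\<lambda>w. sgn (bsum I \<rho>) \<bullet> bsum I w)) (at \<rho> within PolT len)"
    by simp
qed

text \<open>\<open>kks_form_moment_map\<close> applies to each edge of \<open>I\<close> with the
  unit axis as rotation vector. The right-hand side is the differential of \<open>f_len I\<close>
  found in \<open>f_len_has_derivative\<close>.\<close>

lemma omega_bend_field:
  assumes \<rho>: "\<rho> \<in> PolT len" and w: "w \<in> tangent \<rho>"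
  shows "omega \<rho> (bend_field I \<rho>) w = sgn (bsum I \<rho>) \<bullet> bsum I w"
proof -
  have "omega \<rho> (bend_field I \<rho>) w = (\<Sum>e\<in>UNIV. if e \<in> I then sgn (bsum I \<rho>) \<bullet> w $ e else 0)"
    unfolding omega_def
  proof (rule sum.cong)
    fix e
    have "\<rho> $ e \<bullet> w $ e = 0" using w by (simp add: tangent_def)
    then show "kks_form (\<rho> $ e) (bend_field I \<rho> $ e) (w $ e) = (if e \<in> I then sgn (bsum I \<rho>) \<bullet> w $ e else 0)"
      using kks_form_moment_map[OF PolT_nonzero[OF \<rho>, of e]] by (simp add: bend_field_nth) (simp add: kks_form_def)
  qed simp
  then show ?thesis by (simp add: sum.If_cases inner_sum_right bsum_def)
qed

lemma velocity_tangent: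
  assumes "\<And>t. \<gamma> t \<in> PolT len" "(\<gamma> has_vector_derivative \<gamma>') (at t)"
  shows "\<gamma>' \<in> tangent (\<gamma> t)"
proof -
  have "((\<lambda>t. bsum UNIV (\<gamma> t)) has_vector_derivative bsum UNIV \<gamma>') (at t)"
    by (rule has_vector_derivative_bsum[OF assms(2)])
  then have "bsum UNIV \<gamma>' = 0"
    using bsum_UNIV[OF assms(1)] vector_derivative_unique_at[OF _ has_vector_derivative_const[of 0]] by simp
  moreover have "\<gamma> t $ e \<bullet> \<gamma>' $ e = 0" for e
  proof -
    have "((\<lambda>t. \<gamma> t $ e \<bullet> \<gamma> t $ e) has_vector_derivative \<gamma> t $ e \<bullet> \<gamma>' $ e + \<gamma>' $ e \<bullet> \<gamma> t $ e) (at t)"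
      by (intro has_vector_derivative_inner has_vector_derivative_nth assms(2))
    moreover have "\<gamma> t $ e \<bullet> \<gamma> t $ e = (len e)\<^sup>2" for t
      using PolT_norm[OF assms(1)] by (simp add: dot_square_norm)
    ultimately have "((\<lambda>t. (len e)\<^sup>2) has_vector_derivative \<gamma> t $ e \<bullet> \<gamma>' $ e + \<gamma>' $ e \<bullet> \<gamma> t $ e) (at t)"
      by (simp only:)
    from vector_derivative_unique_at[OF this has_vector_derivative_const] show ?thesis
      by (simp add: inner_commute)
  qed
  ultimately show ?thesis by (simp add: tangent_def bsum_def)
qed

text \<open>By \<open>omega_kernel\<close> the velocity of a lift is \<open>bend_field\<close> plus
  an infinitesimal rotation \<open>a t\<close>, chosen separately for each \<open>t\<close>. Once
  the bending is undone, all edges move by this same infinitesimal rotation; so the invariants are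
  constant, and the class remains that of \<open>\<gamma> 0\<close>.\<close>

lemma hamiltonian_curve_bend:
  assumes I: "\<And>\<rho>. \<rho> \<in> PolT len \<Longrightarrow> bsum I \<rho> \<noteq> 0"
    and c: "hamiltonian_curve len (f_len I) c"
  shows "c t = class_map len (bend I (cis t)) (c 0)"
proof -
  obtain \<gamma> \<gamma>' where G: "\<forall>t. \<gamma> t \<in> PolT len \<and> c t = pol_class len (\<gamma> t) \<and> (\<gamma> has_vector_derivative \<gamma>' t) (at t) \<and>
      (\<exists>D. ((\<lambda>\<sigma>. f_len I (pol_class len \<sigma>)) has_derivative D) (at (\<gamma> t) within PolT len) \<and>
             (\<forall>w\<in>tangent (\<gamma> t). omega (\<gamma> t) (\<gamma>' t) w = D w))"
    using c unfolding hamiltonian_curve_def by (elim exE) (rule that)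
  have \<gamma>: "\<gamma> t \<in> PolT len" "c t = pol_class len (\<gamma> t)" "(\<gamma> has_vector_derivative \<gamma>' t) (at t)" for t
    by (rule G[rule_format, THEN conjunct1] G[rule_format, THEN conjunct2, THEN conjunct1]
        G[rule_format, THEN conjunct2, THEN conjunct2, THEN conjunct1])+
  have D: "\<exists>D. ((\<lambda>\<sigma>. f_len I (pol_class len \<sigma>)) has_derivative D) (at (\<gamma> t) within PolT len) \<and>
             (\<forall>w\<in>tangent (\<gamma> t). omega (\<gamma> t) (\<gamma>' t) w = D w)" for t
    using G[rule_format, of t] by (elim conjE)
  have nz: "bsum I (\<gamma> t) \<noteq> 0" for t by (rule I[OF \<gamma>(1)])
  have "\<exists>a. \<forall>e. (\<gamma>' t - bend_field I (\<gamma> t)) $ e = a \<times>\<^sub>3 (\<gamma> t $ e)" for t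
  proof (rule omega_kernel[OF \<gamma>(1)])
    show "\<gamma>' t - bend_field I (\<gamma> t) \<in> tangent (\<gamma> t)"
      by (intro tangent_diff bend_field_tangent velocity_tangent \<gamma>)
    fix w assume w: "w \<in> tangent (\<gamma> t)"
    obtain D where D: "((\<lambda>\<sigma>. f_len I (pol_class len \<sigma>)) has_derivative D) (at (\<gamma> t) within PolT len)"
        "\<forall>w\<in>tangent (\<gamma> t). omega (\<gamma> t) (\<gamma>' t) w = D w"
      using D[of t] by (elim exE conjE)
    show "omega (\<gamma> t) (\<gamma>' t - bend_field I (\<gamma> t)) w = 0"
      using D(2) w derivative_tangent_unique[OF \<gamma>(1) w D(1) f_len_has_derivative[OF \<gamma>(1) nz]]
      by (simp add: omega_diff_left omega_bend_field[OF \<gamma>(1) w])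
  qed
  then obtain a where "\<And>t e. (\<gamma>' t - bend_field I (\<gamma> t)) $ e = a t \<times>\<^sub>3 (\<gamma> t $ e)"
    by (elim choice[THEN exE, OF allI]) simp
  then have a: "\<gamma>' t $ e = bend_field I (\<gamma> t) $ e + a t \<times>\<^sub>3 (\<gamma> t $ e)" for t e
    by (simp add: diff_eq_eq add.commute)
  define u where "u t = sgn (bsum I (\<gamma> t))" for t
  have u1: "norm (u t) = 1" for t using nz by (simp add: u_def norm_sgn)
  \<comment> \<open>The bending field does not move the sum of its own block, so the axis turns with
    \<open>a t\<close> alone.\<close>
  have "bsum I (\<gamma>' t) = a t \<times>\<^sub>3 bsum I (\<gamma> t)" for t
  proof -
    have "bsum I (\<gamma>' t) = (\<Sum>e\<in>I. sgn (bsum I (\<gamma> t)) \<times>\<^sub>3 (\<gamma> t $ e) + a t \<times>\<^sub>3 (\<gamma> t $ e))"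
      unfolding bsum_def[of I "\<gamma>' t"] by (intro sum.cong) (auto simp: a bend_field_nth)
    then show ?thesis by (simp add: sum.distrib sum_cross3_right cross3_sgn_self flip: bsum_def)
  qed
  with has_vector_derivative_sgn[OF has_vector_derivative_bsum[OF \<gamma>(3)] nz]
  have u': "(u has_vector_derivative a t \<times>\<^sub>3 u t) (at t)" for t
    unfolding u_def[abs_def] by (simp add: sgn_div_norm dot_cross_self cross_mult_right)
  define \<sigma> where "\<sigma> t = bend I (cis (- t)) (\<gamma> t)" for t
  have \<sigma>P: "\<sigma> t \<in> PolT len" for t
    unfolding \<sigma>_def by (intro bend_PolT \<gamma> nz) simp
  have \<sigma>': "((\<lambda>t. \<sigma> t $ e) has_vector_derivative a t \<times>\<^sub>3 (\<sigma> t $ e)) (at t)" for t e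
  proof (cases "e \<in> I")
    case True
    have "((\<lambda>t. \<gamma> t $ e) has_vector_derivative (u t + a t) \<times>\<^sub>3 (\<gamma> t $ e)) (at t)"
      using has_vector_derivative_nth[OF \<gamma>(3)[of t], of e] True by (simp add: a bend_field_nth u_def cross_add_left)
    from has_vector_derivative_unbend[OF u' u1 this] show ?thesis
      using True by (simp add: \<sigma>_def bend_nth u_def)
  next
    case False
    then show ?thesis
      using has_vector_derivative_nth[OF \<gamma>(3)[of t], of e] by (simp add: \<sigma>_def bend_nth a bend_field_nth)
  qed
  have inn: "((\<lambda>t. \<sigma> t $ e \<bullet> \<sigma> t $ f) has_vector_derivative 0) (at t)" for e f t
  proof -
    have "\<sigma> t $ e \<bullet> (a t \<times>\<^sub>3 (\<sigma> t $ f)) + (a t \<times>\<^sub>3 (\<sigma> t $ e)) \<bullet> \<sigma> t $ f = 0"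
      by (simp add: cross3_simps)
    then show ?thesis using has_vector_derivative_inner[OF \<sigma>'[of e t] \<sigma>'[of f t]] by simp
  qed
  have tri: "((\<lambda>t. \<sigma> t $ e \<bullet> (\<sigma> t $ f \<times>\<^sub>3 (\<sigma> t $ g))) has_vector_derivative 0) (at t)" for e f g t
  proof -
    have "\<sigma> t $ e \<bullet> (\<sigma> t $ f \<times>\<^sub>3 (a t \<times>\<^sub>3 (\<sigma> t $ g)) + (a t \<times>\<^sub>3 (\<sigma> t $ f)) \<times>\<^sub>3 (\<sigma> t $ g))
      + (a t \<times>\<^sub>3 (\<sigma> t $ e)) \<bullet> (\<sigma> t $ f \<times>\<^sub>3 (\<sigma> t $ g)) = 0"
      by (simp add: cross3_simps)
    then show ?thesis
      using has_vector_derivative_inner[OF \<sigma>'[of e t] has_vector_derivative_cross3[OF \<sigma>'[of f t] \<sigma>'[of g t]]] by simp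
  qed
  have "((\<lambda>t. invar i (\<sigma> t)) has_vector_derivative 0) (at t)" for i t
  proof -
    obtain b e f g where "i = (b, e, f, g)" by (cases i)
    then show ?thesis using inn tri by (cases b) (simp_all add: invar_def)
  qed
  then have "((\<lambda>t. invar i (\<sigma> t)) has_real_derivative 0) (at t)" for i t
    by (simp add: has_real_derivative_iff_has_vector_derivative)
  then have "invar i (\<sigma> t) = invar i (\<sigma> 0)" for i
    using DERIV_isconst_all[of "\<lambda>t. invar i (\<sigma> t)"] by simp
  then have eq: "pol_class len (\<sigma> t) = pol_class len (\<sigma> 0)"
    by (simp add: pol_class_eq_invar[OF \<sigma>P \<sigma>P])
  have "\<sigma> 0 = \<gamma> 0" by (simp add: \<sigma>_def)
  have "c t = pol_class len (bend I (cis t) (\<sigma> t))"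
    unfolding \<gamma>(2) \<sigma>_def by (subst bend_bend[OF nz]) (simp_all add: cis_mult)
  also have "\<dots> = class_map len (bend I (cis t)) (pol_class len (\<sigma> t))"
    by (rule class_map[symmetric]) (simp_all add: equivariant_bend I \<sigma>P)
  also have "\<dots> = class_map len (bend I (cis t)) (c 0)"
    unfolding eq \<open>\<sigma> 0 = \<gamma> 0\<close> \<gamma>(2) ..
  finally show ?thesis .
qed

end

section \<open>Smooth maps\<close>

lemma C_times_cong:
  fixes F G :: "'a::euclidean_space \<Rightarrow> 'b::euclidean_space"
  assumes "open U" "\<And>x. x \<in> U \<Longrightarrow> F x = G x" "C_times k U F"
  shows "C_times k U G"
  using assms(2,3)
proof (induction k arbitrary: F G)
  case 0 then show ?case by (simp cong: continuous_on_cong)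
next
  case (Suc k)
  have d: "(F has_derivative frechet_derivative F (at x)) (at x)" if "x \<in> U" for x
    using Suc.prems(2) that assms(1)
    by (auto simp: differentiable_on_eq_differentiable_at frechet_derivative_works)
  then have dG: "(G has_derivative frechet_derivative F (at x)) (at x)" if "x \<in> U" for x
    using has_derivative_transform_within_open[OF d assms(1)] that Suc.prems(1) by blast
  then have eq: "frechet_derivative F (at x) = frechet_derivative G (at x)" if "x \<in> U" for x
    using that by (simp add: frechet_derivative_at)
  have "G differentiable_on U"
    using dG assms(1) by (auto simp: differentiable_on_eq_differentiable_at differentiable_def)
  moreover have "C_times k U (\<lambda>x. frechet_derivative G (at x) v)" for v
    by (rule Suc.IH[of "\<lambda>x. frechet_derivative F (at x) v"]) (use eq Suc.prems(2) in auto)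
  ultimately show ?case by simp
qed

text \<open>Admits an explicit formula for the derivative in place of
  \<open>frechet_derivative\<close>, with which it agrees on the open set \<open>U\<close>.\<close>

lemma C_times_SucI:
  fixes F :: "'a::euclidean_space \<Rightarrow> 'b::euclidean_space"
  assumes "open U" "\<And>x. x \<in> U \<Longrightarrow> (F has_derivative F' x) (at x)" "\<And>v. C_times k U (\<lambda>x. F' x v)"
  shows "C_times (Suc k) U F"
proof -
  have "F differentiable_on U"
    using assms(1,2) by (auto simp: differentiable_on_eq_differentiable_at differentiable_def)
  moreover have "C_times k U (\<lambda>x. frechet_derivative F (at x) v)" for v
    by (rule C_times_cong[OF assms(1) _ assms(3)[of v]]) (simp add: frechet_derivative_at[OF assms(2)])
  ultimately show ?thesis by simp
qed

lemma C_times_SucD: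
  fixes F :: "'a::euclidean_space \<Rightarrow> 'b::euclidean_space"
  assumes "open U" "C_times (Suc k) U F"
  shows "x \<in> U \<Longrightarrow> (F has_derivative frechet_derivative F (at x)) (at x)"
    "C_times k U (\<lambda>x. frechet_derivative F (at x) v)"
  using assms by (auto simp: differentiable_on_eq_differentiable_at frechet_derivative_works)

lemma C_times_less:
  fixes F :: "'a::euclidean_space \<Rightarrow> 'b::euclidean_space"
  shows "C_times (Suc k) U F \<Longrightarrow> C_times k U F"
  by (induction k arbitrary: F) (auto intro: differentiable_imp_continuous_on)

lemma C_times_const: "open U \<Longrightarrow> C_times k U (\<lambda>x::'a::euclidean_space. c :: 'b::euclidean_space)"
proof (induction k arbitrary: c)
  case (Suc k)
  then show ?case by (intro C_times_SucI[where F' = "\<lambda>_ _. 0"]) auto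
qed simp

lemma C_times_bounded_linear:
  fixes F :: "'a::euclidean_space \<Rightarrow> 'b::euclidean_space" and L :: "'b \<Rightarrow> 'c::euclidean_space"
  assumes "open U" "bounded_linear L" "C_times k U F"
  shows "C_times k U (\<lambda>x. L (F x))"
  using assms(3)
proof (induction k arbitrary: F)
  case 0
  then show ?case using bounded_linear.continuous_on[OF assms(2)] by simp
next
  case (Suc k)
  show ?case
    using C_times_SucD[OF assms(1) Suc.prems] Suc.IH
    by (intro C_times_SucI[OF assms(1) bounded_linear.has_derivative[OF assms(2)]]) auto
qed

lemma C_times_ident: "open U \<Longrightarrow> C_times k U (\<lambda>x::'a::euclidean_space. x)"
  by (cases k) (auto intro!: C_times_SucI[where F' = "\<lambda>_ h. h"] C_times_const continuous_on_id simp del: C_times.simps(2))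

lemma C_times_add:
  fixes F G :: "'a::euclidean_space \<Rightarrow> 'b::euclidean_space"
  assumes "open U" "C_times k U F" "C_times k U G"
  shows "C_times k U (\<lambda>x. F x + G x)"
  using assms(2,3)
proof (induction k arbitrary: F G)
  case 0 then show ?case by (simp add: continuous_on_add)
next
  case (Suc k)
  show ?case
    using C_times_SucD[OF assms(1) Suc.prems(1)] C_times_SucD[OF assms(1) Suc.prems(2)] Suc.IH
    by (intro C_times_SucI[OF assms(1) has_derivative_add]) auto
qed

lemma C_times_sum:
  fixes F :: "'i \<Rightarrow> 'a::euclidean_space \<Rightarrow> 'b::euclidean_space"
  assumes "open U" "\<And>i. i \<in> A \<Longrightarrow> C_times k U (F i)"
  shows "C_times k U (\<lambda>x. \<Sum>i\<in>A. F i x)"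
  using assms(2)
proof (induction A rule: infinite_finite_induct)
  case (insert i A)
  then show ?case using C_times_add[OF assms(1), of k "F i" "\<lambda>x. \<Sum>i\<in>A. F i x"] by simp
qed (simp_all add: C_times_const assms(1))

lemma C_times_bilinear:
  fixes F :: "'a::euclidean_space \<Rightarrow> 'b::euclidean_space" and G :: "'a \<Rightarrow> 'c::euclidean_space"
    and B :: "'b \<Rightarrow> 'c \<Rightarrow> 'd::euclidean_space"
  assumes "open U" "bounded_bilinear B" "C_times k U F" "C_times k U G"
  shows "C_times k U (\<lambda>x. B (F x) (G x))"
  using assms(3,4)
proof (induction k arbitrary: F G)
  case 0 then show ?case using bounded_bilinear.continuous_on[OF assms(2)] by simp
next
  case (Suc k)
  note dF = C_times_SucD[OF assms(1) Suc.prems(1)] and dG = C_times_SucD[OF assms(1) Suc.prems(2)]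
  show ?case
  proof (rule C_times_SucI[OF assms(1)])
    show "((\<lambda>x. B (F x) (G x)) has_derivative
        (\<lambda>h. B (F x) (frechet_derivative G (at x) h) + B (frechet_derivative F (at x) h) (G x))) (at x)" if "x \<in> U" for x
      by (rule bounded_bilinear.FDERIV[OF assms(2) dF(1)[OF that] dG(1)[OF that]])
    show "C_times k U (\<lambda>x. B (F x) (frechet_derivative G (at x) v) + B (frechet_derivative F (at x) v) (G x))" for v
      by (rule C_times_add[OF assms(1) Suc.IH[OF C_times_less[OF Suc.prems(1)] dG(2)]
            Suc.IH[OF dF(2) C_times_less[OF Suc.prems(2)]]])
  qed
qed

lemma C_times_inverse:
  fixes F :: "'a::euclidean_space \<Rightarrow> real"
  assumes "open U" "C_times k U F" "\<And>x. x \<in> U \<Longrightarrow> F x \<noteq> 0"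
  shows "C_times k U (\<lambda>x. inverse (F x))"
  using assms(2)
proof (induction k)
  case 0 then show ?case using assms(3) by (simp add: continuous_on_inverse)
next
  case (Suc k)
  show ?case
  proof (rule C_times_SucI[OF assms(1)])
    show "((\<lambda>x. inverse (F x)) has_derivative (\<lambda>h. - (inverse (F x) * frechet_derivative F (at x) h * inverse (F x)))) (at x)"
      if "x \<in> U" for x
      using Deriv.has_derivative_inverse[OF assms(3)[OF that] C_times_SucD(1)[OF assms(1) Suc.prems that]] .
    have "C_times k U (\<lambda>x. inverse (F x))" by (rule Suc.IH[OF C_times_less[OF Suc.prems]])
    then show "C_times k U (\<lambda>x. - (inverse (F x) * frechet_derivative F (at x) v * inverse (F x)))" for v
      by (intro C_times_bounded_linear[OF assms(1) bounded_linear_minus[OF bounded_linear_ident]]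
          C_times_bilinear[OF assms(1) bounded_bilinear_mult] C_times_SucD(2)[OF assms(1) Suc.prems])
  qed
qed

lemma C_times_sqrt:
  fixes F :: "'a::euclidean_space \<Rightarrow> real"
  assumes "open U" "C_times k U F" "\<And>x. x \<in> U \<Longrightarrow> F x > 0"
  shows "C_times k U (\<lambda>x. sqrt (F x))"
  using assms(2)
proof (induction k)
  case 0 then show ?case by (simp add: continuous_on_real_sqrt)
next
  case (Suc k)
  show ?case
  proof (rule C_times_SucI[OF assms(1)])
    show "((\<lambda>x. sqrt (F x)) has_derivative (\<lambda>h. (inverse (sqrt (F x)) / 2) * frechet_derivative F (at x) h)) (at x)"
      if "x \<in> U" for x
      using DERIV_compose_FDERIV[OF DERIV_real_sqrt[OF assms(3)[OF that]] C_times_SucD(1)[OF assms(1) Suc.prems that]]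
      by (simp add: mult.commute)
    have "C_times k U (\<lambda>x. sqrt (F x))" by (rule Suc.IH[OF C_times_less[OF Suc.prems]])
    then have "C_times k U (\<lambda>x. inverse (sqrt (F x)))"
      by (rule C_times_inverse[OF assms(1)]) (use assms(3) in force)
    then show "C_times k U (\<lambda>x. (inverse (sqrt (F x)) / 2) * frechet_derivative F (at x) v)" for v
      by (intro C_times_bilinear[OF assms(1) bounded_bilinear_mult] C_times_SucD(2)[OF assms(1) Suc.prems]
          C_times_bounded_linear[OF assms(1) bounded_linear_divide])
  qed
qed

lemma C_times_compose:
  fixes F :: "'b::euclidean_space \<Rightarrow> 'c::euclidean_space" and G :: "'a::euclidean_space \<Rightarrow> 'b"
  assumes "open U" "open V" "G ` U \<subseteq> V" "C_times k V F" "C_times k U G"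
  shows "C_times k U (\<lambda>x. F (G x))"
  using assms(4,5)
proof (induction k arbitrary: F)
  case 0 then show ?case using assms(3) by (auto intro: continuous_on_compose2)
next
  case (Suc k)
  have dG: "(G has_derivative frechet_derivative G (at x)) (at x)" if "x \<in> U" for x
    using C_times_SucD(1)[OF assms(1) Suc.prems(2) that] .
  have dF: "(F has_derivative frechet_derivative F (at (G x))) (at (G x))" if "x \<in> U" for x
    using C_times_SucD(1)[OF assms(2) Suc.prems(1)] that assms(3) by blast
  \<comment> \<open>\<open>C_times\<close> differentiates in a fixed direction only, while the chain
    rule produces the direction \<open>w\<close> that varies with \<open>x\<close>. Expanding
    \<open>w\<close> in the basis leaves fixed directions with smooth coefficients.\<close>
  have e: "frechet_derivative F (at (G x)) w = (\<Sum>b\<in>Basis. (w \<bullet> b) *\<^sub>R frechet_derivative F (at (G x)) b)"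
    if "x \<in> U" for x w
  proof -
    interpret bounded_linear "frechet_derivative F (at (G x))"
      using dF[OF that] by (rule has_derivative_bounded_linear)
    show ?thesis
      by (subst euclidean_representation[symmetric, of w]) (simp only: sum scaleR)
  qed
  show ?case
  proof (rule C_times_SucI[OF assms(1)])
    fix x assume x: "x \<in> U"
    have "((\<lambda>x. F (G x)) has_derivative (\<lambda>h. frechet_derivative F (at (G x)) (frechet_derivative G (at x) h))) (at x)"
      by (rule has_derivative_compose[OF dG[OF x] dF[OF x]])
    then show "((\<lambda>x. F (G x)) has_derivative (\<lambda>h. \<Sum>b\<in>Basis. (frechet_derivative G (at x) h \<bullet> b) *\<^sub>R frechet_derivative F (at (G x)) b)) (at x)"
      by (rule has_derivative_eq_rhs) (rule ext, rule e[OF x])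
  next
    fix v
    have "C_times k U G" using Suc.prems(2) by (rule C_times_less)
    then show "C_times k U (\<lambda>x. \<Sum>b\<in>Basis. (frechet_derivative G (at x) v \<bullet> b) *\<^sub>R frechet_derivative F (at (G x)) b)"
      by (intro C_times_sum[OF assms(1)] C_times_bilinear[OF assms(1) bounded_bilinear_scaleR]
          C_times_bounded_linear[OF assms(1) bounded_linear_inner_left] C_times_SucD(2)[OF assms(1) Suc.prems(2)]
          Suc.IH[OF C_times_SucD(2)[OF assms(2) Suc.prems(1)]])
  qed
qed

lemma C_times_vec_lambda:
  fixes F :: "'e::finite \<Rightarrow> 'a::euclidean_space \<Rightarrow> 'b::euclidean_space"
  assumes "open U" "\<And>e. C_times k U (F e)"
  shows "C_times k U (\<lambda>x. \<chi> e. F e x)"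
  unfolding vec_lambda_eq_sum_axis
  by (intro C_times_sum[OF assms(1)] C_times_bounded_linear[OF assms(1) bounded_linear_axis] assms(2))

lemma C_times_norm:
  fixes F :: "'a::euclidean_space \<Rightarrow> 'b::euclidean_space"
  assumes "open U" "C_times k U F" "\<And>x. x \<in> U \<Longrightarrow> F x \<noteq> 0"
  shows "C_times k U (\<lambda>x. norm (F x))"
  unfolding norm_eq_sqrt_inner
  by (intro C_times_sqrt C_times_bilinear[OF assms(1) bounded_bilinear_inner] assms(1,2)) (simp add: assms(3))

lemma open_bsum_nonzero: "open {\<rho>. bsum I \<rho> \<noteq> 0}"
proof -
  have "continuous_on UNIV (bsum I)" by (rule linear_continuous_on[OF bounded_linear_bsum])
  then show ?thesis by (intro open_Collect_neq) auto
qed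

lemma smooth_bend: "smooth_on_open {\<rho>. bsum I \<rho> \<noteq> 0} (bend I z)"
  unfolding smooth_on_open_def
proof (intro conjI allI)
  let ?U = "{\<rho> :: real ^ 3 ^ 'a. bsum I \<rho> \<noteq> 0}"
  show U: "open ?U" by (rule open_bsum_nonzero)
  fix k
  have b: "C_times k ?U (bsum I)"
    by (rule C_times_bounded_linear[OF U bounded_linear_bsum C_times_ident[OF U]])
  have s: "C_times k ?U (\<lambda>\<rho>. sgn (bsum I \<rho>))"
    unfolding sgn_div_norm
    by (intro C_times_bilinear[OF U bounded_bilinear_scaleR] C_times_inverse[OF U] C_times_norm[OF U] b) auto
  have n: "C_times k ?U (\<lambda>\<rho>. \<rho> $ e)" for e
    by (rule C_times_bounded_linear[OF U bounded_linear_vec_nth C_times_ident[OF U]])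
  have "C_times k ?U (\<lambda>\<rho>. if e \<in> I then rot z (sgn (bsum I \<rho>)) (\<rho> $ e) else \<rho> $ e)" for e
    unfolding rot_def using n s
    by (cases "e \<in> I")
      (auto intro!: C_times_add[OF U] C_times_bilinear[OF U bounded_bilinear_scaleR] C_times_const[OF U]
        C_times_bilinear[OF U bounded_bilinear_mult] C_times_bilinear[OF U bounded_bilinear_inner] C_times_bilinear[OF U bounded_bilinear_cross3])
  then show "C_times k ?U (bend I z)"
    unfolding bend_def[abs_def] by (rule C_times_vec_lambda[OF U])
qed

section \<open>Bendings are symplectic\<close>

definition rot_gen :: "complex \<Rightarrow> real ^ 3 \<Rightarrow> real ^ 3 \<Rightarrow> real ^ 3" where
  "rot_gen z u y = (1 - Re z) *\<^sub>R (u \<times>\<^sub>3 y) + Im z *\<^sub>R y"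

text \<open>Moving the axis \<open>u\<close> with velocity \<open>y\<close> moves the rotated vector infinitesimally by the
  rotation \<open>rot_gen z u y\<close>, that is \<open>a - R a\<close> for \<open>a = u \<times> y\<close>.\<close>

lemma rot_axis_derivative:
  assumes "norm u = 1" "norm z = 1" "u \<bullet> y = 0"
  shows "Im z *\<^sub>R (y \<times>\<^sub>3 x) + ((1 - Re z) * (y \<bullet> x)) *\<^sub>R u + ((1 - Re z) * (u \<bullet> x)) *\<^sub>R y
    = rot_gen z u y \<times>\<^sub>3 rot z u x"
proof -
  have uu: "u \<bullet> u = 1" using assms by (simp add: dot_square_norm)
  have "(Re z)\<^sup>2 + (Im z)\<^sup>2 = 1" using assms(2) by (simp add: cmod_def)
  then have z: "Im z * Im z = 1 - Re z * Re z" by (simp add: power2_eq_square)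
  have yu: "y \<bullet> u = 0" using assms(3) by (simp add: inner_commute)
  define q where "q = y \<bullet> (u \<times>\<^sub>3 x)"
  have b1: "(u \<times>\<^sub>3 y) \<times>\<^sub>3 x = (u \<bullet> x) *\<^sub>R y - (y \<bullet> x) *\<^sub>R u"
    and b3: "(u \<times>\<^sub>3 y) \<times>\<^sub>3 u = y"
    and b4: "y \<times>\<^sub>3 (u \<times>\<^sub>3 x) = (y \<bullet> x) *\<^sub>R u"
    by (simp_all add: cross3_cross3_left Lagrange dot_cross_self uu yu)
  have b2: "(u \<times>\<^sub>3 y) \<times>\<^sub>3 (u \<times>\<^sub>3 x) = - q *\<^sub>R u"
    by (simp add: cross3_cross3_left[of u y "u \<times>\<^sub>3 x"] dot_cross_self q_def)
  have "(u \<times>\<^sub>3 (y \<times>\<^sub>3 x)) \<times>\<^sub>3 u = (u \<bullet> u) *\<^sub>R (y \<times>\<^sub>3 x) - ((y \<times>\<^sub>3 x) \<bullet> u) *\<^sub>R u"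
    by (rule cross3_cross3_left)
  moreover have "u \<times>\<^sub>3 (y \<times>\<^sub>3 x) = (u \<bullet> x) *\<^sub>R y" by (simp add: Lagrange assms(3))
  moreover have "(y \<times>\<^sub>3 x) \<bullet> u = - q" by (simp add: q_def cross3_simps)
  ultimately have b5: "(u \<bullet> x) *\<^sub>R (y \<times>\<^sub>3 u) = y \<times>\<^sub>3 x + q *\<^sub>R u"
    by (simp add: uu cross_mult_left)
  have "rot_gen z u y \<times>\<^sub>3 rot z u x =
     ((1 - Re z) * Re z) *\<^sub>R ((u \<times>\<^sub>3 y) \<times>\<^sub>3 x) + ((1 - Re z) * Im z) *\<^sub>R ((u \<times>\<^sub>3 y) \<times>\<^sub>3 (u \<times>\<^sub>3 x))
     + ((1 - Re z) * (1 - Re z) * (u \<bullet> x)) *\<^sub>R ((u \<times>\<^sub>3 y) \<times>\<^sub>3 u)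
     + (Im z * Re z) *\<^sub>R (y \<times>\<^sub>3 x) + (Im z * Im z) *\<^sub>R (y \<times>\<^sub>3 (u \<times>\<^sub>3 x))
     + (Im z * (1 - Re z)) *\<^sub>R ((u \<bullet> x) *\<^sub>R (y \<times>\<^sub>3 u))"
    unfolding rot_gen_def rot_def
    by (simp add: cross_add_left cross_add_right cross_mult_left cross_mult_right scaleR_add_right mult_ac add_ac)
  also have "\<dots> = Im z *\<^sub>R (y \<times>\<^sub>3 x) + ((1 - Re z) * (y \<bullet> x)) *\<^sub>R u + ((1 - Re z) * (u \<bullet> x)) *\<^sub>R y"
    unfolding b1 b2 b3 b4 b5 z
    by (simp add: algebra_simps) (simp only: mult_2 mult_2_right scaleR_add_right scaleR_add_left distrib_left)
  finally show ?thesis ..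
qed

text \<open>This is the total contribution of the moving axis to the pulled back form, divided by
  the length of the block sum. Terms with \<open>y \<bullet> y'\<close> cancel in pairs; those with
  the triple product of \<open>u\<close>, \<open>y\<close>, \<open>y'\<close> cancel because
  \<open>z\<close> has norm 1.\<close>

lemma rot_gen_symplectic:
  assumes "norm u = 1" "norm z = 1" "u \<bullet> y = 0" "u \<bullet> y' = 0"
  shows "rot_gen z u y \<bullet> rot z u y' - rot_gen z u y' \<bullet> rot z u y + rot_gen z u y \<bullet> (rot_gen z u y' \<times>\<^sub>3 u) = 0"
proof -
  have uu: "u \<bullet> u = 1" using assms by (simp add: dot_square_norm)
  have "(Re z)\<^sup>2 + (Im z)\<^sup>2 = 1" using assms(2) by (simp add: cmod_def)
  then have z: "Im z * Im z = 1 - Re z * Re z" by (simp add: power2_eq_square)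
  have yu: "y \<bullet> u = 0" "y' \<bullet> u = 0" using assms(3,4) by (simp_all add: inner_commute)
  define q where "q = u \<bullet> (y \<times>\<^sub>3 y')"
  define p where "p = y \<bullet> y'"
  have i: "(u \<times>\<^sub>3 y) \<bullet> y' = q" "(u \<times>\<^sub>3 y') \<bullet> y = - q" "y \<bullet> (u \<times>\<^sub>3 y') = - q" "y' \<bullet> (u \<times>\<^sub>3 y) = q"
    by (simp_all add: q_def cross3_simps)
  have j: "(u \<times>\<^sub>3 y) \<bullet> (u \<times>\<^sub>3 y') = p" "(u \<times>\<^sub>3 y') \<bullet> (u \<times>\<^sub>3 y) = p" "y \<bullet> y' = p" "y' \<bullet> y = p"
    using yu by (simp_all add: dot_cross uu p_def inner_commute)
  have r: "rot z u y = Re z *\<^sub>R y + Im z *\<^sub>R (u \<times>\<^sub>3 y)" "rot z u y' = Re z *\<^sub>R y' + Im z *\<^sub>R (u \<times>\<^sub>3 y')"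
    by (simp_all add: rot_def assms(3,4))
  have g: "rot_gen z u y' \<times>\<^sub>3 u = (1 - Re z) *\<^sub>R y' - Im z *\<^sub>R (u \<times>\<^sub>3 y')"
    by (simp add: rot_gen_def cross_add_left cross_mult_left cross3_cross3_left uu yu cross_skew[of y' u])
  have "q * (Im z * Im z) + q * (Re z * Re z) = q"
    by (simp add: z right_diff_distrib)
  then show ?thesis
    unfolding g r unfolding rot_gen_def
    by (simp add: inner_add_left inner_add_right inner_diff_right i j) (simp add: algebra_simps)
qed

text \<open>The argument of \<open>rot_gen\<close> is the velocity of the unit axis when the polygon
  moves with velocity \<open>h\<close>; by \<open>rot_axis_derivative\<close> it adds an
  infinitesimal rotation to the rotated velocity.\<close>

lemma bend_has_derivative:
  assumes nz: "bsum I \<rho> \<noteq> 0" and z: "norm z = 1"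
  defines "u \<equiv> sgn (bsum I \<rho>)"
  shows "(bend I z has_derivative (\<lambda>h. \<chi> e. if e \<in> I
    then rot z u (h $ e) + rot_gen z u (oproj u (bsum I h) /\<^sub>R norm (bsum I \<rho>)) \<times>\<^sub>3 rot z u (\<rho> $ e) else h $ e)) (at \<rho>)"
  unfolding bend_def[abs_def]
proof (rule has_derivative_vec_lambda)
  fix e
  have u1: "norm u = 1" using nz by (simp add: u_def norm_sgn)
  define y where "y h = oproj u (bsum I h) /\<^sub>R norm (bsum I \<rho>)" for h
  have uy: "u \<bullet> y h = 0" for h using inner_oproj[OF u1] by (simp add: y_def)
  have du: "((\<lambda>\<rho>. sgn (bsum I \<rho>)) has_derivative y) (at \<rho>)"
    using has_derivative_compose[OF bounded_linear.has_derivative[OF bounded_linear_bsum has_derivative_ident] has_derivative_sgn[OF nz]]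
    by (simp add: y_def[abs_def] oproj_def u_def)
  have dx: "((\<lambda>\<rho>. \<rho> $ e) has_derivative (\<lambda>h. h $ e)) (at \<rho>)"
    by (rule bounded_linear.has_derivative[OF bounded_linear_vec_nth has_derivative_ident])
  note d = has_derivative_add[OF has_derivative_add[OF
      has_derivative_scaleR_right[OF dx, of "Re z"]
      has_derivative_scaleR_right[OF bounded_bilinear.FDERIV[OF bounded_bilinear_cross3 du dx], of "Im z"]]
      has_derivative_scaleR[OF has_derivative_mult_right[OF bounded_bilinear.FDERIV[OF bounded_bilinear_inner du dx], of "1 - Re z"] du]]
  have "((\<lambda>\<rho>. rot z (sgn (bsum I \<rho>)) (\<rho> $ e)) has_derivative
      (\<lambda>h. rot z u (h $ e) + rot_gen z u (y h) \<times>\<^sub>3 rot z u (\<rho> $ e))) (at \<rho>)"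
    unfolding rot_axis_derivative[OF u1 z uy, symmetric]
    unfolding rot_def u_def[symmetric]
    by (rule has_derivative_eq_rhs[OF d]) (simp add: u_def[symmetric] fun_eq_iff algebra_simps)
  then show "((\<lambda>\<rho>. if e \<in> I then rot z (sgn (bsum I \<rho>)) (\<rho> $ e) else \<rho> $ e) has_derivative
      (\<lambda>h. if e \<in> I then rot z u (h $ e) + rot_gen z u (oproj u (bsum I h) /\<^sub>R norm (bsum I \<rho>)) \<times>\<^sub>3 rot z u (\<rho> $ e) else h $ e)) (at \<rho>)"
    using dx by (cases "e \<in> I") (simp_all add: y_def)
qed

lemma kks_form_rotf: "rotf f \<Longrightarrow> kks_form (f x) (f v) (f w) = kks_form x v w"
  by (simp add: kks_form_def rotf_norm) (metis rotf_def)

lemma kks_form_add_rotation: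
  assumes "x \<noteq> 0" "x \<bullet> v = 0" "x \<bullet> w = 0"
  shows "kks_form x (v + b \<times>\<^sub>3 x) (w + b' \<times>\<^sub>3 x) = kks_form x v w + b \<bullet> w - b' \<bullet> v + b \<bullet> (b' \<times>\<^sub>3 x)"
proof -
  have "kks_form x (b' \<times>\<^sub>3 x) v = b' \<bullet> v" by (rule kks_form_moment_map[OF assms(1,2)])
  then have 1: "kks_form x v (b' \<times>\<^sub>3 x) = - (b' \<bullet> v)"
    by (simp add: kks_form_def cross_skew[of v])
  have "x \<bullet> (w + b' \<times>\<^sub>3 x) = 0" using assms(3) by (simp add: inner_add_right dot_cross_self)
  from kks_form_moment_map[OF assms(1) this, of b]
  have "kks_form x (b \<times>\<^sub>3 x) (w + b' \<times>\<^sub>3 x) = b \<bullet> w + b \<bullet> (b' \<times>\<^sub>3 x)" by (simp add: inner_add_right)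
  moreover have "kks_form x (v + b \<times>\<^sub>3 x) Y = kks_form x v Y + kks_form x (b \<times>\<^sub>3 x) Y"
    and "kks_form x v (w + Y) = kks_form x v w + kks_form x v Y" for Y
    by (simp_all add: kks_form_def cross_add_left cross_add_right inner_add_right add_divide_distrib)
  ultimately show ?thesis by (simp add: 1)
qed

text \<open>\<open>Symp\<close> wants a lift near each polygon; here one neighbourhood serves all
  polygons. Tangency of the image vectors is included because compositions of lifts rely on
  it.\<close>

definition symp_lift :: "('e::finite \<Rightarrow> real) \<Rightarrow> (real ^ 3 ^ 'e \<Rightarrow> real ^ 3 ^ 'e) \<Rightarrow> bool" where
  "symp_lift len \<psi> \<longleftrightarrow> (\<exists>U. PolT len \<subseteq> U \<and> smooth_on_open U \<psi>) \<and>
     (\<forall>\<rho>\<in>PolT len. \<forall>v\<in>tangent \<rho>. frechet_derivative \<psi> (at \<rho>) v \<in> tangent (\<psi> \<rho>) \<and>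
        (\<forall>w\<in>tangent \<rho>. omega (\<psi> \<rho>) (frechet_derivative \<psi> (at \<rho>) v) (frechet_derivative \<psi> (at \<rho>) w) = omega \<rho> v w))"

text \<open>Each edge form is invariant under the rotation. What the moving axis adds is linear in
  the edges once summed over the block, so it depends on block sums only and vanishes by
  \<open>rot_gen_symplectic\<close>.\<close>

lemma (in polygon_space) symp_lift_bend:
  assumes I: "\<And>\<rho>. \<rho> \<in> PolT len \<Longrightarrow> bsum I \<rho> \<noteq> 0" and z: "norm z = 1"
  shows "symp_lift len (bend I z)"
  unfolding symp_lift_def
proof (intro conjI ballI)
  show "\<exists>U. PolT len \<subseteq> U \<and> smooth_on_open U (bend I z)"
    by (intro exI[of _ "{\<rho>. bsum I \<rho> \<noteq> 0}"] conjI smooth_bend subsetI CollectI I)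
  fix \<rho> v assume \<rho>: "\<rho> \<in> PolT len" and v: "v \<in> tangent \<rho>"
  note nz = I[OF \<rho>]
  define r where "r = norm (bsum I \<rho>)"
  define u where "u = sgn (bsum I \<rho>)"
  have u1: "norm u = 1" using nz by (simp add: u_def norm_sgn)
  have r: "bsum I \<rho> = r *\<^sub>R u" "r \<noteq> 0" using nz by (simp_all add: r_def u_def sgn_div_norm)
  define y where "y h = oproj u (bsum I h) /\<^sub>R r" for h
  have uy: "u \<bullet> y h = 0" for h using inner_oproj[OF u1] by (simp add: y_def)
  have hy: "bsum I h = r *\<^sub>R y h + (u \<bullet> bsum I h) *\<^sub>R u" for h
    using r(2) by (simp add: y_def oproj_def)
  define b where "b h = rot_gen z u (y h)" for h
  define D where "D h = (\<chi> e. if e \<in> I then rot z u (h $ e) + b h \<times>\<^sub>3 rot z u (\<rho> $ e) else h $ e)" for h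
  have der: "(bend I z has_derivative D) (at \<rho>)"
    using bend_has_derivative[OF nz z] unfolding D_def[abs_def] b_def y_def u_def r_def .
  then have fD: "frechet_derivative (bend I z) (at \<rho>) = D"
    by (rule frechet_derivative_at[symmetric])
  have rf: "rotf (rot z u)" using u1 z by (rule rotf_rot)
  have op: "open {\<rho>. bsum I \<rho> \<noteq> 0}" by (rule open_bsum_nonzero)
  have t: "D v \<in> tangent (bend I z \<rho>)" if v: "v \<in> tangent \<rho>" for v
  proof -
    \<comment> \<open>The sum of all edges is not changed by bending, so its derivative along
      \<open>D\<close> can be computed as that of \<open>bsum UNIV\<close> itself.\<close>
    have d1: "((\<lambda>\<sigma>. bsum UNIV (bend I z \<sigma>)) has_derivative (\<lambda>h. bsum UNIV (D h))) (at \<rho>)"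
      by (rule bounded_linear.has_derivative[OF bounded_linear_bsum der])
    have d2: "((\<lambda>\<sigma>. bsum UNIV (bend I z \<sigma>)) has_derivative bsum UNIV) (at \<rho>)"
      by (rule has_derivative_transform_within_open[OF bounded_linear_imp_has_derivative[OF bounded_linear_bsum] op])
        (simp_all add: nz bsum_bend_superset z)
    have "bsum UNIV (D v) = bsum UNIV v"
      by (rule fun_cong[OF has_derivative_unique[OF d1 d2]])
    also have "\<dots> = 0" using v by (simp add: tangent_def bsum_def)
    finally have "bsum UNIV (D v) = 0" .
    moreover have "bend I z \<rho> $ e \<bullet> D v $ e = 0" for e
    proof -
      have "\<rho> $ e \<bullet> v $ e = 0" using v by (simp add: tangent_def)
      moreover have "rot z u (\<rho> $ e) \<bullet> rot z u (v $ e) = \<rho> $ e \<bullet> v $ e"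
        by (rule inner_rot_rot[OF u1 z])
      ultimately show ?thesis
        by (simp add: bend_nth D_def inner_add_right dot_cross_self flip: u_def)
    qed
    ultimately show ?thesis by (simp add: tangent_def bsum_def)
  qed
  then show "frechet_derivative (bend I z) (at \<rho>) v \<in> tangent (bend I z \<rho>)" using v by (simp add: fD)
  fix w assume w: "w \<in> tangent \<rho>"
  let ?k = "\<lambda>e. kks_form (\<rho> $ e) (v $ e) (w $ e)"
  have k: "kks_form (bend I z \<rho> $ e) (D v $ e) (D w $ e) = ?k e +
      (if e \<in> I then b v \<bullet> rot z u (w $ e) - b w \<bullet> rot z u (v $ e) + b v \<bullet> (b w \<times>\<^sub>3 rot z u (\<rho> $ e)) else 0)" for e
  proof (cases "e \<in> I")
    case True
    have "rot z u (\<rho> $ e) \<bullet> rot z u (v $ e) = 0" "rot z u (\<rho> $ e) \<bullet> rot z u (w $ e) = 0"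
      using v w by (simp_all add: inner_rot_rot[OF u1 z] tangent_def)
    moreover have "rot z u (\<rho> $ e) \<noteq> 0"
      using rotf_norm[OF rf, of "\<rho> $ e"] PolT_nonzero[OF \<rho>, of e] by (metis norm_eq_zero)
    ultimately show ?thesis
      using True by (simp add: bend_nth D_def kks_form_add_rotation kks_form_rotf[OF rf] flip: u_def)
  qed (simp add: bend_nth D_def)
  have "omega (bend I z \<rho>) (D v) (D w) = omega \<rho> v w +
     (b v \<bullet> rot z u (bsum I w) - b w \<bullet> rot z u (bsum I v) + b v \<bullet> (b w \<times>\<^sub>3 rot z u (bsum I \<rho>)))"
    unfolding omega_def k
    by (simp add: sum.distrib sum.If_cases sum_subtractf bsum_def linear_sum[OF linear_rot] inner_sum_right
        flip: sum_cross3_right)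
  also have "b v \<bullet> rot z u (bsum I w) - b w \<bullet> rot z u (bsum I v) + b v \<bullet> (b w \<times>\<^sub>3 rot z u (bsum I \<rho>)) = 0"
  proof -
    have bu: "b h \<bullet> u = 0" for h
      using uy[of h] by (simp add: b_def rot_gen_def inner_commute[of _ u] inner_add_right dot_cross_self)
    have R: "rot z u (bsum I h) = r *\<^sub>R rot z u (y h) + (u \<bullet> bsum I h) *\<^sub>R u" for h
      by (subst hy) (simp add: linear_add[OF linear_rot] linear_scale[OF linear_rot] rot_axis[OF u1])
    have "rot z u (bsum I \<rho>) = r *\<^sub>R u" by (simp add: r(1) linear_scale[OF linear_rot] rot_axis[OF u1])
    then have "b v \<bullet> rot z u (bsum I w) - b w \<bullet> rot z u (bsum I v) + b v \<bullet> (b w \<times>\<^sub>3 rot z u (bsum I \<rho>))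
      = r * (b v \<bullet> rot z u (y w) - b w \<bullet> rot z u (y v) + b v \<bullet> (b w \<times>\<^sub>3 u))"
      by (simp add: R inner_add_right bu cross_mult_right algebra_simps)
    also have "\<dots> = 0" unfolding b_def by (simp add: rot_gen_symplectic[OF u1 z uy uy])
    finally show ?thesis .
  qed
  finally show "omega (bend I z \<rho>) (frechet_derivative (bend I z) (at \<rho>) v) (frechet_derivative (bend I z) (at \<rho>) w) = omega \<rho> v w"
    by (simp add: fD)
qed

lemma symp_lift_id: "symp_lift len (\<lambda>\<rho>. \<rho>)"
proof -
  have "smooth_on_open UNIV (\<lambda>\<rho>::real ^ 3 ^ 'a. \<rho>)"
    unfolding smooth_on_open_def by (simp add: C_times_ident)
  then show ?thesis unfolding symp_lift_def by (auto simp: frechet_derivative_id)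
qed

lemma smooth_on_open_has_derivative:
  assumes "smooth_on_open U \<psi>" "x \<in> U"
  shows "(\<psi> has_derivative frechet_derivative \<psi> (at x)) (at x)"
  using assms C_times_SucD(1)[of U 0 \<psi> x] unfolding smooth_on_open_def by blast

lemma symp_lift_comp:
  assumes \<phi>: "symp_lift len \<phi>" and \<psi>: "symp_lift len \<psi>" and P: "\<And>\<rho>. \<rho> \<in> PolT len \<Longrightarrow> \<psi> \<rho> \<in> PolT len"
  shows "symp_lift len (\<lambda>\<rho>. \<phi> (\<psi> \<rho>))"
proof -
  obtain U where U: "PolT len \<subseteq> U" "smooth_on_open U \<phi>" using \<phi> unfolding symp_lift_def by blast
  obtain V where V: "PolT len \<subseteq> V" "smooth_on_open V \<psi>" using \<psi> unfolding symp_lift_def by blast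
  have oV: "open V" "continuous_on V \<psi>" and oU: "open U"
    using V(2) U(2) by (auto simp: smooth_on_open_def dest: spec[of _ 0])
  define W where "W = V \<inter> \<psi> -` U"
  have W: "open W" "PolT len \<subseteq> W" "W \<subseteq> V" "\<psi> ` W \<subseteq> U"
    using continuous_open_preimage[OF oV(2,1) oU] U V P by (auto simp: W_def)
  have "C_times k W (\<lambda>\<rho>. \<phi> (\<psi> \<rho>))" for k
  proof (rule C_times_compose[OF W(1) oU W(4)])
    show "C_times k U \<phi>" using U(2) by (simp add: smooth_on_open_def)
    have "C_times k V \<psi>" using V(2) by (simp add: smooth_on_open_def)
    \<comment> \<open>Smoothness is restricted from \<open>V\<close> to the smaller open set
      \<open>W\<close> by composing with the identity of \<open>W\<close>.\<close>
    then show "C_times k W \<psi>"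
      by (rule C_times_compose[OF W(1) oV(1) _ _ C_times_ident[OF W(1)], unfolded image_ident, OF W(3)])
  qed
  then have sm: "smooth_on_open W (\<lambda>\<rho>. \<phi> (\<psi> \<rho>))" using W(1) by (simp add: smooth_on_open_def)
  have fd: "frechet_derivative (\<lambda>\<rho>. \<phi> (\<psi> \<rho>)) (at \<rho>) v
      = frechet_derivative \<phi> (at (\<psi> \<rho>)) (frechet_derivative \<psi> (at \<rho>) v)" if "\<rho> \<in> PolT len" for \<rho> v
  proof -
    have "((\<lambda>\<rho>. \<phi> (\<psi> \<rho>)) has_derivative (\<lambda>v. frechet_derivative \<phi> (at (\<psi> \<rho>)) (frechet_derivative \<psi> (at \<rho>) v))) (at \<rho>)"
      by (rule has_derivative_compose[OF smooth_on_open_has_derivative[OF V(2)] smooth_on_open_has_derivative[OF U(2)]])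
        (use that P U(1) V(1) in auto)
    from fun_cong[OF frechet_derivative_at[OF this], of v] show ?thesis by (rule sym)
  qed
  show ?thesis
    unfolding symp_lift_def
  proof (intro conjI ballI)
    show "\<exists>U. PolT len \<subseteq> U \<and> smooth_on_open U (\<lambda>\<rho>. \<phi> (\<psi> \<rho>))" using W(2) sm by blast
    fix \<rho> v assume \<rho>: "\<rho> \<in> PolT len" and v: "v \<in> tangent \<rho>"
    have t: "frechet_derivative \<psi> (at \<rho>) v \<in> tangent (\<psi> \<rho>)" if "v \<in> tangent \<rho>" for v
      using \<psi> \<rho> that unfolding symp_lift_def by blast
    then show "frechet_derivative (\<lambda>\<rho>. \<phi> (\<psi> \<rho>)) (at \<rho>) v \<in> tangent (\<phi> (\<psi> \<rho>))"
      unfolding fd[OF \<rho>] using \<phi> P[OF \<rho>] v unfolding symp_lift_def by blast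
    fix w assume w: "w \<in> tangent \<rho>"
    have "omega (\<phi> (\<psi> \<rho>)) (frechet_derivative \<phi> (at (\<psi> \<rho>)) (frechet_derivative \<psi> (at \<rho>) v))
        (frechet_derivative \<phi> (at (\<psi> \<rho>)) (frechet_derivative \<psi> (at \<rho>) w))
      = omega (\<psi> \<rho>) (frechet_derivative \<psi> (at \<rho>) v) (frechet_derivative \<psi> (at \<rho>) w)"
      using \<phi> P[OF \<rho>] t v w unfolding symp_lift_def by blast
    also have "\<dots> = omega \<rho> v w" using \<psi> \<rho> v w unfolding symp_lift_def by blast
    finally show "omega (\<phi> (\<psi> \<rho>)) (frechet_derivative (\<lambda>\<rho>. \<phi> (\<psi> \<rho>)) (at \<rho>) v)
        (frechet_derivative (\<lambda>\<rho>. \<phi> (\<psi> \<rho>)) (at \<rho>) w) = omega \<rho> v w"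
      unfolding fd[OF \<rho>] .
  qed
qed

lemma class_map_Symp:
  assumes e: "equivariant len \<psi>" "equivariant len \<psi>'" and s: "symp_lift len \<psi>" "symp_lift len \<psi>'"
    and inv: "\<And>\<rho>. \<rho> \<in> PolT len \<Longrightarrow> \<psi> (\<psi>' \<rho>) = \<rho>" "\<And>\<rho>. \<rho> \<in> PolT len \<Longrightarrow> \<psi>' (\<psi> \<rho>) = \<rho>"
  shows "class_map len \<psi> \<in> Symp len"
proof -
  have maps: "class_map len \<phi> p \<in> Pol len" if "equivariant len \<phi>" "p \<in> Pol len" for \<phi> p
    using that(2) by (rule Pol_cases) (simp add: class_map[OF that(1)] equivariantD[OF that(1)])
  have i1: "class_map len \<psi>' (class_map len \<psi> p) = p" if "p \<in> Pol len" for p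
    using that by (rule Pol_cases) (simp add: class_map e equivariantD[OF e(1)] inv)
  have i2: "class_map len \<psi> (class_map len \<psi>' p) = p" if "p \<in> Pol len" for p
    using that by (rule Pol_cases) (simp add: class_map e equivariantD[OF e(2)] inv)
  have bij: "bij_betw (class_map len \<psi>) (Pol len) (Pol len)"
    by (rule bij_betwI[where g = "class_map len \<psi>'"]) (use maps e i1 i2 in auto)
  then have B: "class_map len \<psi> \<in> Bij (Pol len)" by (simp add: Bij_def)
  have inv_eq: "inv_into (Pol len) (class_map len \<psi>) p = class_map len \<psi>' p" if "p \<in> Pol len" for p
    using bij by (intro inv_into_f_eq) (auto simp: bij_betw_def maps e i2 that)
  have lift: "\<exists>U. \<rho> \<in> U \<and> smooth_lift len f U \<phi>"
    if eq: "equivariant len \<phi>" and sl: "symp_lift len \<phi>" and feq: "\<And>p. p \<in> Pol len \<Longrightarrow> f p = class_map len \<phi> p" and \<rho>: "\<rho> \<in> PolT len" for \<phi> f \<rho>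
  proof -
    obtain U where "PolT len \<subseteq> U" "smooth_on_open U \<phi>" using sl unfolding symp_lift_def by blast
    then have "\<rho> \<in> U \<and> smooth_lift len f U \<phi>"
      unfolding smooth_lift_def using \<rho> by (auto simp: feq class_map[OF eq] equivariantD[OF eq])
    then show ?thesis by blast
  qed
  show ?thesis
    unfolding Symp_def
  proof (intro CollectI conjI ballI B)
    fix \<rho> assume \<rho>: "\<rho> \<in> PolT len"
    obtain U where "\<rho> \<in> U" "smooth_lift len (class_map len \<psi>) U \<psi>" using lift[OF e(1) s(1) _ \<rho>] by blast
    moreover have "\<forall>v\<in>tangent \<rho>. \<forall>w\<in>tangent \<rho>.
           omega (\<psi> \<rho>) (frechet_derivative \<psi> (at \<rho>) v) (frechet_derivative \<psi> (at \<rho>) w) = omega \<rho> v w"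
      using s(1) \<rho> unfolding symp_lift_def by blast
    ultimately show "\<exists>U \<psi>'. \<rho> \<in> U \<and> smooth_lift len (class_map len \<psi>) U \<psi>' \<and>
        (\<forall>v\<in>tangent \<rho>. \<forall>w\<in>tangent \<rho>.
           omega (\<psi>' \<rho>) (frechet_derivative \<psi>' (at \<rho>) v) (frechet_derivative \<psi>' (at \<rho>) w) = omega \<rho> v w)"
      by (intro exI[of _ U] exI[of _ \<psi>] conjI)
    obtain V where "\<rho> \<in> V \<and> smooth_lift len (inv_into (Pol len) (class_map len \<psi>)) V \<psi>'"
      using lift[OF e(2) s(2) inv_eq \<rho>] by blast
    then show "\<exists>U \<psi>'. \<rho> \<in> U \<and> smooth_lift len (inv_into (Pol len) (class_map len \<psi>)) U \<psi>'"
      by (intro exI[of _ V] exI[of _ \<psi>'])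
  qed
qed

section \<open>Commuting families of bendings\<close>

primrec bends :: "(nat \<Rightarrow> 'e::finite set) \<Rightarrow> (nat \<Rightarrow> complex) \<Rightarrow> nat \<Rightarrow> real ^ 3 ^ 'e \<Rightarrow> real ^ 3 ^ 'e" where
  "bends I z 0 \<rho> = \<rho>"
| "bends I z (Suc k) \<rho> = bend (I k) (z k) (bends I z k \<rho>)"

lemma bends_cong: "(\<And>k. k < m \<Longrightarrow> z k = w k) \<Longrightarrow> bends I z m \<rho> = bends I w m \<rho>"
  by (induction m) auto

lemma bends_ones: "(\<And>k. k < m \<Longrightarrow> z k = 1) \<Longrightarrow> bends I z m \<rho> = \<rho>"
  by (induction m) auto

text \<open>The motion of the axis does not show at time 0: its velocity \<open>u'\<close> is
  multiplied by \<open>sin (t * x)\<close> and \<open>1 - cos (t * x)\<close>, which vanish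
  there.\<close>

lemma has_vector_derivative_bend:
  assumes g: "(g has_vector_derivative g') (at 0)" and nz: "bsum I (g 0) \<noteq> 0"
  shows "((\<lambda>t. bend I (cis (t * x)) (g t)) has_vector_derivative g' + x *\<^sub>R bend_field I (g 0)) (at 0)"
proof -
  define u where "u t = sgn (bsum I (g t))" for t
  obtain u' where u: "(u has_vector_derivative u') (at 0)"
    using has_vector_derivative_sgn[OF has_vector_derivative_bsum[OF g] nz] unfolding u_def[abs_def] by blast
  have c: "((\<lambda>t. cos (t * x)) has_vector_derivative 0) (at 0)" "((\<lambda>t. sin (t * x)) has_vector_derivative x) (at 0)"
    "((\<lambda>t. 1 - cos (t * x)) has_vector_derivative 0) (at 0)"
    unfolding has_real_derivative_iff_has_vector_derivative[symmetric]
    by (auto intro!: derivative_eq_intros)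
  have "((\<lambda>t. bend I (cis (t * x)) (g t) $ e) has_vector_derivative (g' + x *\<^sub>R bend_field I (g 0)) $ e) (at 0)" for e
  proof (cases "e \<in> I")
    case True
    note ge = has_vector_derivative_nth[OF g, of e]
    note d = has_vector_derivative_add[OF has_vector_derivative_add[OF
      has_vector_derivative_scaleR'[OF c(1) ge]
      has_vector_derivative_scaleR'[OF c(2) has_vector_derivative_cross3[OF u ge]]]
      has_vector_derivative_scaleR'[OF has_vector_derivative_mult[OF c(3) has_vector_derivative_inner[OF u ge]] u]]
    have "(\<lambda>t. bend I (cis (t * x)) (g t) $ e) = (\<lambda>t. cos (t * x) *\<^sub>R g t $ e + sin (t * x) *\<^sub>R (u t \<times>\<^sub>3 (g t $ e))
        + ((1 - cos (t * x)) * (u t \<bullet> g t $ e)) *\<^sub>R u t)"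
      using True by (simp add: bend_nth rot_def u_def)
    then show ?thesis using d True by (simp add: bend_field_nth u_def)
  next
    case False
    then show ?thesis using has_vector_derivative_nth[OF g, of e] by (simp add: bend_nth bend_field_nth)
  qed
  then have "((\<lambda>t. \<chi> e. bend I (cis (t * x)) (g t) $ e) has_derivative
      (\<lambda>h. \<chi> e. h *\<^sub>R ((g' + x *\<^sub>R bend_field I (g 0)) $ e))) (at 0)"
    unfolding has_vector_derivative_def by (rule has_derivative_vec_lambda)
  moreover have "(\<lambda>h. \<chi> e. h *\<^sub>R ((g' + x *\<^sub>R bend_field I (g 0)) $ e)) = (\<lambda>h. h *\<^sub>R (g' + x *\<^sub>R bend_field I (g 0)))"
    by (simp add: vec_eq_iff fun_eq_iff)
  ultimately show ?thesis by (simp only: has_vector_derivative_def vec_nth_inverse)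
qed

text \<open>Indices grow outwards: a later block contains or avoids an earlier one. Since
  \<open>bends\<close> starts with index 0, an outer block still has its original sum when its turn
  comes.\<close>

locale bending_chain = polygon_space len for len :: "'e::finite \<Rightarrow> real" +
  fixes I :: "nat \<Rightarrow> 'e set" and d :: nat
  assumes bsum_nonzero: "k < d \<Longrightarrow> \<rho> \<in> PolT len \<Longrightarrow> bsum (I k) \<rho> \<noteq> 0"
    and laminar: "j < k \<Longrightarrow> k < d \<Longrightarrow> I j \<subseteq> I k \<or> I j \<inter> I k = {}"
begin

definition angles :: "(nat \<Rightarrow> complex) set" where
  "angles = {z. \<forall>k<d. norm (z k) = 1}"

lemma anglesD: "z \<in> angles \<Longrightarrow> k < d \<Longrightarrow> norm (z k) = 1"
  by (simp add: angles_def)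

lemma angles_mult: "z \<in> angles \<Longrightarrow> w \<in> angles \<Longrightarrow> (\<lambda>k. z k * w k) \<in> angles"
  by (simp add: angles_def norm_mult)

lemma angles_cis: "(\<lambda>k. cis (x k)) \<in> angles"
  by (simp add: angles_def)

lemma equivariant_bends: "z \<in> angles \<Longrightarrow> m \<le> d \<Longrightarrow> equivariant len (bends I z m)"
proof (induction m)
  case 0
  have "bends I z 0 = (\<lambda>\<rho>. \<rho>)" by (rule ext) simp
  then show ?case using equivariant_id by metis
next
  case (Suc m)
  have "bends I z (Suc m) = (\<lambda>\<rho>. bend (I m) (z m) (bends I z m \<rho>))" by (rule ext) simp
  moreover have "equivariant len (bend (I m) (z m))"
    using Suc.prems by (intro equivariant_bend bsum_nonzero anglesD) auto
  ultimately show ?case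
    using equivariant_comp[of len "bend (I m) (z m)" "bends I z m"] Suc by simp
qed

lemma bends_PolT: "z \<in> angles \<Longrightarrow> m \<le> d \<Longrightarrow> \<rho> \<in> PolT len \<Longrightarrow> bends I z m \<rho> \<in> PolT len"
  using equivariantD[OF equivariant_bends] by blast

lemma symp_lift_bends: "z \<in> angles \<Longrightarrow> m \<le> d \<Longrightarrow> symp_lift len (bends I z m)"
proof (induction m)
  case 0
  have "bends I z 0 = (\<lambda>\<rho>. \<rho>)" by (rule ext) simp
  then show ?case using symp_lift_id by metis
next
  case (Suc m)
  have "bends I z (Suc m) = (\<lambda>\<rho>. bend (I m) (z m) (bends I z m \<rho>))" by (rule ext) simp
  moreover have "symp_lift len (bend (I m) (z m))"
    using Suc.prems by (intro symp_lift_bend bsum_nonzero anglesD) auto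
  ultimately show ?case
    using symp_lift_comp[of len "bend (I m) (z m)" "bends I z m"] Suc bends_PolT[OF Suc.prems(1), of m] by simp
qed

lemma bends_bend_commute:
  assumes z: "z \<in> angles" and k: "k < d" and w: "norm w = 1" and \<rho>: "\<rho> \<in> PolT len"
  shows "m \<le> k \<Longrightarrow> bend (I k) w (bends I z m \<rho>) = bends I z m (bend (I k) w \<rho>)"
proof (induction m)
  case (Suc m)
  then have m: "m < k" "m < d" using k by auto
  have P: "bends I z m \<rho> \<in> PolT len" using z m \<rho> by (intro bends_PolT) auto
  have "bend (I k) w (bend (I m) (z m) (bends I z m \<rho>)) = bend (I m) (z m) (bend (I k) w (bends I z m \<rho>))"
  proof (cases "I m \<inter> I k = {}")
    case True then show ?thesis by (rule bend_commute_disjoint[symmetric])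
  next
    case False
    then show ?thesis
      using laminar[OF m(1) k] bend_commute_subset[OF _ bsum_nonzero[OF m(2) P] bsum_nonzero[OF k P] anglesD[OF z m(2)] w]
      by auto
  qed
  with Suc show ?case by simp
qed simp

text \<open>The bending at \<open>m\<close> by \<open>w m\<close> commutes with all earlier ones, so
  it can be moved next to the one by \<open>z m\<close>, with which it shares the axis.\<close>

lemma bends_mult:
  assumes z: "z \<in> angles" and w: "w \<in> angles" and \<rho>: "\<rho> \<in> PolT len"
  shows "m \<le> d \<Longrightarrow> bends I z m (bends I w m \<rho>) = bends I (\<lambda>k. z k * w k) m \<rho>"
proof (induction m)
  case (Suc m)
  then have m: "m < d" by simp
  have P: "bends I w m \<rho> \<in> PolT len" using w m \<rho> by (intro bends_PolT) auto
  have Q: "bends I z m (bends I w m \<rho>) \<in> PolT len" by (rule bends_PolT[OF z _ P]) (use m in simp)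
  have "bends I z m (bend (I m) (w m) (bends I w m \<rho>)) = bend (I m) (w m) (bends I z m (bends I w m \<rho>))"
    by (rule bends_bend_commute[OF z m anglesD[OF w m] P, symmetric]) simp
  then show ?case
    using Suc by (simp add: bend_bend[OF bsum_nonzero[OF m Q[unfolded Suc.IH[OF less_imp_le[OF m]]]] anglesD[OF w m]])
qed simp

lemma bsum_bends:
  assumes z: "z \<in> angles" and k: "k < d" and \<rho>: "\<rho> \<in> PolT len"
  shows "m \<le> k \<Longrightarrow> bsum (I k) (bends I z m \<rho>) = bsum (I k) \<rho>"
proof (induction m)
  case (Suc m)
  then have m: "m < k" "m < d" using k by auto
  have P: "bends I z m \<rho> \<in> PolT len" using z m \<rho> by (intro bends_PolT) auto
  have "bsum (I k) (bend (I m) (z m) (bends I z m \<rho>)) = bsum (I k) (bends I z m \<rho>)"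
    using laminar[OF m(1) k]
  proof
    assume "I m \<subseteq> I k" then show ?thesis by (rule bsum_bend_superset[OF bsum_nonzero[OF m(2) P] anglesD[OF z m(2)]])
  qed (rule bsum_bend_disjoint)
  with Suc show ?case by simp
qed simp

lemma bends_velocity_0:
  assumes \<rho>: "\<rho> \<in> PolT len"
  shows "m \<le> d \<Longrightarrow> ((\<lambda>t. bends I (\<lambda>k. cis (t * x k)) m \<rho>) has_vector_derivative (\<Sum>k<m. x k *\<^sub>R bend_field (I k) \<rho>)) (at 0)"
proof (induction m)
  case (Suc m)
  have 0: "bends I (\<lambda>k. cis (0 * x k)) m \<rho> = \<rho>" by (rule bends_ones) simp
  have "bsum (I m) \<rho> \<noteq> 0" using Suc.prems by (intro bsum_nonzero \<rho>) simp
  then show ?case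
    using has_vector_derivative_bend[OF Suc.IH, of "I m" "x m"] Suc.prems unfolding 0 by simp
qed simp

text \<open>By the group law the curve can be restarted at its point of time \<open>t\<close>, which
  reduces the claim to time 0.\<close>

lemma bends_velocity:
  assumes \<rho>: "\<rho> \<in> PolT len"
  shows "((\<lambda>t. bends I (\<lambda>k. cis (t * x k)) d \<rho>) has_vector_derivative
    (\<Sum>k<d. x k *\<^sub>R bend_field (I k) (bends I (\<lambda>k. cis (t * x k)) d \<rho>))) (at t)"
proof -
  let ?g = "\<lambda>t. bends I (\<lambda>k. cis (t * x k)) d \<rho>"
  have P: "?g t \<in> PolT len" by (intro bends_PolT angles_cis \<rho>) simp
  have eq: "?g = (\<lambda>s. bends I (\<lambda>k. cis ((s - t) * x k)) d (?g t))"
    by (rule ext) (simp add: bends_mult[OF angles_cis angles_cis \<rho>] cis_mult algebra_simps)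
  have "((\<lambda>s. bends I (\<lambda>k. cis ((s - t) * x k)) d (?g t)) has_vector_derivative
      1 *\<^sub>R (\<Sum>k<d. x k *\<^sub>R bend_field (I k) (?g t))) (at t)"
  proof (rule vector_diff_chain_at[unfolded o_def])
    show "((\<lambda>s. s - t) has_vector_derivative 1) (at t)"
      by (auto intro!: derivative_eq_intros simp flip: has_real_derivative_iff_has_vector_derivative)
    show "((\<lambda>h. bends I (\<lambda>k. cis (h * x k)) d (?g t)) has_vector_derivative
        (\<Sum>k<d. x k *\<^sub>R bend_field (I k) (?g t))) (at (t - t))"
      using bends_velocity_0[OF P, of d x] by simp
  qed
  then have "((\<lambda>s. bends I (\<lambda>k. cis ((s - t) * x k)) d (?g t)) has_vector_derivative
      (\<Sum>k<d. x k *\<^sub>R bend_field (I k) (?g t))) (at t)" by (simp only: scaleR_one)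
  then show ?thesis by (subst eq)
qed

definition \<theta> :: "(nat \<Rightarrow> complex) \<Rightarrow> (real ^ 3 ^ 'e) set \<Rightarrow> (real ^ 3 ^ 'e) set" where
  "\<theta> z = class_map len (bends I z d)"

lemma \<theta>_class: "z \<in> angles \<Longrightarrow> \<rho> \<in> PolT len \<Longrightarrow> \<theta> z (pol_class len \<rho>) = pol_class len (bends I z d \<rho>)"
  by (simp add: \<theta>_def class_map equivariant_bends)

lemma \<theta>_cong: "(\<And>k. k < d \<Longrightarrow> z k = w k) \<Longrightarrow> \<theta> z = \<theta> w"
  unfolding \<theta>_def by (intro arg_cong[of _ _ "class_map len"] ext bends_cong)

lemma omega_sum_left: "omega \<rho> (\<Sum>k\<in>A. v k) w = (\<Sum>k\<in>A. omega \<rho> (v k) w)"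
proof (induction A rule: infinite_finite_induct)
  case (insert k A) then show ?case by (simp add: omega_add_left)
qed (simp_all add: omega_def kks_form_def)

lemma \<theta>_flow: "is_hamiltonian_flow len (\<lambda>p. \<Sum>k<d. x k * f_len (I k) p) (\<lambda>t. \<theta> (\<lambda>k. cis (t * x k)))"
  unfolding is_hamiltonian_flow_def
proof (intro conjI allI ballI)
  show "\<theta> (\<lambda>k. cis (t * x k)) \<in> extensional (Pol len)" for t
    by (simp add: \<theta>_def)
  fix p assume "p \<in> Pol len"
  then obtain \<rho> where \<rho>: "\<rho> \<in> PolT len" "p = pol_class len \<rho>" by (rule Pol_cases)
  let ?g = "\<lambda>t. bends I (\<lambda>k. cis (t * x k)) d \<rho>"
  have P: "?g t \<in> PolT len" for t by (intro bends_PolT angles_cis \<rho>) simp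
  show "\<theta> (\<lambda>k. cis (0 * x k)) p = p"
    unfolding \<rho>(2) \<theta>_class[OF angles_cis \<rho>(1)] by (subst bends_ones) simp_all
  show "hamiltonian_curve len (\<lambda>p. \<Sum>k<d. x k * f_len (I k) p) (\<lambda>t. \<theta> (\<lambda>k. cis (t * x k)) p)"
    unfolding hamiltonian_curve_def
  proof (rule exI[of _ ?g], rule exI[of _ "\<lambda>t. \<Sum>k<d. x k *\<^sub>R bend_field (I k) (?g t)"], intro allI conjI)
    fix t
    show "?g t \<in> PolT len" by (rule P)
    show "\<theta> (\<lambda>k. cis (t * x k)) p = pol_class len (?g t)"
      unfolding \<rho>(2) by (rule \<theta>_class[OF angles_cis \<rho>(1)])
    show "(?g has_vector_derivative (\<Sum>k<d. x k *\<^sub>R bend_field (I k) (?g t))) (at t)"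
      by (rule bends_velocity[OF \<rho>(1)])
    let ?D = "\<lambda>w. \<Sum>k<d. x k * (sgn (bsum (I k) (?g t)) \<bullet> bsum (I k) w)"
    have "((\<lambda>\<sigma>. \<Sum>k<d. x k * f_len (I k) (pol_class len \<sigma>)) has_derivative ?D) (at (?g t) within PolT len)"
      by (intro has_derivative_sum has_derivative_mult_right f_len_has_derivative P bsum_nonzero) simp
    moreover have "omega (?g t) (\<Sum>k<d. x k *\<^sub>R bend_field (I k) (?g t)) w = ?D w" if "w \<in> tangent (?g t)" for w
      by (simp add: omega_sum_left omega_scaleR_left omega_bend_field[OF P that])
    ultimately show "\<exists>D. ((\<lambda>\<sigma>. \<Sum>k<d. x k * f_len (I k) (pol_class len \<sigma>)) has_derivative D) (at (?g t) within PolT len) \<and>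
        (\<forall>w\<in>tangent (?g t). omega (?g t) (\<Sum>k<d. x k *\<^sub>R bend_field (I k) (?g t)) w = D w)"
      by (intro exI[of _ ?D] conjI ballI)
  qed
qed

lemma \<theta>_Symp:
  assumes z: "z \<in> angles" shows "\<theta> z \<in> Symp len"
proof -
  let ?w = "\<lambda>k. cnj (z k)"
  have w: "?w \<in> angles" using z by (simp add: angles_def)
  have 1: "z k * cnj (z k) = 1" if "k < d" for k
    using anglesD[OF z that] complex_norm_square[of "z k"] by simp
  then have 2: "cnj (z k) * z k = 1" if "k < d" for k
    using that by (subst mult.commute) simp
  show ?thesis
    unfolding \<theta>_def
  proof (rule class_map_Symp[of _ _ "bends I ?w d"])
    fix \<rho> assume \<rho>: "\<rho> \<in> PolT len"
    show "bends I z d (bends I ?w d \<rho>) = \<rho>"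
      unfolding bends_mult[OF z w \<rho> order_refl] by (rule bends_ones, rule 1)
    show "bends I ?w d (bends I z d \<rho>) = \<rho>"
      unfolding bends_mult[OF w z \<rho> order_refl] by (rule bends_ones, rule 2)
  qed (rule equivariant_bends[OF z order_refl] equivariant_bends[OF w order_refl]
      symp_lift_bends[OF z order_refl] symp_lift_bends[OF w order_refl])+
qed

lemma \<theta>_mult:
  assumes "z \<in> angles" "w \<in> angles"
  shows "compose (Pol len) (\<theta> z) (\<theta> w) = \<theta> (\<lambda>k. z k * w k)"
proof -
  have "compose (Pol len) (\<theta> z) (\<theta> w) = class_map len (\<lambda>\<rho>. bends I z d (bends I w d \<rho>))"
    unfolding \<theta>_def by (intro class_map_comp equivariant_bends assms) simp_all
  also have "\<dots> = \<theta> (\<lambda>k. z k * w k)"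
    unfolding \<theta>_def
  proof (rule class_map_eqI[OF class_map_extensional])
    have e: "equivariant len (\<lambda>\<rho>. bends I z d (bends I w d \<rho>))"
      by (rule equivariant_comp[OF equivariant_bends[OF assms(1)] equivariant_bends[OF assms(2)]]) simp_all
    show "equivariant len (bends I (\<lambda>k. z k * w k) d)"
      by (intro equivariant_bends angles_mult assms) simp
    show "class_map len (\<lambda>\<rho>. bends I z d (bends I w d \<rho>)) (pol_class len \<rho>) = pol_class len (bends I (\<lambda>k. z k * w k) d \<rho>)"
      if "\<rho> \<in> PolT len" for \<rho>
      using that by (simp add: class_map[OF e] bends_mult assms)
  qed
  finally show ?thesis .
qed

end

context polygon_space
begin

text \<open>\<open>hamiltonian_flow\<close> is a definite description: existence is the case of a
  chain with the single block \<open>J\<close>, uniqueness is \<open>hamiltonian_curve_bend\<close>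
  together with extensionality.\<close>

lemma bending_flow_eq:
  assumes J: "\<And>\<rho>. \<rho> \<in> PolT len \<Longrightarrow> bsum J \<rho> \<noteq> 0"
  shows "bending_flow len J t = class_map len (bend J (cis t))"
proof -
  interpret bending_chain len "\<lambda>_. J" "Suc 0" by unfold_locales (use J in auto)
  have one: "\<theta> z = class_map len (bend J (z 0))" for z
    unfolding \<theta>_def by (intro arg_cong[of _ _ "class_map len"] ext) simp
  have flow: "is_hamiltonian_flow len (f_len J) (\<lambda>t. class_map len (bend J (cis t)))"
    using \<theta>_flow[of "\<lambda>_. 1"] by (simp add: one)
  have unique: "\<Phi> = (\<lambda>t. class_map len (bend J (cis t)))" if "is_hamiltonian_flow len (f_len J) \<Phi>" for \<Phi>
  proof
    fix t
    show "\<Phi> t = class_map len (bend J (cis t))"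
    proof (rule extensionalityI)
      show "\<Phi> t \<in> extensional (Pol len)" using that by (simp add: is_hamiltonian_flow_def)
      fix p assume "p \<in> Pol len"
      then have "\<Phi> 0 p = p" "hamiltonian_curve len (f_len J) (\<lambda>t. \<Phi> t p)"
        using that by (simp_all add: is_hamiltonian_flow_def)
      with hamiltonian_curve_bend[OF J this(2), of t] show "\<Phi> t p = class_map len (bend J (cis t)) p" by simp
    qed simp
  qed
  have "hamiltonian_flow len (f_len J) = (\<lambda>t. class_map len (bend J (cis t)))"
    unfolding hamiltonian_flow_def by (rule the_equality) (fact flow, fact unique)
  then show ?thesis by (simp add: bending_flow_def)
qed

end

section \<open>Polygons in general position\<close>

lemma cross3_parallel_trans:
  assumes "x \<times>\<^sub>3 y = 0" "y \<times>\<^sub>3 z = 0" "y \<noteq> 0" shows "x \<times>\<^sub>3 z = 0"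
proof -
  have "(y \<bullet> y) *\<^sub>R x = (y \<bullet> x) *\<^sub>R y"
    using Lagrange[of y y x] assms(1) cross_skew[of x y] by simp
  then have "(y \<bullet> y) *\<^sub>R (x \<times>\<^sub>3 z) = (y \<bullet> x) *\<^sub>R (y \<times>\<^sub>3 z)"
    by (metis cross_mult_left)
  with assms(2,3) show ?thesis by simp
qed

lemma rot_fixed_imp_one:
  assumes u: "norm u = 1" and z: "norm z = 1" and ux: "u \<times>\<^sub>3 x \<noteq> 0" and fixd: "rot z u x = x"
  shows "z = 1"
proof -
  have "rot z u x \<bullet> (u \<times>\<^sub>3 x) = x \<bullet> (u \<times>\<^sub>3 x)" by (simp add: fixd)
  then have "Im z * ((u \<times>\<^sub>3 x) \<bullet> (u \<times>\<^sub>3 x)) = 0"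
    by (simp add: rot_def inner_add_left dot_cross_self)
  with ux have I: "Im z = 0" by simp
  have "u \<times>\<^sub>3 rot z u x = u \<times>\<^sub>3 x" by (simp add: fixd)
  then have "Re z *\<^sub>R (u \<times>\<^sub>3 x) = u \<times>\<^sub>3 x"
    by (simp add: rot_def I cross_add_right cross_mult_right)
  then have "(Re z - 1) *\<^sub>R (u \<times>\<^sub>3 x) = 0" by (simp add: scaleR_left_diff_distrib)
  with ux have "Re z = 1" by simp
  with I show ?thesis by (simp add: complex_eq_iff)
qed

text \<open>The cross product of \<open>p\<close> and \<open>q\<close> is fixed as well, so
  \<open>f x - x\<close> is orthogonal to three vectors that span the space.\<close>

lemma rotf_fixing_two:
  assumes f: "rotf f" and p: "f p = p" and q: "f q = q" and pq: "p \<times>\<^sub>3 q \<noteq> 0"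
  shows "f x = x"
proof -
  have inn: "f x \<bullet> f y = x \<bullet> y" and cr: "f (x \<times>\<^sub>3 y) = f x \<times>\<^sub>3 f y" for x y
    using f by (simp_all add: rotf_def)
  define n where "n = p \<times>\<^sub>3 q"
  define w where "w = f x - x"
  have fn: "f n = n" by (simp add: n_def cr p q)
  have o: "w \<bullet> p = 0" "w \<bullet> q = 0" "w \<bullet> n = 0"
    using inn[of x p] inn[of x q] inn[of x n] by (simp_all add: w_def inner_diff_left p q fn)
  have "n \<times>\<^sub>3 w = 0"
    using cross3_cross3_left[of p q w] o(1,2) by (simp add: n_def inner_commute)
  moreover have "n \<bullet> w = 0" using o(3) by (simp add: inner_commute)
  ultimately have "w = 0" using norm_and_cross_eq_0[of n w] pq by (simp add: n_def)
  then show ?thesis by (simp add: w_def)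
qed

lemma bsum_move:
  assumes "e \<in> X" "\<And>g. g \<in> X \<Longrightarrow> g \<noteq> e \<Longrightarrow> \<sigma> $ g = \<rho> $ g"
  shows "bsum X \<sigma> = bsum X \<rho> + (\<sigma> $ e - \<rho> $ e)"
proof -
  have "(\<Sum>g\<in>X - {e}. \<sigma> $ g) = (\<Sum>g\<in>X - {e}. \<rho> $ g)" using assms(2) by (intro sum.cong) auto
  then show ?thesis unfolding bsum_def by (simp add: sum.remove[OF _ assms(1)])
qed

lemma bsum_eqI: "(\<And>g. g \<in> X \<Longrightarrow> \<sigma> $ g = \<rho> $ g) \<Longrightarrow> bsum X \<sigma> = bsum X \<rho>"
  unfolding bsum_def by (rule sum.cong) auto

lemma continuous_on_bend:
  "continuous_on (UNIV \<times> {\<rho>. bsum I \<rho> \<noteq> 0}) (\<lambda>x. bend I (fst x) (snd x))"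
  unfolding bend_def
proof (rule continuous_on_vec_lambda)
  fix e
  let ?S = "(UNIV :: complex set) \<times> {\<rho> :: real ^ 3 ^ 'a. bsum I \<rho> \<noteq> 0}"
  have b: "continuous_on ?S (\<lambda>x. bsum I (snd x))"
    by (intro linear_continuous_on_compose[OF _ bounded_linear.linear[OF bounded_linear_bsum]] continuous_intros)
  have s: "continuous_on ?S (\<lambda>x. sgn (bsum I (snd x)))"
    unfolding sgn_div_norm by (intro continuous_intros b) auto
  have c: "continuous_on ?S (\<lambda>x. snd x $ e)" by (intro continuous_intros)
  show "continuous_on ?S (\<lambda>x. if e \<in> I then rot (fst x) (sgn (bsum I (snd x))) (snd x $ e) else snd x $ e)"
  proof (cases "e \<in> I")
    case True
    have "continuous_on ?S (\<lambda>x. rot (fst x) (sgn (bsum I (snd x))) (snd x $ e))"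
      unfolding rot_def by (intro continuous_intros continuous_on_cross s c)
    with True show ?thesis by simp
  next
    case False
    with c show ?thesis by simp
  qed
qed

context polygon_space
begin

text \<open>Bending the pair \<open>{e, f}\<close> by a small angle \<open>t\<close> or
  \<open>- t\<close> displaces the edge \<open>e\<close> by \<open>(1 - cos t) *\<^sub>R A\<close>
  plus or minus \<open>sin t *\<^sub>R B\<close>. If both displacements were parallel to
  \<open>p\<close>, so would be the orthogonal nonzero vectors \<open>A\<close> and
  \<open>B\<close>.\<close>

lemma pair_move:
  assumes \<rho>: "\<rho> \<in> PolT len" and ef: "\<rho> $ e \<times>\<^sub>3 (\<rho> $ f) \<noteq> 0" and p: "p \<noteq> 0" and eps: "\<epsilon> > 0"
  shows "\<exists>\<sigma>\<in>PolT len. dist \<sigma> \<rho> < \<epsilon> \<and> (\<forall>g. g \<noteq> e \<longrightarrow> g \<noteq> f \<longrightarrow> \<sigma> $ g = \<rho> $ g) \<and> (\<sigma> $ e - \<rho> $ e) \<times>\<^sub>3 p \<noteq> 0"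
proof -
  have "e \<noteq> f" using ef by auto
  then have s: "bsum {e, f} \<rho> = \<rho> $ e + \<rho> $ f" by (simp add: bsum_def)
  have nz: "bsum {e, f} \<rho> \<noteq> 0"
  proof
    assume "bsum {e, f} \<rho> = 0"
    then have "\<rho> $ f = - (\<rho> $ e)" unfolding s by (simp add: eq_neg_iff_add_eq_0 add.commute)
    with ef show False by simp
  qed
  define u where "u = sgn (bsum {e, f} \<rho>)"
  have u: "norm u = 1" using nz by (simp add: u_def norm_sgn)
  define x where "x = \<rho> $ e"
  define B where "B = u \<times>\<^sub>3 x"
  define A where "A = (u \<bullet> x) *\<^sub>R u - x"
  have uu: "u \<bullet> u = 1" using u by (simp add: dot_square_norm)
  have A: "A = u \<times>\<^sub>3 B" by (simp add: A_def B_def Lagrange uu)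
  have B: "B \<noteq> 0"
    using ef nz by (simp add: B_def u_def x_def sgn_div_norm cross_mult_left s cross_add_left cross_skew[of "\<rho> $ f"])
  let ?b = "\<lambda>t. bend {e, f} (cis t) \<rho>"
  have \<delta>: "?b t $ e - \<rho> $ e = (1 - cos t) *\<^sub>R A + sin t *\<^sub>R B" for t
    by (simp add: bend_nth rot_def A_def B_def x_def u_def algebra_simps)
  have "continuous_on UNIV (\<lambda>t. bend {e, f} (fst (cis t, \<rho>)) (snd (cis t, \<rho>)))"
    by (rule continuous_on_compose2[OF continuous_on_bend]) (auto intro!: continuous_intros simp: nz)
  then have "continuous (at 0) ?b" by (simp add: continuous_on_eq_continuous_at)
  then obtain t0 where t0: "t0 > 0" "\<And>t. \<bar>t\<bar> < t0 \<Longrightarrow> dist (?b t) \<rho> < \<epsilon>"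
    unfolding continuous_at_eps_delta using eps by (auto simp: dist_real_def)
  define t where "t = min (t0 / 2) 1"
  have t: "0 < t" "t \<le> 1" "t < t0" using t0(1) by (auto simp: t_def)
  have sn: "sin t > 0" using t pi_gt3 by (intro sin_gt_zero) auto
  have cs: "1 - cos t \<noteq> 0"
    using sn sin_cos_squared_add[of t] by (auto simp: power2_eq_square)
  have "\<exists>r\<in>{t, - t}. (?b r $ e - \<rho> $ e) \<times>\<^sub>3 p \<noteq> 0"
  proof (rule ccontr)
    assume "\<not> ?thesis"
    then have "((1 - cos t) *\<^sub>R A + sin t *\<^sub>R B) \<times>\<^sub>3 p = 0" "((1 - cos t) *\<^sub>R A - sin t *\<^sub>R B) \<times>\<^sub>3 p = 0"
      by (simp_all add: \<delta>)
    then have "(1 - cos t) *\<^sub>R (A \<times>\<^sub>3 p) + sin t *\<^sub>R (B \<times>\<^sub>3 p) = 0" "(1 - cos t) *\<^sub>R (A \<times>\<^sub>3 p) - sin t *\<^sub>R (B \<times>\<^sub>3 p) = 0"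
      by (simp_all only: cross_add_left cross_mult_left Cross3.left_diff_distrib)
    moreover from this have "2 *\<^sub>R ((1 - cos t) *\<^sub>R (A \<times>\<^sub>3 p)) = 0" by (simp only: scaleR_2) simp
    ultimately have "A \<times>\<^sub>3 p = 0" "B \<times>\<^sub>3 p = 0" using sn cs by simp_all
    then have "A \<times>\<^sub>3 B = 0"
      using cross3_parallel_trans[of A p B] p cross_skew[of B p] by simp
    moreover have "B \<bullet> u = 0" by (simp add: B_def dot_cross_self)
    ultimately have "(B \<bullet> B) *\<^sub>R u = 0"
      using cross3_cross3_left[of u B B] by (simp add: A inner_commute)
    with B u show False by auto
  qed
  then obtain r where "r = t \<or> r = - t" "(?b r $ e - \<rho> $ e) \<times>\<^sub>3 p \<noteq> 0" by blast
  moreover from this have "dist (?b r) \<rho> < \<epsilon>" using t by (intro t0(2)) auto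
  moreover have "?b r \<in> PolT len" by (intro bend_PolT \<rho> nz) simp
  moreover have "?b r $ g = \<rho> $ g" if "g \<noteq> e" "g \<noteq> f" for g using that by (simp add: bend_nth)
  ultimately show ?thesis by blast
qed

text \<open>Some edge of \<open>X \<union> Y\<close> is not parallel to some edge outside, for
  otherwise the polygon lies on a line. Moving this pair changes only one of the two sums, by a
  vector that is not parallel to the other sum.\<close>

lemma perturb_nonparallel:
  assumes \<rho>: "\<rho> \<in> PolT len" and XY: "X \<inter> Y = {}" "X \<union> Y \<noteq> UNIV"
    and X: "bsum X \<rho> \<noteq> 0" and Y: "bsum Y \<rho> \<noteq> 0" and eps: "\<epsilon> > 0"
  shows "\<exists>\<sigma>\<in>PolT len. dist \<sigma> \<rho> < \<epsilon> \<and> bsum X \<sigma> \<times>\<^sub>3 bsum Y \<sigma> \<noteq> 0"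
proof (cases "bsum X \<rho> \<times>\<^sub>3 bsum Y \<rho> = 0")
  case False
  then show ?thesis using \<rho> eps by (intro bexI[of _ \<rho>]) auto
next
  case par: True
  have move: "\<exists>\<sigma>\<in>PolT len. dist \<sigma> \<rho> < \<epsilon> \<and> bsum X \<sigma> \<times>\<^sub>3 bsum Y \<sigma> \<noteq> 0"
    if hyp: "e \<in> X" "f \<notin> X \<union> Y" "\<rho> $ e \<times>\<^sub>3 (\<rho> $ f) \<noteq> 0" "X \<inter> Y = {}" "bsum Y \<rho> \<noteq> 0" "bsum X \<rho> \<times>\<^sub>3 bsum Y \<rho> = 0" for e f X Y
  proof -
    obtain \<sigma> where \<sigma>: "\<sigma> \<in> PolT len" "dist \<sigma> \<rho> < \<epsilon>" "\<forall>g. g \<noteq> e \<longrightarrow> g \<noteq> f \<longrightarrow> \<sigma> $ g = \<rho> $ g"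
      "(\<sigma> $ e - \<rho> $ e) \<times>\<^sub>3 bsum Y \<rho> \<noteq> 0"
      using pair_move[OF \<rho> hyp(3,5) eps] by (elim bexE conjE)
    have "bsum X \<sigma> = bsum X \<rho> + (\<sigma> $ e - \<rho> $ e)"
      by (rule bsum_move[OF hyp(1)]) (use \<sigma>(3) hyp(2) in auto)
    moreover have "bsum Y \<sigma> = bsum Y \<rho>"
      by (rule bsum_eqI) (use \<sigma>(3) hyp(1,2,4) in auto)
    ultimately have "bsum X \<sigma> \<times>\<^sub>3 bsum Y \<sigma> \<noteq> 0"
      using \<sigma>(4) hyp(6) by (simp add: cross_add_left)
    with \<sigma> show ?thesis by blast
  qed
  obtain f where f: "f \<notin> X \<union> Y" using XY(2) by blast
  have "X \<noteq> {}" using X by (auto simp: bsum_def)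
  then obtain e0 where e0: "e0 \<in> X" by blast
  have "(\<exists>e\<in>X \<union> Y. \<exists>f'. f' \<notin> X \<union> Y \<and> \<rho> $ e \<times>\<^sub>3 (\<rho> $ f') \<noteq> 0)"
  proof (rule ccontr)
    assume "\<not> ?thesis"
    then have all: "\<rho> $ e \<times>\<^sub>3 (\<rho> $ f') = 0" if "e \<in> X \<union> Y" "f' \<notin> X \<union> Y" for e f'
      using that by blast
    have "\<rho> $ e0 \<times>\<^sub>3 (\<rho> $ g) = 0" for g
    proof (cases "g \<in> X \<union> Y")
      case True
      then show ?thesis
        using cross3_parallel_trans[of "\<rho> $ e0" "\<rho> $ f" "\<rho> $ g"] all[OF _ f, of e0] all[OF True f] e0
          cross_skew[of "\<rho> $ f" "\<rho> $ g"] PolT_nonzero[OF \<rho>, of f] by simp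
    qed (use all e0 in simp)
    then show False using not_on_line[OF \<rho> PolT_nonzero[OF \<rho>, of e0]] by simp
  qed
  then obtain e f' where ef: "e \<in> X \<union> Y" "f' \<notin> X \<union> Y" "\<rho> $ e \<times>\<^sub>3 (\<rho> $ f') \<noteq> 0" by (elim bexE exE conjE)
  show ?thesis
  proof (cases "e \<in> X")
    case True
    show ?thesis by (rule move[OF True ef(2,3) XY(1) Y par])
  next
    case False
    then have e: "e \<in> Y" using ef(1) by simp
    have "\<exists>\<sigma>\<in>PolT len. dist \<sigma> \<rho> < \<epsilon> \<and> bsum Y \<sigma> \<times>\<^sub>3 bsum X \<sigma> \<noteq> 0"
      using XY(1) ef(2) par cross_skew[of "bsum Y \<rho>" "bsum X \<rho>"]
      by (intro move[OF e _ ef(3) _ X]) auto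
    then show ?thesis by (metis cross_skew neg_equal_0_iff_equal)
  qed
qed

text \<open>Every condition is open, so a small enough perturbation that achieves a new one keeps
  those already achieved.\<close>

lemma exists_generic:
  assumes "finite Q"
    and "\<And>X Y. (X, Y) \<in> Q \<Longrightarrow> X \<inter> Y = {} \<and> X \<union> Y \<noteq> UNIV \<and> (\<forall>\<rho>\<in>PolT len. bsum X \<rho> \<noteq> 0 \<and> bsum Y \<rho> \<noteq> 0)"
  shows "\<exists>\<rho>\<in>PolT len. \<forall>(X, Y)\<in>Q. bsum X \<rho> \<times>\<^sub>3 bsum Y \<rho> \<noteq> 0"
  using assms
proof (induction Q rule: finite_induct)
  case empty
  then show ?case using nonempty by auto
next
  case (insert q Q)
  obtain X Y where q: "q = (X, Y)" by (cases q)
  obtain \<rho> where \<rho>: "\<rho> \<in> PolT len" "\<forall>(X, Y)\<in>Q. bsum X \<rho> \<times>\<^sub>3 bsum Y \<rho> \<noteq> 0"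
    using insert.IH insert.prems by (metis insertCI)
  have cont: "continuous_on UNIV (bsum X)" for X :: "'e set" by (rule linear_continuous_on[OF bounded_linear_bsum])
  have "open {\<sigma>. bsum X \<sigma> \<times>\<^sub>3 bsum Y \<sigma> \<noteq> 0}" for X Y :: "'e set"
    by (intro open_Collect_neq continuous_on_cross cont continuous_intros)
  then have op: "open (\<Inter>q\<in>Q. {\<sigma>. bsum (fst q) \<sigma> \<times>\<^sub>3 bsum (snd q) \<sigma> \<noteq> 0})"
    using insert.hyps(1) by (intro open_INT) auto
  have "\<rho> \<in> (\<Inter>q\<in>Q. {\<sigma>. bsum (fst q) \<sigma> \<times>\<^sub>3 bsum (snd q) \<sigma> \<noteq> 0})"
    using \<rho>(2) by auto
  then obtain \<epsilon> where \<epsilon>: "\<epsilon> > 0" "ball \<rho> \<epsilon> \<subseteq> (\<Inter>q\<in>Q. {\<sigma>. bsum (fst q) \<sigma> \<times>\<^sub>3 bsum (snd q) \<sigma> \<noteq> 0})"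
    using op open_contains_ball by blast
  have "X \<inter> Y = {}" "X \<union> Y \<noteq> UNIV" "bsum X \<rho> \<noteq> 0" "bsum Y \<rho> \<noteq> 0"
    using insert.prems[of X Y] \<rho>(1) q by auto
  then obtain \<sigma> where \<sigma>: "\<sigma> \<in> PolT len" "dist \<sigma> \<rho> < \<epsilon>" "bsum X \<sigma> \<times>\<^sub>3 bsum Y \<sigma> \<noteq> 0"
    using perturb_nonparallel[OF \<rho>(1) _ _ _ _ \<epsilon>(1), of X Y] by blast
  then have "\<sigma> \<in> ball \<rho> \<epsilon>" by (simp add: dist_commute)
  then have "\<forall>q\<in>Q. bsum (fst q) \<sigma> \<times>\<^sub>3 bsum (snd q) \<sigma> \<noteq> 0" using \<epsilon>(2) by blast
  with \<sigma> show ?case by (intro bexI[of _ \<sigma>]) (auto simp: q)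
qed

end

section \<open>Effectiveness of the torus action\<close>

context bending_chain
begin

lemma bends_trunc: "m \<le> n \<Longrightarrow> (\<And>k. m \<le> k \<Longrightarrow> k < n \<Longrightarrow> z k = 1) \<Longrightarrow> bends I z n \<rho> = bends I z m \<rho>"
proof (induction n)
  case (Suc n) then show ?case by (cases "m = Suc n") auto
qed simp

lemma bends_nth_notin: "(\<And>k. k < m \<Longrightarrow> e \<notin> I k) \<Longrightarrow> bends I z m \<rho> $ e = \<rho> $ e"
  by (induction m) (auto simp: bend_nth)

lemma bsum_bends_block:
  assumes z: "z \<in> angles" and \<rho>: "\<rho> \<in> PolT len" and B: "\<And>k. k < d \<Longrightarrow> I k \<subseteq> B \<or> I k \<inter> B = {}"
  shows "m \<le> d \<Longrightarrow> bsum B (bends I z m \<rho>) = bsum B \<rho>"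
proof (induction m)
  case (Suc m)
  then have m: "m < d" by simp
  have P: "bends I z m \<rho> \<in> PolT len" using z m \<rho> by (intro bends_PolT) auto
  have "bsum B (bend (I m) (z m) (bends I z m \<rho>)) = bsum B (bends I z m \<rho>)"
    using B[OF m]
  proof
    assume "I m \<subseteq> B" then show ?thesis by (rule bsum_bend_superset[OF bsum_nonzero[OF m P] anglesD[OF z m]])
  qed (rule bsum_bend_disjoint)
  with Suc show ?case by simp
qed simp

text \<open>No block cuts across \<open>B\<close> or \<open>B'\<close>, so their sums survive all
  bendings. A rotation that matches the bent polygon with \<open>\<rho>\<close> fixes these two
  independent vectors and is the identity; hence the polygon itself has not changed, and not only
  its class.\<close>

lemma \<theta>_trivial_imp_ones:
  assumes \<rho>: "\<rho> \<in> PolT len"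
    and a: "\<And>k. k < d \<Longrightarrow> a k \<in> I k" "\<And>j k. j < k \<Longrightarrow> k < d \<Longrightarrow> a k \<notin> I j"
    and ax: "\<And>k. k < d \<Longrightarrow> bsum (I k) \<rho> \<times>\<^sub>3 (\<rho> $ a k) \<noteq> 0"
    and BB: "\<And>k. k < d \<Longrightarrow> I k \<subseteq> B \<or> I k \<inter> B = {}" "\<And>k. k < d \<Longrightarrow> I k \<subseteq> B' \<or> I k \<inter> B' = {}"
    and nz: "bsum B \<rho> \<times>\<^sub>3 bsum B' \<rho> \<noteq> 0"
    and v: "v \<in> angles" and triv: "\<theta> v (pol_class len \<rho>) = pol_class len \<rho>"
  shows "\<forall>k<d. v k = 1"
proof (rule ccontr)
  assume "\<not> ?thesis"
  then have ne: "{k. k < d \<and> v k \<noteq> 1} \<noteq> {}" by blast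
  have P: "bends I v d \<rho> \<in> PolT len" using v \<rho> by (intro bends_PolT) auto
  have "pol_class len \<rho> = pol_class len (bends I v d \<rho>)"
    using triv by (simp add: \<theta>_class[OF v \<rho>])
  then obtain f where f: "rotf f" "\<forall>e. bends I v d \<rho> $ e = f (\<rho> $ e)"
    unfolding pol_class_eq_iff[OF \<rho> P] by (elim exE conjE)
  have "bsum J (bends I v d \<rho>) = f (bsum J \<rho>)" for J
    by (rule bsum_rotf[OF f(1) f(2)[rule_format]])
  then have "f (bsum B \<rho>) = bsum B \<rho>" "f (bsum B' \<rho>) = bsum B' \<rho>"
    using bsum_bends_block[OF v \<rho> BB(1), of d] bsum_bends_block[OF v \<rho> BB(2), of d] by simp_all
  from rotf_fixing_two[OF f(1) this nz] f(2) have same: "bends I v d \<rho> $ e = \<rho> $ e" for e by simp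
  \<comment> \<open>Beyond the last nontrivial angle nothing moves, and \<open>a k\<close> lies in
    no earlier block. So the edge \<open>a k\<close> has been rotated exactly once, by
    \<open>v k\<close> about an axis that it does not lie on.\<close>
  define k where "k = Max {k. k < d \<and> v k \<noteq> 1}"
  have fin: "finite {k. k < d \<and> v k \<noteq> 1}" by simp
  have k: "k < d" "v k \<noteq> 1" using Max_in[OF fin ne] by (auto simp: k_def)
  have after: "v j = 1" if "Suc k \<le> j" "j < d" for j
    using Max_ge[OF fin, of j] that by (fastforce simp: k_def)
  have "\<rho> $ a k = bends I v (Suc k) \<rho> $ a k"
    using bends_trunc[of "Suc k" d v \<rho>] k after same[of "a k"] by simp
  also have "\<dots> = rot (v k) (sgn (bsum (I k) \<rho>)) (\<rho> $ a k)"
    using bends_nth_notin[of k "a k" v \<rho>] a(2)[OF _ k(1)] bsum_bends[OF v k(1) \<rho>, of k]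
    by (simp add: bend_nth a(1)[OF k(1)])
  finally have "rot (v k) (sgn (bsum (I k) \<rho>)) (\<rho> $ a k) = \<rho> $ a k" by simp
  moreover have "sgn (bsum (I k) \<rho>) \<times>\<^sub>3 (\<rho> $ a k) \<noteq> 0"
    using ax[OF k(1)] bsum_nonzero[OF k(1) \<rho>] by (simp add: sgn_div_norm cross_mult_left)
  moreover have "norm (sgn (bsum (I k) \<rho>)) = 1" using bsum_nonzero[OF k(1) \<rho>] by (simp add: norm_sgn)
  ultimately have "v k = 1" using rot_fixed_imp_one anglesD[OF v k(1)] by blast
  with k(2) show False by simp
qed

lemma \<theta>_inj:
  assumes triv: "\<And>v. v \<in> angles \<Longrightarrow> \<theta> v = (\<lambda>p\<in>Pol len. p) \<Longrightarrow> \<forall>k<d. v k = 1"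
  shows "inj_on \<theta> (carrier (torus_group d))"
proof (rule inj_onI)
  fix z w assume zw: "z \<in> carrier (torus_group d)" "w \<in> carrier (torus_group d)" and eq: "\<theta> z = \<theta> w"
  have E: "z \<in> extensional {..<d}" "w \<in> extensional {..<d}"
    using zw by (auto simp: torus_group_def PiE_def)
  have n: "z \<in> angles" "w \<in> angles"
    using zw by (auto simp: torus_group_def circle_group_def angles_def PiE_iff)
  have nc: "(\<lambda>k. cnj (w k)) \<in> angles" using n(2) by (simp add: angles_def)
  have cw: "cnj (w k) * w k = 1" if "k < d" for k
    using anglesD[OF n(2) that] complex_norm_square[of "w k"] by (simp add: mult.commute)
  have "\<theta> (\<lambda>k. cnj (w k) * z k) = compose (Pol len) (\<theta> (\<lambda>k. cnj (w k))) (\<theta> w)"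
    by (simp add: \<theta>_mult[OF nc n(1)] flip: eq)
  also have "\<dots> = \<theta> (\<lambda>k. 1)"
    unfolding \<theta>_mult[OF nc n(2)] by (rule \<theta>_cong) (rule cw)
  also have "\<dots> = (\<lambda>p\<in>Pol len. p)"
  proof (rule extensionalityI[of _ "Pol len"])
    fix p assume "p \<in> Pol len"
    then obtain \<rho> where "\<rho> \<in> PolT len" "p = pol_class len \<rho>" by (rule Pol_cases)
    moreover have "(\<lambda>k. 1) \<in> angles" by (simp add: angles_def)
    ultimately show "\<theta> (\<lambda>k. 1) p = (\<lambda>p\<in>Pol len. p) p" by (simp add: \<theta>_class bends_ones)
  qed (simp_all add: \<theta>_def)
  finally have "\<forall>k<d. cnj (w k) * z k = 1" by (rule triv[OF angles_mult[OF nc n(1)]])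
  then have "z k = w k" if "k < d" for k
    using that cw[OF that] by (metis mult_cancel_left mult_zero_left zero_neq_one)
  then show "z = w" by (intro extensionalityI[OF E]) simp
qed

end

section \<open>Tori of bendings\<close>

lemma group_circle_group: "group circle_group"
proof (rule groupI)
  fix x assume "x \<in> carrier circle_group"
  then have "norm x = 1" by (simp add: circle_group_def)
  then show "\<exists>y\<in>carrier circle_group. y \<otimes>\<^bsub>circle_group\<^esub> x = \<one>\<^bsub>circle_group\<^esub>"
    using complex_norm_square[of x]
    by (intro bexI[of _ "cnj x"]) (simp_all add: circle_group_def mult.commute)
qed (auto simp: circle_group_def norm_mult)

lemma group_torus_group: "group (torus_group d)"
  unfolding torus_group_def using group_circle_group by (rule product_group)

lemma carrier_torus_group: "carrier (torus_group d) = (\<Pi>\<^sub>E k\<in>{..<d}. sphere 0 1)"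
  by (simp add: torus_group_def circle_group_def)

lemma mult_torus_group: "z \<otimes>\<^bsub>torus_group d\<^esub> w = (\<lambda>k\<in>{..<d}. z k * w k)"
  by (simp add: torus_group_def circle_group_def)

lemma topspace_torus_topology: "topspace (torus_topology d) = carrier (torus_group d)"
  by (simp add: torus_topology_def carrier_torus_group)

lemma compact_torus_topology: "compact_space (torus_topology d)"
proof -
  have "compact_space (top_of_set (sphere (0::complex) 1))"
    by (intro compact_space_subtopology) simp
  then show ?thesis
    unfolding torus_topology_def compact_space_product_topology by blast
qed

lemma Hausdorff_torus_topology: "Hausdorff_space (torus_topology d)"
proof -
  have "Hausdorff_space (top_of_set (sphere (0::complex) 1))"
    by (intro Hausdorff_space_subtopology Hausdorff_space_euclidean)
  then show ?thesis
    unfolding torus_topology_def Hausdorff_space_product_topology by blast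
qed

lemma continuous_map_Pair_euclidean:
  fixes f :: "'x \<Rightarrow> 'a::topological_space" and g :: "'x \<Rightarrow> 'b::topological_space"
  assumes f: "continuous_map X euclidean f" and g: "continuous_map X euclidean g"
  shows "continuous_map X euclidean (\<lambda>x. (f x, g x))"
  unfolding continuous_map_def
proof (intro conjI allI impI)
  fix U :: "('a \<times> 'b) set" assume "openin euclidean U"
  then have U: "open U" by simp
  show "openin X {x \<in> topspace X. (f x, g x) \<in> U}"
  proof (subst openin_subopen, intro ballI)
    fix x assume "x \<in> {x \<in> topspace X. (f x, g x) \<in> U}"
    then have x: "(f x, g x) \<in> U" "x \<in> topspace X" by auto
    obtain A B where AB: "open A" "open B" "(f x, g x) \<in> A \<times> B" "A \<times> B \<subseteq> U"
      by (rule open_prod_elim[OF U x(1)], rule that)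
    let ?T = "{x \<in> topspace X. f x \<in> A} \<inter> {x \<in> topspace X. g x \<in> B}"
    have "openin X ?T"
      using openin_continuous_map_preimage[OF f, of A] openin_continuous_map_preimage[OF g, of B] AB(1,2) by (intro openin_Int) auto
    moreover have "x \<in> ?T" "?T \<subseteq> {x \<in> topspace X. (f x, g x) \<in> U}" using AB(3,4) x(2) by auto
    ultimately show "\<exists>T. openin X T \<and> x \<in> T \<and> T \<subseteq> {x \<in> topspace X. (f x, g x) \<in> U}" by blast
  qed
qed simp

context bending_chain
begin

lemma torus_angles: "z \<in> carrier (torus_group d) \<Longrightarrow> z \<in> angles"
  by (auto simp: carrier_torus_group angles_def PiE_iff)

lemma \<theta>_Bij: "z \<in> angles \<Longrightarrow> \<theta> z \<in> Bij (Pol len)"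
  using \<theta>_Symp by (simp add: Symp_def)

lemma \<theta>_hom: "\<theta> \<in> hom (torus_group d) (BijGroup (Pol len))"
proof (rule homI)
  fix z w assume "z \<in> carrier (torus_group d)" "w \<in> carrier (torus_group d)"
  then have n: "z \<in> angles" "w \<in> angles" by (simp_all add: torus_angles)
  have "\<theta> (z \<otimes>\<^bsub>torus_group d\<^esub> w) = \<theta> (\<lambda>k. z k * w k)"
    by (rule \<theta>_cong) (simp add: mult_torus_group)
  then show "\<theta> (z \<otimes>\<^bsub>torus_group d\<^esub> w) = \<theta> z \<otimes>\<^bsub>BijGroup (Pol len)\<^esub> \<theta> w"
    using n by (simp add: BijGroup_def \<theta>_Bij \<theta>_mult)
qed (simp add: BijGroup_def \<theta>_Bij torus_angles)

text \<open>Continuity is checked on polygons. Since the torus is compact and Hausdorff, the product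
  of its identity with the quotient map \<open>pol_class len\<close> is again a quotient
  map.\<close>

lemma \<theta>_continuous:
  "continuous_map (prod_topology (torus_topology d) (pol_topology len)) (pol_topology len) (\<lambda>(z, p). \<theta> z p)"
proof -
  let ?X = "prod_topology (torus_topology d) (top_of_set (PolT len))"
  have up: "continuous_map ?X euclidean (\<lambda>x. bends I (fst x) m (snd x))" if "m \<le> d" for m
    using that
  proof (induction m)
    case 0
    have "continuous_map ?X (top_of_set (PolT len)) snd" by (rule continuous_map_snd)
    then show ?case by (simp add: continuous_map_in_subtopology o_def)
  next
    case (Suc m)
    then have m: "m < d" by simp
    have "continuous_map (torus_topology d) (top_of_set (sphere 0 1)) (\<lambda>z. z m)"
      unfolding torus_topology_def using m by (intro continuous_map_product_projection) simp
    from continuous_map_compose[OF continuous_map_fst this, of "top_of_set (PolT len)"]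
    have zm: "continuous_map ?X euclidean (\<lambda>x. fst x m)"
      by (simp add: continuous_map_in_subtopology o_def)
    have pair: "continuous_map ?X euclidean (\<lambda>x. (fst x m, bends I (fst x) m (snd x)))"
      by (rule continuous_map_Pair_euclidean[OF zm Suc.IH]) (use m in simp)
    have "continuous_map ?X (top_of_set (UNIV \<times> {\<rho>. bsum (I m) \<rho> \<noteq> 0})) (\<lambda>x. (fst x m, bends I (fst x) m (snd x)))"
      unfolding continuous_map_in_subtopology
    proof (intro conjI pair)
      show "(\<lambda>x. (fst x m, bends I (fst x) m (snd x))) \<in> topspace ?X \<rightarrow> UNIV \<times> {\<rho>. bsum (I m) \<rho> \<noteq> 0}"
        using bsum_nonzero[OF m] bends_PolT[OF torus_angles] m by (auto simp: topspace_torus_topology)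
    qed
    moreover have "continuous_map (top_of_set (UNIV \<times> {\<rho>. bsum (I m) \<rho> \<noteq> 0})) euclidean (\<lambda>x. bend (I m) (fst x) (snd x))"
      using continuous_on_bend by simp
    ultimately show ?case
      using continuous_map_compose[of ?X _ "\<lambda>x. (fst x m, bends I (fst x) m (snd x))" euclidean "\<lambda>x. bend (I m) (fst x) (snd x)"]
      by (simp add: o_def)
  qed
  have "continuous_map ?X (top_of_set (PolT len)) (\<lambda>x. bends I (fst x) d (snd x))"
    unfolding continuous_map_in_subtopology
    using up[OF order_refl] bends_PolT[OF torus_angles order_refl] by (auto simp: topspace_torus_topology)
  from continuous_map_compose[OF this continuous_map_pol_class]
  have "continuous_map ?X (pol_topology len) (\<lambda>x. pol_class len (bends I (fst x) d (snd x)))"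
    by (simp add: o_def)
  then have "continuous_map ?X (pol_topology len) ((\<lambda>(z, p). \<theta> z p) \<circ> (\<lambda>(z, \<rho>). (z, pol_class len \<rho>)))"
    by (rule continuous_map_eq) (auto simp: topspace_torus_topology \<theta>_class torus_angles)
  moreover have "quotient_map ?X (prod_topology (torus_topology d) (pol_topology len)) (\<lambda>(z, \<rho>). (z, pol_class len \<rho>))"
    using quotient_map_prod_right[OF compact_imp_locally_compact_space[OF compact_torus_topology] disjI1[OF Hausdorff_torus_topology] quotient_map_pol_class] .
  ultimately show ?thesis using continuous_compose_quotient_map_eq by blast
qed

lemma smooth_f_len:
  assumes J: "\<And>\<rho>. \<rho> \<in> PolT len \<Longrightarrow> bsum J \<rho> \<noteq> 0"
  shows "smooth_function len (f_len J)"
  unfolding smooth_function_def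
proof
  fix \<rho> assume \<rho>: "\<rho> \<in> PolT len"
  let ?U = "{\<rho> :: real ^ 3 ^ 'e. bsum J \<rho> \<noteq> 0}"
  have U: "open ?U" by (rule open_bsum_nonzero)
  have "C_times k ?U (\<lambda>\<rho>. norm (bsum J \<rho>))" for k
    by (intro C_times_norm[OF U] C_times_bounded_linear[OF U bounded_linear_bsum C_times_ident[OF U]]) simp
  then have "smooth_on_open ?U (\<lambda>\<rho>. norm (bsum J \<rho>))" using U by (simp add: smooth_on_open_def)
  then show "\<exists>U F. \<rho> \<in> U \<and> smooth_on_open U F \<and> (\<forall>\<sigma>\<in>U \<inter> PolT len. F \<sigma> = f_len J (pol_class len \<sigma>))"
    using J[OF \<rho>] by (intro exI[of _ ?U] exI[of _ "\<lambda>\<rho>. norm (bsum J \<rho>)"]) (simp add: f_len_class)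
qed

lemma bends_single:
  assumes "k < d" shows "bends I (\<lambda>j. if j = k then w else 1) d \<rho> = bend (I k) w \<rho>"
proof -
  have "bends I (\<lambda>j. if j = k then w else 1) d \<rho> = bends I (\<lambda>j. if j = k then w else 1) (Suc k) \<rho>"
    using assms by (intro bends_trunc) auto
  also have "\<dots> = bend (I k) w \<rho>" by (simp add: bends_ones)
  finally show ?thesis .
qed

text \<open>A single flow arises from angles that are 1 except at one index; conversely the bendings
  in \<open>bends\<close> are peeled off one at a time.\<close>

lemma \<theta>_generate:
  "\<theta> ` carrier (torus_group d) = generate (BijGroup (Pol len)) {bending_flow len J t | J t. J \<in> I ` {..<d}}"
  (is "?T = generate ?G ?K")
proof
  interpret G: group ?G by (rule group_BijGroup)
  interpret H: group_hom "torus_group d" ?G \<theta>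
    using group_torus_group group_BijGroup \<theta>_hom by (simp add: group_hom_def group_hom_axioms_def)
  have flow: "bending_flow len (I k) t = class_map len (bend (I k) (cis t))" if "k < d" for k t
    using that by (intro bending_flow_eq bsum_nonzero)
  have "?K \<subseteq> ?T"
  proof
    fix g assume "g \<in> ?K"
    then obtain k t where k: "k < d" "g = bending_flow len (I k) t" by auto
    let ?z = "\<lambda>j. if j = k then cis t else 1"
    have "g = class_map len (bend (I k) (cis t))" using k flow by simp
    also have "\<dots> = \<theta> ?z"
      unfolding \<theta>_def by (intro arg_cong[of _ _ "class_map len"] ext bends_single[OF k(1), symmetric])
    also have "\<dots> = \<theta> (\<lambda>j\<in>{..<d}. ?z j)" by (rule \<theta>_cong) simp
    finally have "g = \<theta> (\<lambda>j\<in>{..<d}. ?z j)" .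
    moreover have "(\<lambda>j\<in>{..<d}. ?z j) \<in> carrier (torus_group d)" by (simp add: carrier_torus_group)
    ultimately show "g \<in> ?T" by (rule image_eqI)
  qed
  then show "generate ?G ?K \<subseteq> ?T"
    by (rule G.generate_subgroup_incl[OF _ H.img_is_subgroup])
  show "?T \<subseteq> generate ?G ?K"
  proof
    fix g assume "g \<in> ?T"
    then obtain z where z: "z \<in> angles" "g = \<theta> z" using torus_angles by blast
    have "class_map len (bends I z m) \<in> generate ?G ?K" if "m \<le> d" for m
      using that
    proof (induction m)
      case 0
      have eq: "class_map len (bends I z 0) = (\<lambda>p\<in>Pol len. p)"
      proof (rule extensionalityI[of _ "Pol len"])
        fix p assume "p \<in> Pol len"
        then obtain \<rho> where "\<rho> \<in> PolT len" "p = pol_class len \<rho>" by (rule Pol_cases)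
        then show "class_map len (bends I z 0) p = (\<lambda>p\<in>Pol len. p) p"
          using class_map[OF equivariant_bends[OF z(1), of 0]] by simp
      qed simp_all
      have one: "(\<lambda>p\<in>Pol len. p) = \<one>\<^bsub>?G\<^esub>" by (simp add: BijGroup_def)
      show ?case unfolding eq one by (rule generate.one)
    next
      case (Suc m)
      then have m: "m < d" by simp
      have nm: "norm (z m) = 1" by (rule anglesD[OF z(1) m])
      have e1: "equivariant len (bend (I m) (z m))" by (intro equivariant_bend bsum_nonzero m nm)
      have e2: "equivariant len (bends I z m)" using m by (intro equivariant_bends z) simp
      obtain t where t: "z m = cis t"
      proof
        have "z m \<noteq> 0" using nm by auto
        then show "z m = cis (Arg (z m))" using nm by (simp add: cis_Arg sgn_div_norm)
      qed
      have b: "class_map len (bend (I m) (z m)) \<in> ?K" 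
        by (intro CollectI exI[of _ "I m"] exI[of _ t] conjI) (simp_all add: flow[OF m] t m)
      have "class_map len (bends I z (Suc m)) = compose (Pol len) (class_map len (bend (I m) (z m))) (class_map len (bends I z m))"
      proof -
        have "bends I z (Suc m) = (\<lambda>\<rho>. bend (I m) (z m) (bends I z m \<rho>))" by (rule ext) simp
        then show ?thesis by (simp only: class_map_comp[OF e1 e2])
      qed
      moreover have B1: "class_map len (bend (I m) (z m)) \<in> Bij (Pol len)"
      proof -
        have "bends I (\<lambda>j. if j = m then z m else 1) d = bend (I m) (z m)" by (rule ext) (rule bends_single[OF m])
        then show ?thesis
          using \<theta>_Bij[of "\<lambda>j. if j = m then z m else 1"] nm by (simp add: angles_def \<theta>_def)
      qed
      moreover have B2: "class_map len (bends I z m) \<in> Bij (Pol len)"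
      proof -
        have "bends I (\<lambda>j. if j < m then z j else 1) d \<rho> = bends I z m \<rho>" for \<rho>
          using bends_trunc[of m d "\<lambda>j. if j < m then z j else 1" \<rho>] bends_cong[of m "\<lambda>j. if j < m then z j else 1" z I \<rho>] m by simp
        then have "bends I (\<lambda>j. if j < m then z j else 1) d = bends I z m" by (rule ext)
        then show ?thesis
          using \<theta>_Bij[of "\<lambda>j. if j < m then z j else 1"] anglesD[OF z(1)] by (simp add: angles_def \<theta>_def)
      qed
      ultimately have eq: "class_map len (bends I z (Suc m)) = class_map len (bend (I m) (z m)) \<otimes>\<^bsub>?G\<^esub> class_map len (bends I z m)"
        by (simp add: BijGroup_def)
      show ?case
        unfolding eq by (rule generate.eng[OF generate.incl[OF b] Suc.IH]) (use m in simp)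
    qed
    then show "g \<in> generate ?G ?K" by (simp add: z(2) \<theta>_def)
  qed
qed

lemma bending_torus_\<theta>:
  assumes inj: "inj_on \<theta> (carrier (torus_group d))" and lop: "\<And>k. k < d \<Longrightarrow> lopsided len (I k)"
  shows "bending_torus len (\<theta> ` carrier (torus_group d)) d"
proof -
  let ?T = "\<theta> ` carrier (torus_group d)"
  interpret H: group_hom "torus_group d" "BijGroup (Pol len)" \<theta>
    using group_torus_group group_BijGroup \<theta>_hom by (simp add: group_hom_def group_hom_axioms_def)
  have iso: "\<theta> \<in> iso (torus_group d) ((BijGroup (Pol len))\<lparr>carrier := ?T\<rparr>)"
    using \<theta>_hom inj by (auto simp: iso_def hom_def bij_betw_def)
  have flow: "is_hamiltonian_flow len (\<lambda>p. \<Sum>k<d. x k * f_len (I k) p) (\<lambda>t. \<theta> (\<lambda>k\<in>{..<d}. cis (t * x k)))" for x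
  proof -
    have "(\<lambda>t. \<theta> (\<lambda>k\<in>{..<d}. cis (t * x k))) = (\<lambda>t. \<theta> (\<lambda>k. cis (t * x k)))"
      by (rule ext, rule \<theta>_cong) simp
    then show ?thesis using \<theta>_flow by simp
  qed
  have "hamiltonian_torus len ?T d"
    unfolding hamiltonian_torus_def
  proof (intro conjI)
    show "subgroup ?T (BijGroup (Pol len))" by (rule H.img_is_subgroup)
    show "?T \<subseteq> Symp len" using \<theta>_Symp torus_angles by blast
    show "\<exists>\<theta> \<mu>. \<theta> \<in> iso (torus_group d) ((BijGroup (Pol len))\<lparr>carrier := ?T\<rparr>) \<and>
        continuous_map (prod_topology (torus_topology d) (pol_topology len)) (pol_topology len)
          (\<lambda>(z, p). \<theta> z p) \<and>
        (\<forall>k<d. smooth_function len (\<mu> k)) \<and>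
        (\<forall>x::nat \<Rightarrow> real. is_hamiltonian_flow len (\<lambda>p. \<Sum>k<d. x k * \<mu> k p)
           (\<lambda>t. \<theta> (\<lambda>k\<in>{..<d}. cis (t * x k))))"
    proof (rule exI[of _ \<theta>], rule exI[of _ "\<lambda>k. f_len (I k)"], intro conjI allI impI)
      show "smooth_function len (f_len (I k))" if "k < d" for k
        using that by (intro smooth_f_len bsum_nonzero)
    qed (rule iso \<theta>_continuous flow)+
  qed
  then show ?thesis
    unfolding bending_torus_def using lop \<theta>_generate
    by (intro conjI exI[of _ "I ` {..<d}"]) auto
qed

end

section \<open>Lopsided partitions and the tori that they give\<close>

context polygon_space
begin

text \<open>A closed polygon with at most two edges lies on a line.\<close>

lemma card_ge_3: "CARD('e) \<ge> 3"
proof (rule ccontr)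
  assume "\<not> CARD('e) \<ge> 3"
  obtain \<rho> where \<rho>: "\<rho> \<in> PolT len" using nonempty by blast
  obtain e f where ef: "\<rho> $ e \<times>\<^sub>3 (\<rho> $ f) \<noteq> 0" using not_collinear[OF \<rho>] .
  then have "e \<noteq> f" by auto
  then have "card {e, f} = 2" by simp
  with \<open>\<not> CARD('e) \<ge> 3\<close> have "card (UNIV :: 'e set) \<le> card {e, f}" by simp
  then have "{e, f} = UNIV" by (intro card_seteq) auto
  then have "\<rho> $ e + \<rho> $ f = 0" using bsum_UNIV[OF \<rho>] \<open>e \<noteq> f\<close> by (simp add: bsum_def flip: \<open>{e, f} = UNIV\<close>)
  then have "\<rho> $ f = - (\<rho> $ e)" by (simp add: eq_neg_iff_add_eq_0 add.commute)
  with ef show False by simp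
qed

lemma not_lopsided_UNIV: "\<not> lopsided len UNIV"
  using lopsided_bsum_nonzero[of len UNIV] bsum_UNIV nonempty by blast

lemma lopsided_partition_exists:
  "\<exists>P. partition_on (UNIV :: 'e set) P \<and> (\<forall>B\<in>P. lopsided len B) \<and> card P = N_lopsided len"
proof -
  let ?S = "(\<lambda>e. {e}) ` (UNIV :: 'e set)"
  have "partition_on UNIV ?S" by (auto simp: partition_on_def disjoint_def)
  moreover have "\<forall>B\<in>?S. lopsided len B" using len_pos by (auto simp: lopsided_singleton)
  ultimately have "\<exists>P. partition_on (UNIV::'e set) P \<and> (\<forall>I\<in>P. lopsided len I) \<and> card P = card ?S" by blast
  then show ?thesis unfolding N_lopsided_def by (rule LeastI)
qed

lemma N_lopsided_le: "partition_on UNIV P \<Longrightarrow> (\<And>B. B \<in> P \<Longrightarrow> lopsided len B) \<Longrightarrow> N_lopsided len \<le> card P"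
  unfolding N_lopsided_def by (rule Least_le) blast

text \<open>\<open>UNIV\<close> is not lopsided, so fewer than three blocks means two. As there are
  at least three edges, one block has an element besides its dominating one, and this element is
  split off as a singleton.\<close>

lemma lopsided_partition_max:
  "\<exists>P. partition_on (UNIV :: 'e set) P \<and> (\<forall>B\<in>P. lopsided len B) \<and> card P = max 3 (N_lopsided len)"
proof -
  obtain P where P: "partition_on (UNIV :: 'e set) P" "\<forall>B\<in>P. lopsided len B" "card P = N_lopsided len"
    using lopsided_partition_exists by blast
  show ?thesis
  proof (cases "N_lopsided len \<ge> 3")
    case True
    then show ?thesis using P by (intro exI[of _ P]) auto
  next
    case False
    have fin: "finite P" by simp
    have "P \<noteq> {}" using P(1) by (auto simp: partition_on_def)
    moreover have "card P \<noteq> 1"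
    proof
      assume "card P = 1"
      then obtain B where "P = {B}" by (auto simp: card_1_singleton_iff)
      then have "B = UNIV" using P(1) by (auto simp: partition_on_def)
      with P(2) \<open>P = {B}\<close> not_lopsided_UNIV show False by simp
    qed
    ultimately have "card P = 2" using False P(3) fin by (cases "card P") auto
    then obtain A B where AB: "P = {A, B}" "A \<noteq> B" by (auto simp: card_2_iff)
    have split: ?thesis if AB: "P = {A, B}" "A \<noteq> B" "card A \<ge> 2" for A B
    proof -
      have u: "A \<union> B = UNIV" "A \<inter> B = {}" "A \<noteq> {}" "B \<noteq> {}"
        using P(1) AB by (auto simp: partition_on_def disjoint_def)
      have lop: "lopsided len A" "lopsided len B" using P(2) AB by auto
      obtain e0 where e0: "e0 \<in> A" "\<And>J. J \<subseteq> A \<Longrightarrow> e0 \<in> J \<Longrightarrow> lopsided len J"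
        using lopsided_subset[OF len_pos lop(1)] by blast
      have "\<not> A \<subseteq> {e0}"
      proof
        assume "A \<subseteq> {e0}"
        then have "card A \<le> 1" using card_mono[of "{e0}" A] by simp
        with AB(3) show False by simp
      qed
      then obtain x where x: "x \<in> A" "x \<noteq> e0" by blast
      let ?P = "{A - {x}, {x}, B}"
      have "partition_on UNIV ?P"
        unfolding partition_on_def disjoint_def using u e0(1) x by auto
      moreover have "lopsided len (A - {x})" using e0 x by (intro e0(2)) auto
      moreover have "card ?P = 3" using u e0(1) x by (simp add: card_insert_if) blast
      ultimately show ?thesis
        using False lop(2) lopsided_singleton[OF len_pos] by (intro exI[of _ ?P]) auto
    qed
    have "card (UNIV :: 'e set) \<le> card A + card B"
      using P(1) AB card_Un_le[of A B] by (simp add: partition_on_def)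
    then have "card A \<ge> 2 \<or> card B \<ge> 2" using card_ge_3 by linarith
    then show ?thesis
    proof
      assume "card A \<ge> 2" then show ?thesis by (rule split[OF AB])
    next
      assume "card B \<ge> 2"
      moreover have "P = {B, A}" "B \<noteq> A" using AB by blast+
      ultimately show ?thesis by (intro split[of B A])
    qed
  qed
qed

lemma bending_torus_of_partition:
  assumes part: "partition_on (UNIV :: 'e set) P" and lop: "\<And>B. B \<in> P \<Longrightarrow> lopsided len B" and P3: "card P \<ge> 3"
  shows "\<exists>T. bending_torus len T (CARD('e) - card P)"
proof -
  have ex1: "\<exists>!B. B \<in> P \<and> e \<in> B" for e
  proof -
    obtain B where B: "B \<in> P" "e \<in> B" using partition_onD1[OF part] by (metis UNIV_I UnionE)
    show ?thesis
    proof (rule ex1I[of _ B])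
      show "B' = B" if "B' \<in> P \<and> e \<in> B'" for B'
        using that B disjointD[OF partition_onD2[OF part], of B' B] by blast
    qed (use B in simp)
  qed
  define blk where "blk e = (THE B. B \<in> P \<and> e \<in> B)" for e
  have blk: "blk e \<in> P" "e \<in> blk e" for e
    using theI'[OF ex1[of e]] by (simp_all add: blk_def)
  have blk_eq: "blk e = B" if "B \<in> P" "e \<in> B" for e B
    unfolding blk_def by (rule the1_equality[OF ex1]) (use that in simp)
  define dm where "dm B = (SOME e. e \<in> B \<and> (\<forall>J. J \<subseteq> B \<longrightarrow> e \<in> J \<longrightarrow> lopsided len J))" for B
  have dm: "dm B \<in> B" "J \<subseteq> B \<Longrightarrow> dm B \<in> J \<Longrightarrow> lopsided len J" if "B \<in> P" for B J
  proof -
    have "\<exists>e. e \<in> B \<and> (\<forall>J. J \<subseteq> B \<longrightarrow> e \<in> J \<longrightarrow> lopsided len J)"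
      using lopsided_subset[OF len_pos lop[OF that]] by (simp only: Bex_def)
    from someI_ex[OF this, folded dm_def]
    show "dm B \<in> B" "J \<subseteq> B \<Longrightarrow> dm B \<in> J \<Longrightarrow> lopsided len J" by simp_all
  qed
  \<comment> \<open>Each element that does not dominate its block will contribute one bending, which
    accounts for the dimension.\<close>
  define R where "R = UNIV - dm ` P"
  have "inj_on dm P" by (rule inj_onI) (metis blk_eq dm(1))
  then have cR: "card R = CARD('e) - card P"
    by (simp add: R_def card_Diff_subset card_image)
  define d where "d = CARD('e) - card P"
  obtain a where a: "bij_betw a {0..<d} R"
    using ex_bij_betw_nat_finite[of R] by (auto simp: cR d_def)
  have aR: "a k \<in> R" if "k < d" for k using a that by (auto simp: bij_betw_def)
  have ainj: "a i = a j \<Longrightarrow> i = j" if "i < d" "j < d" for i j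
    using a that by (auto simp: bij_betw_def inj_on_def)
  \<comment> \<open>Within a block the sets grow from the dominating element by one new element
    \<open>a k\<close> at a time. Keeping the dominating element makes them lopsided, and the new
    element avoids all earlier sets.\<close>
  define I where "I k = insert (dm (blk (a k))) {a j | j. j \<le> k \<and> blk (a j) = blk (a k)}" for k
  have Iblk: "I k \<subseteq> blk (a k)" for k
    using dm(1)[OF blk(1)] blk(2) by (auto simp: I_def)
  have Idm: "dm (blk (a k)) \<in> I k" for k by (simp add: I_def)
  have aI: "a k \<in> I k" for k by (auto simp: I_def)
  have Ilop: "lopsided len (I k)" for k by (rule dm(2)[OF blk(1) Iblk Idm])
  have disj: "B \<inter> B' = {}" if "B \<in> P" "B' \<in> P" "B \<noteq> B'" for B B' using that blk_eq by blast
  have lam: "I j \<subseteq> I k \<or> I j \<inter> I k = {}" if "j < k" for j k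
  proof (cases "blk (a j) = blk (a k)")
    case True
    then have "I j \<subseteq> I k" using that by (auto simp: I_def)
    then show ?thesis ..
  next
    case False
    then show ?thesis using disj[OF blk(1)[of "a j"] blk(1)[of "a k"]] Iblk[of j] Iblk[of k] by blast
  qed
  have anotin: "a k \<notin> I j" if "j < k" "k < d" for j k
  proof
    assume "a k \<in> I j"
    then consider "a k = dm (blk (a j))" | i where "i \<le> j" "a k = a i" by (auto simp: I_def)
    then show False
    proof cases
      case 1
      then show False using aR[OF that(2)] blk(1) by (simp add: R_def)
    next
      case 2
      then show False using ainj[of k i] that by auto
    qed
  qed
  interpret bending_chain len I d
    by unfold_locales (use lopsided_bsum_nonzero[OF Ilop] lam in auto)
  let ?Q = "{(X, Y). X \<inter> Y = {} \<and> X \<union> Y \<noteq> UNIV \<and> lopsided len X \<and> lopsided len Y}"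
  have "\<exists>\<rho>\<in>PolT len. \<forall>(X, Y)\<in>?Q. bsum X \<rho> \<times>\<^sub>3 bsum Y \<rho> \<noteq> 0"
    by (rule exists_generic) (auto simp: lopsided_bsum_nonzero)
  then obtain \<rho> where \<rho>: "\<rho> \<in> PolT len"
    and gen: "\<And>X Y. X \<inter> Y = {} \<Longrightarrow> X \<union> Y \<noteq> UNIV \<Longrightarrow> lopsided len X \<Longrightarrow> lopsided len Y \<Longrightarrow> bsum X \<rho> \<times>\<^sub>3 bsum Y \<rho> \<noteq> 0"
    by (auto split: prod.splits)
  \<comment> \<open>Three blocks are wanted: two give sums that are not parallel in
    \<open>\<rho>\<close>, and the third ensures that these two do not cover everything.\<close>
  obtain P' where P': "P' \<subseteq> P" "card P' = 3" using obtain_subset_with_card_n[OF P3] by blast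
  then obtain B B' B'' where BB: "P' = {B, B', B''}" "B \<noteq> B'" "B \<noteq> B''" "B' \<noteq> B''"
    by (auto simp: card_3_iff)
  have BP: "B \<in> P" "B' \<in> P" "B'' \<in> P" using P'(1) BB(1) by auto
  have nonempty_B: "B \<noteq> {}" "B' \<noteq> {}" "B'' \<noteq> {}" using BP part by (auto simp: partition_on_def)
  have two_blocks: "C \<union> C' \<noteq> UNIV" if "C \<in> P" "C' \<in> P" for C C'
  proof
    assume "C \<union> C' = UNIV"
    then have "D = C \<or> D = C'" if "D \<in> P" "D \<noteq> {}" for D
      using disj[OF that(1) \<open>C \<in> P\<close>] disj[OF that(1) \<open>C' \<in> P\<close>] that(2) by blast
    then show False using BP nonempty_B BB by metis
  qed
  \<comment> \<open>The set without \<open>a k\<close> still contains its dominating element, so it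
    and \<open>{a k}\<close> form one of the pairs for which \<open>\<rho>\<close> is
    generic.\<close>
  have ax: "bsum (I k) \<rho> \<times>\<^sub>3 (\<rho> $ a k) \<noteq> 0" if "k < d" for k
  proof -
    have neq: "dm (blk (a k)) \<noteq> a k" using aR[OF that] blk(1) by (metis DiffD2 R_def image_eqI)
    have "lopsided len (I k - {a k})" using dm(2)[OF blk(1), of "I k - {a k}" "a k"] Iblk Idm neq by blast
    moreover have "(I k - {a k}) \<union> {a k} \<noteq> UNIV"
      using Iblk[of k] two_blocks[OF blk(1)[of "a k"] blk(1)[of "a k"]] blk(2)[of "a k"] by blast
    ultimately have "bsum (I k - {a k}) \<rho> \<times>\<^sub>3 bsum {a k} \<rho> \<noteq> 0"
      by (intro gen lopsided_singleton len_pos) auto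
    moreover have "bsum (I k) \<rho> = bsum (I k - {a k}) \<rho> + bsum {a k} \<rho>"
      using bsum_Un[of "I k - {a k}" "{a k}" \<rho>] aI[of k] by (simp add: insert_absorb)
    ultimately show ?thesis by (simp add: cross_add_left bsum_def)
  qed
  have block: "I k \<subseteq> C \<or> I k \<inter> C = {}" if "C \<in> P" for k C
    using disj[OF blk(1)[of "a k"] that] Iblk[of k] by blast
  have nz: "bsum B \<rho> \<times>\<^sub>3 bsum B' \<rho> \<noteq> 0"
    using disj[OF BP(1,2)] BB two_blocks[OF BP(1,2)] lop BP by (intro gen) auto
  have "inj_on \<theta> (carrier (torus_group d))"
  proof (rule \<theta>_inj)
    fix v assume v: "v \<in> angles" "\<theta> v = (\<lambda>p\<in>Pol len. p)"
    have triv: "\<theta> v (pol_class len \<rho>) = pol_class len \<rho>"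
      by (subst v(2)) (rule restrict_apply'[OF pol_class_mem[OF \<rho>]])
    show "\<forall>k<d. v k = 1"
      by (rule \<theta>_trivial_imp_ones[OF \<rho> aI anotin ax block[OF BP(1)] block[OF BP(2)] nz v(1) triv])
  qed
  then have "bending_torus len (\<theta> ` carrier (torus_group d)) d"
    by (rule bending_torus_\<theta>) (rule Ilop)
  then show ?thesis unfolding d_def by blast
qed

lemma exists_bending_torus: "\<exists>T. bending_torus len T (CARD('e) - max 3 (N_lopsided len))"
proof -
  obtain P where P: "partition_on (UNIV :: 'e set) P" "\<forall>B\<in>P. lopsided len B" "card P = max 3 (N_lopsided len)"
    using lopsided_partition_max by blast
  have "\<exists>T. bending_torus len T (CARD('e) - card P)"
    using P by (intro bending_torus_of_partition) auto
  then show ?thesis by (simp only: P(3))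
qed

end

section \<open>Bending flows that do not commute\<close>

lemma cross3_zero_orth:
  assumes "x \<times>\<^sub>3 y = 0" "y \<noteq> 0" "y \<bullet> n = 0" shows "x \<bullet> n = 0"
proof -
  have "(y \<bullet> y) *\<^sub>R x = (y \<bullet> x) *\<^sub>R y"
    using Lagrange[of y y x] assms(1) cross_skew[of x y] by simp
  then have "((y \<bullet> y) *\<^sub>R x) \<bullet> n = 0" using assms(3) by simp
  then show ?thesis using assms(2) by simp
qed

text \<open>On the connected sphere of radius \<open>l\<close> the distance to \<open>w\<close>
  takes both extreme values, at plus and minus \<open>l\<close> times the direction of
  \<open>w\<close>, and so every value between.\<close>

lemma triangle_exists:
  fixes w :: "real ^ 3"
  assumes "0 \<le> l" "\<bar>norm w - l\<bar> \<le> r" "r \<le> norm w + l"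
  shows "\<exists>y. norm y = l \<and> norm (w - y) = r"
proof -
  obtain u where u: "norm u = 1" "w = norm w *\<^sub>R u"
  proof (cases "w = 0")
    case True
    then show ?thesis using that[of "axis 1 1"] by (simp add: norm_axis_1)
  next
    case False
    then show ?thesis using that[of "sgn w"] by (simp add: norm_sgn sgn_div_norm)
  qed
  have e: "norm (w - c *\<^sub>R u) = \<bar>norm w - c\<bar>" for c
  proof -
    have "w - c *\<^sub>R u = (norm w - c) *\<^sub>R u" by (subst u(2)) (simp add: scaleR_left_diff_distrib)
    then show ?thesis using u(1) by simp
  qed
  have "connected ((\<lambda>y. norm (w - y)) ` sphere 0 l)"
    by (intro connected_continuous_image continuous_intros connected_sphere) simp
  moreover have "\<bar>norm w - l\<bar> \<in> (\<lambda>y. norm (w - y)) ` sphere 0 l"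
    by (rule image_eqI[of _ _ "l *\<^sub>R u"]) (use u(1) assms(1) e in auto)
  moreover have "norm w + l \<in> (\<lambda>y. norm (w - y)) ` sphere 0 l"
    by (rule image_eqI[of _ _ "(- l) *\<^sub>R u"]) (use u(1) assms(1) e[of "- l"] in auto)
  ultimately have "r \<in> (\<lambda>y. norm (w - y)) ` sphere 0 l"
    by (rule connectedD_interval[OF _ _ _ assms(2,3)])
  then show ?thesis by auto
qed

text \<open>The hypotheses are the polygon inequalities for the sides \<open>C\<close> closed up by
  \<open>w\<close>. The induction cuts off the triangle with sides \<open>w\<close> and
  \<open>y\<close>, leaving a polygon closed up by \<open>w - y\<close>.\<close>

lemma vectors_with_sum_exist:
  fixes w :: "real ^ 3"
  assumes "finite C" "\<And>e. e \<in> C \<Longrightarrow> 0 \<le> l e" "norm w \<le> (\<Sum>e\<in>C. l e)" "\<And>x. x \<in> C \<Longrightarrow> 2 * l x \<le> (\<Sum>e\<in>C. l e) + norm w"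
  shows "\<exists>r. (\<forall>e\<in>C. norm (r e) = l e) \<and> (\<Sum>e\<in>C. r e) = w"
  using assms
proof (induction C arbitrary: w rule: finite_induct)
  case empty
  then show ?case by simp
next
  case (insert e C)
  define u where "u = (\<Sum>x\<in>C. l x)"
  have s: "(\<Sum>x\<in>insert e C. l x) = l e + u" using insert.hyps by (simp add: u_def)
  have u0: "0 \<le> u" using insert.prems(1) by (auto simp: u_def intro: sum_nonneg)
  have le: "0 \<le> l e" using insert.prems(1) by simp
  \<comment> \<open>\<open>M\<close> collects the lower bounds for the length of the new diagonal,
    from the triangle and from the remaining polygon. Each is at most both upper bounds
    \<open>norm w + l e\<close> and \<open>u\<close>, so their maximum is admissible.\<close>
  define M where "M = insert \<bar>norm w - l e\<bar> ((\<lambda>x. 2 * l x - u) ` C)"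
  define r' where "r' = Max M"
  have fM: "finite M" "M \<noteq> {}" using insert.hyps(1) by (simp_all add: M_def)
  have r1: "\<bar>norm w - l e\<bar> \<le> r'" unfolding r'_def using fM by (intro Max_ge) (simp_all add: M_def)
  have r2: "2 * l x - u \<le> r'" if "x \<in> C" for x unfolding r'_def using fM that by (intro Max_ge) (simp_all add: M_def)
  have "m \<le> norm w + l e \<and> m \<le> u" if "m \<in> M" for m
  proof -
    have lu: "l x \<le> u" if "x \<in> C" for x
      unfolding u_def using insert.hyps(1) insert.prems(1) that by (intro member_le_sum) auto
    have lw: "2 * l x \<le> l e + u + norm w" if "x \<in> C" for x
      using insert.prems(3)[of x] that unfolding s by simp
    have "2 * l e \<le> l e + u + norm w" using insert.prems(3)[of e] unfolding s by simp
    have "norm w \<le> l e + u" using insert.prems(2) unfolding s .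
    from that consider "m = \<bar>norm w - l e\<bar>" | x where "x \<in> C" "m = 2 * l x - u"
      unfolding M_def by auto
    then show ?thesis
    proof cases
      case 1
      then show ?thesis
        using le norm_ge_zero[of w] \<open>2 * l e \<le> l e + u + norm w\<close> \<open>norm w \<le> l e + u\<close> by linarith
    next
      case 2
      then show ?thesis
        using lu[OF 2(1)] lw[OF 2(1)] by linarith
    qed
  qed
  then have r3: "r' \<le> norm w + l e" "r' \<le> u"
    using Max_in[OF fM] by (simp_all add: r'_def)
  obtain y where y: "norm y = l e" "norm (w - y) = r'"
    using triangle_exists[OF le r1 r3(1)] by blast
  have "\<exists>r. (\<forall>x\<in>C. norm (r x) = l x) \<and> (\<Sum>x\<in>C. r x) = w - y"
  proof (rule insert.IH)
    show "norm (w - y) \<le> (\<Sum>x\<in>C. l x)" using r3(2) y(2) by (simp add: u_def)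
    show "2 * l x \<le> (\<Sum>x\<in>C. l x) + norm (w - y)" if "x \<in> C" for x
      using r2[OF that] y(2) by (simp add: u_def)
  qed (use insert.prems(1) in simp)
  then obtain r where r: "\<forall>x\<in>C. norm (r x) = l x" "(\<Sum>x\<in>C. r x) = w - y" by (elim exE conjE)
  have "(\<Sum>x\<in>C. (r(e := y)) x) = (\<Sum>x\<in>C. r x)" using insert.hyps(2) by (intro sum.cong) auto
  then show ?case
    using r y(1) insert.hyps by (intro exI[of _ "r(e := y)"]) auto
qed

section \<open>Polygons with a straight block, and crossing blocks that fail to commute\<close>

context polygon_space
begin

lemma polygon_inequality: "2 * len x \<le> (\<Sum>e\<in>UNIV. len e)"
proof -
  obtain \<rho> where \<rho>: "\<rho> \<in> PolT len" using nonempty by blast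
  have "\<rho> $ x + (\<Sum>e\<in>UNIV - {x}. \<rho> $ e) = 0"
    using bsum_UNIV[OF \<rho>] sum.remove[of UNIV x "\<lambda>e. \<rho> $ e"] by (simp add: bsum_def)
  then have "\<rho> $ x = - (\<Sum>e\<in>UNIV - {x}. \<rho> $ e)" by (rule eq_neg_iff_add_eq_0[THEN iffD2])
  then have "len x = norm (\<Sum>e\<in>UNIV - {x}. \<rho> $ e)" using PolT_norm[OF \<rho>, of x] by (metis norm_minus_cancel)
  also have "\<dots> \<le> (\<Sum>e\<in>UNIV - {x}. len e)"
    using norm_sum[of "\<lambda>e. \<rho> $ e" "UNIV - {x}"] by (simp add: PolT_norm[OF \<rho>])
  finally show ?thesis by (simp add: sum.remove[of UNIV x len])
qed

text \<open>As \<open>I\<close> is shorter than its complement, the other edges can close up a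
  straight \<open>I\<close>. If the sum over \<open>C\<close> is parallel to \<open>v\<close>,
  moving an edge of \<open>C\<close> against one of \<open>D\<close> corrects this and leaves
  \<open>I\<close> straight; parallel edges throughout would put the polygon on a line.\<close>

lemma exists_aligned:
  assumes I: "(\<Sum>e\<in>I. len e) < (\<Sum>e\<in>- I. len e)" and v: "norm v = 1"
    and C: "C \<noteq> {}" "D \<noteq> {}" "C \<inter> D = {}" "C \<union> D = - I" and "I \<noteq> {}"
  shows "\<exists>\<rho>\<in>PolT len. (\<forall>e\<in>I. \<rho> $ e = len e *\<^sub>R v) \<and> bsum C \<rho> \<times>\<^sub>3 v \<noteq> 0"
proof -
  define u where "u = (\<Sum>e\<in>I. len e)"
  have u: "u > 0" unfolding u_def using \<open>I \<noteq> {}\<close> len_pos by (intro sum_pos) auto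
  have tot: "(\<Sum>e\<in>UNIV. len e) = (\<Sum>e\<in>- I. len e) + u"
    using sum.union_disjoint[of I "- I" len] by (simp add: u_def)
  have "\<exists>r. (\<forall>e\<in>- I. norm (r e) = len e) \<and> (\<Sum>e\<in>- I. r e) = - (u *\<^sub>R v)"
  proof (rule vectors_with_sum_exist)
    show "norm (- (u *\<^sub>R v)) \<le> (\<Sum>e\<in>- I. len e)" using I u v by (simp add: u_def)
    show "2 * len x \<le> (\<Sum>e\<in>- I. len e) + norm (- (u *\<^sub>R v))" for x
      using polygon_inequality[of x] u v by (simp add: tot)
  qed (simp_all add: less_imp_le len_pos)
  then obtain r where r: "\<forall>e\<in>- I. norm (r e) = len e" "(\<Sum>e\<in>- I. r e) = - (u *\<^sub>R v)" by (elim exE conjE)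
  define \<rho> :: "real ^ 3 ^ 'e" where "\<rho> = (\<chi> e. if e \<in> I then len e *\<^sub>R v else r e)"
  have bI: "bsum I \<rho> = u *\<^sub>R v" by (simp add: bsum_def \<rho>_def u_def scaleR_sum_left)
  have "bsum (- I) \<rho> = - (u *\<^sub>R v)"
    unfolding bsum_def r(2)[symmetric] by (intro sum.cong) (auto simp: \<rho>_def)
  then have "bsum UNIV \<rho> = 0" using bsum_Un[of I "- I" \<rho>] bI by simp
  moreover have "norm (\<rho> $ e) = len e" for e using r(1) v len_pos[of e] by (simp add: \<rho>_def)
  ultimately have \<rho>: "\<rho> \<in> PolT len" by (simp add: PolT_def bsum_def)
  have al: "\<forall>e\<in>I. \<rho> $ e = len e *\<^sub>R v" by (simp add: \<rho>_def)
  have v0: "v \<noteq> 0" using v by auto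
  show ?thesis
  proof (cases "bsum C \<rho> \<times>\<^sub>3 v = 0")
    case False
    with \<rho> al show ?thesis by (intro bexI[of _ \<rho>] conjI)
  next
    case par: True
    have "\<exists>e\<in>C. \<exists>f\<in>D. \<rho> $ e \<times>\<^sub>3 (\<rho> $ f) \<noteq> 0"
    proof (rule ccontr)
      assume "\<not> ?thesis"
      then have all: "\<rho> $ e \<times>\<^sub>3 (\<rho> $ f) = 0" if "e \<in> C" "f \<in> D" for e f using that by blast
      obtain e0 f0 where ef: "e0 \<in> C" "f0 \<in> D" using C by blast
      let ?w = "\<rho> $ e0"
      have w0: "?w \<noteq> 0" by (rule PolT_nonzero[OF \<rho>])
      have wCD: "?w \<times>\<^sub>3 (\<rho> $ g) = 0" if "g \<notin> I" for g
      proof (cases "g \<in> D")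
        case True then show ?thesis by (rule all[OF ef(1)])
      next
        case False
        then have "g \<in> C" using that C(4) by blast
        then have "\<rho> $ f0 \<times>\<^sub>3 (\<rho> $ g) = 0" using all[OF _ ef(2), of g] cross_skew[of "\<rho> $ f0" "\<rho> $ g"] by simp
        with all[OF ef] show ?thesis by (rule cross3_parallel_trans) (rule PolT_nonzero[OF \<rho>])
      qed
      then have "(\<Sum>g\<in>- I. ?w \<times>\<^sub>3 (\<rho> $ g)) = 0" by (intro sum.neutral) simp
      then have "?w \<times>\<^sub>3 bsum (- I) \<rho> = 0" by (simp add: sum_cross3_right bsum_def)
      then have "?w \<times>\<^sub>3 v = 0"
        using \<open>bsum (- I) \<rho> = - (u *\<^sub>R v)\<close> u by (simp add: cross_mult_right)
      then have "?w \<times>\<^sub>3 (\<rho> $ g) = 0" for g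
        using wCD[of g] al by (cases "g \<in> I") (simp_all add: cross_mult_right)
      then show False using not_on_line[OF \<rho> w0] by simp
    qed
    then obtain e f where ef: "e \<in> C" "f \<in> D" "\<rho> $ e \<times>\<^sub>3 (\<rho> $ f) \<noteq> 0" by (elim bexE)
    obtain \<sigma> where \<sigma>: "\<sigma> \<in> PolT len" "dist \<sigma> \<rho> < 1" "\<forall>g. g \<noteq> e \<longrightarrow> g \<noteq> f \<longrightarrow> \<sigma> $ g = \<rho> $ g"
      "(\<sigma> $ e - \<rho> $ e) \<times>\<^sub>3 v \<noteq> 0"
      using pair_move[OF \<rho> ef(3) v0 zero_less_one] by (elim bexE conjE)
    have "bsum C \<sigma> = bsum C \<rho> + (\<sigma> $ e - \<rho> $ e)"
      by (rule bsum_move[OF ef(1)]) (use \<sigma>(3) ef(2) C(3) in auto)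
    then have "bsum C \<sigma> \<times>\<^sub>3 v \<noteq> 0" using \<sigma>(4) par by (simp add: cross_add_left)
    moreover have "\<sigma> $ g = len g *\<^sub>R v" if "g \<in> I" for g
    proof -
      have "g \<noteq> e" "g \<noteq> f" using that ef C(4) by auto
      then show ?thesis using \<sigma>(3) al that by simp
    qed
    ultimately show ?thesis using \<sigma>(1) by (intro bexI[of _ \<sigma>]) auto
  qed
qed

text \<open>Commutation makes the class of \<open>q\<close>, the quarter turn of
  \<open>\<rho>\<close> along \<open>J\<close>, invariant under the half turn of \<open>I\<close>;
  let \<open>Q\<close> be the matching rotation. The half turn does not move the edges outside
  \<open>I\<close>. If these are not all parallel, \<open>Q\<close> is the identity and all edges of
  \<open>I\<close> in \<open>q\<close> lie on the axis. Both this and the parallel case contradict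
  the fact that the quarter turn moves \<open>v\<close> and \<open>c\<close> out of their common
  plane with normal \<open>n\<close>.\<close>

lemma commuting_not_crossing_aux:
  assumes less: "(\<Sum>e\<in>I. len e) < (\<Sum>e\<in>- I. len e)"
    and nzI: "\<And>\<rho>. \<rho> \<in> PolT len \<Longrightarrow> bsum I \<rho> \<noteq> 0" and nzJ: "\<And>\<rho>. \<rho> \<in> PolT len \<Longrightarrow> bsum J \<rho> \<noteq> 0"
    and comm: "\<And>p. p \<in> Pol len \<Longrightarrow> class_map len (bend I (- 1)) (class_map len (bend J \<i>) p)
        = class_map len (bend J \<i>) (class_map len (bend I (- 1)) p)"
    and corners: "I \<inter> J \<noteq> {}" "I - J \<noteq> {}" "J - I \<noteq> {}" "- (I \<union> J) \<noteq> {}"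
  shows False
proof -
  define v :: "real ^ 3" where "v = axis 1 1"
  have v: "norm v = 1" "v \<noteq> 0" by (simp_all add: v_def norm_axis_1)
  obtain \<rho> where \<rho>: "\<rho> \<in> PolT len" and al: "\<forall>e\<in>I. \<rho> $ e = len e *\<^sub>R v" and Cv: "bsum (J - I) \<rho> \<times>\<^sub>3 v \<noteq> 0"
    using exists_aligned[OF less v(1) corners(3,4)] corners(1) by blast
  define c where "c = bsum (J - I) \<rho>"
  define n where "n = v \<times>\<^sub>3 c"
  have n0: "n \<noteq> 0" using Cv cross_skew[of v c] by (simp add: n_def c_def)
  have nv: "v \<bullet> n = 0" "c \<bullet> n = 0" by (simp_all add: n_def dot_cross_self)
  have sA: "bsum A \<rho> = (\<Sum>e\<in>A. len e) *\<^sub>R v" if "A \<subseteq> I" for A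
  proof -
    have "bsum A \<rho> = (\<Sum>e\<in>A. len e *\<^sub>R v)" unfolding bsum_def using al that by (intro sum.cong) auto
    then show ?thesis by (simp add: scaleR_sum_left)
  qed
  define \<alpha> where "\<alpha> = (\<Sum>e\<in>I \<inter> J. len e)"
  have \<alpha>: "\<alpha> > 0" unfolding \<alpha>_def using corners(1) len_pos by (intro sum_pos) auto
  have uI: "(\<Sum>e\<in>I. len e) > 0" using corners(1) len_pos by (intro sum_pos) auto
  define b where "b = bsum J \<rho>"
  have "J = (I \<inter> J) \<union> (J - I)" "(I \<inter> J) \<inter> (J - I) = {}" by blast+
  then have b: "b = \<alpha> *\<^sub>R v + c"
    using bsum_Un[of "I \<inter> J" "J - I" \<rho>] sA[of "I \<inter> J"] by (simp add: b_def \<alpha>_def c_def)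
  have b0: "b \<noteq> 0" unfolding b_def by (rule nzJ[OF \<rho>])
  have bn: "b \<bullet> n = 0" by (simp add: b inner_add_left nv)
  let ?R = "rot \<i> (sgn b)"
  \<comment> \<open>The cosine term vanishes for a quarter turn, and the term along the axis is
    orthogonal to \<open>n\<close>.\<close>
  have Rn: "?R x \<bullet> n = ((b \<times>\<^sub>3 x) \<bullet> n) / norm b" for x
    using bn by (simp add: rot_def sgn_div_norm cross_mult_left inner_add_left divide_inverse_commute)
  have "b \<times>\<^sub>3 v = - n" using cross_skew[of c v] by (simp add: b cross_add_left cross_mult_left n_def)
  then have Rv: "?R v \<bullet> n \<noteq> 0" using n0 b0 by (simp add: Rn)
  have "b \<times>\<^sub>3 c = \<alpha> *\<^sub>R n" by (simp add: b cross_add_left cross_mult_left n_def)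
  then have Rc: "?R c \<bullet> n \<noteq> 0" using n0 b0 \<alpha> by (simp add: Rn)
  define q where "q = bend J \<i> \<rho>"
  have qP: "q \<in> PolT len" unfolding q_def by (intro bend_PolT \<rho> nzJ) simp
  have eI: "equivariant len (bend I (- 1))" by (rule equivariant_bend) (simp_all add: nzI)
  have eJ: "equivariant len (bend J \<i>)" by (rule equivariant_bend) (simp_all add: nzJ)
  have sI: "sgn (bsum I \<rho>) = v" using uI v(1) sA[of I] by (simp add: sgn_div_norm)
  have "bend I (- 1) \<rho> $ e = \<rho> $ e" for e
    using al by (simp add: bend_nth sI linear_scale[OF linear_rot] rot_axis[OF v(1)])
  then have fix1: "bend I (- 1) \<rho> = \<rho>" by (simp add: vec_eq_iff[of "bend I (- 1) \<rho>"])
  have "pol_class len (bend I (- 1) q) = class_map len (bend I (- 1)) (class_map len (bend J \<i>) (pol_class len \<rho>))"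
    by (simp add: class_map[OF eJ \<rho>] class_map[OF eI qP] flip: q_def)
  also have "\<dots> = class_map len (bend J \<i>) (class_map len (bend I (- 1)) (pol_class len \<rho>))"
    by (rule comm) (simp add: \<rho>)
  also have "\<dots> = pol_class len q"
    by (simp add: class_map[OF eI \<rho>] fix1 class_map[OF eJ \<rho>] flip: q_def)
  finally have "pol_class len q = pol_class len (bend I (- 1) q)" ..
  then obtain Q where Q: "rotf Q" "\<forall>e. bend I (- 1) q $ e = Q (q $ e)"
    using pol_class_eq_iff[OF qP equivariantD[OF eI qP]] by blast
  \<comment> \<open>Otherwise the turned sum over \<open>J - I\<close> would be parallel to the sum
    over \<open>D\<close>, which the quarter turn has left in the plane orthogonal to
    \<open>n\<close>.\<close>
  have "\<exists>e f. e \<notin> I \<and> f \<notin> I \<and> q $ e \<times>\<^sub>3 (q $ f) \<noteq> 0"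
  proof (rule ccontr)
    assume "\<not> ?thesis"
    then have all: "q $ e \<times>\<^sub>3 (q $ f) = 0" if "e \<notin> I" "f \<notin> I" for e f using that by blast
    define D where "D = - (I \<union> J)"
    have qD: "bsum D q = bsum D \<rho>" unfolding q_def by (rule bsum_bend_disjoint) (auto simp: D_def)
    have qC: "bsum (J - I) q = ?R c"
      unfolding q_def c_def b_def by (rule bsum_bend_subset[OF nzJ[OF \<rho>]]) auto
    have D: "bsum D \<rho> = - ((\<Sum>e\<in>I. len e) *\<^sub>R v) - c"
    proof -
      have "UNIV = (I \<union> (J - I)) \<union> D" "(I \<union> (J - I)) \<inter> D = {}" "I \<inter> (J - I) = {}" by (auto simp: D_def)
      then have "bsum I \<rho> + bsum (J - I) \<rho> + bsum D \<rho> = 0"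
        using bsum_UNIV[OF \<rho>] bsum_Un[of "I \<union> (J - I)" D \<rho>] bsum_Un[of I "J - I" \<rho>] by metis
      then show ?thesis by (simp add: sA c_def algebra_simps eq_neg_iff_add_eq_0)
    qed
    have D0: "bsum D \<rho> \<noteq> 0"
    proof
      assume "bsum D \<rho> = 0"
      then have "v \<times>\<^sub>3 (- ((\<Sum>e\<in>I. len e) *\<^sub>R v) - c) = 0" using D by simp
      then show False using n0 by (simp add: Cross3.right_diff_distrib cross_mult_right n_def)
    qed
    have par: "bsum (J - I) q \<times>\<^sub>3 bsum D q = 0"
    proof -
      have eD: "q $ e \<times>\<^sub>3 bsum D q = 0" if "e \<in> J - I" for e
        unfolding bsum_def sum_cross3_right[symmetric]
        by (intro sum.neutral ballI all) (use that in \<open>auto simp: D_def\<close>)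
      have "bsum D q \<times>\<^sub>3 bsum (J - I) q = 0"
        unfolding bsum_def[of "J - I"] sum_cross3_right[symmetric]
        using eD by (intro sum.neutral ballI) (subst cross_skew, simp)
      then show ?thesis by (subst cross_skew) simp
    qed
    have Dn: "bsum D \<rho> \<bullet> n = 0" by (simp add: D inner_diff_left nv)
    have "?R c \<bullet> n = 0"
      by (rule cross3_zero_orth[OF par[unfolded qD qC] D0 Dn])
    with Rc show False by simp
  qed
  then obtain e f where ef: "e \<notin> I" "f \<notin> I" "q $ e \<times>\<^sub>3 (q $ f) \<noteq> 0" by (elim exE conjE)
  have Qq: "Q (q $ g) = q $ g" if "g \<notin> I" for g using Q(2)[rule_format, of g] that by (simp add: bend_nth)
  have Qid: "Q x = x" for x by (rule rotf_fixing_two[OF Q(1) Qq[OF ef(1)] Qq[OF ef(2)] ef(3)])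
  let ?s = "sgn (bsum I q)"
  have s1: "norm ?s = 1" using nzI[OF qP] by (simp add: norm_sgn)
  have ax: "?s \<times>\<^sub>3 (q $ g) = 0" if "g \<in> I" for g
  proof (rule ccontr)
    assume "?s \<times>\<^sub>3 (q $ g) \<noteq> 0"
    moreover have "rot (- 1) ?s (q $ g) = q $ g" using Q(2)[rule_format, of g] that by (simp add: bend_nth Qid)
    ultimately have "(- 1 :: complex) = 1" using s1 by (intro rot_fixed_imp_one) auto
    then show False by (simp add: complex_eq_iff)
  qed
  \<comment> \<open>The edge \<open>g\<close> has been turned with \<open>J\<close>, while
    \<open>h\<close> still has direction \<open>v\<close>; both lying on the axis would keep the
    turned \<open>v\<close> in the plane.\<close>
  obtain g h where gh: "g \<in> I \<inter> J" "h \<in> I - J" using corners by blast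
  have s0: "?s \<noteq> 0" using s1 by auto
  have "q $ g \<times>\<^sub>3 ?s = 0" using ax[of g] gh cross_skew[of "q $ g" ?s] by simp
  then have "q $ g \<times>\<^sub>3 (q $ h) = 0" by (rule cross3_parallel_trans[OF _ ax s0]) (use gh in simp)
  moreover have "q $ g = len g *\<^sub>R ?R v" "q $ h = len h *\<^sub>R v"
    using gh al by (simp_all add: q_def bend_nth b_def linear_scale[OF linear_rot])
  ultimately have "?R v \<times>\<^sub>3 v = 0"
    using len_pos[of g] len_pos[of h] by (simp add: cross_mult_left cross_mult_right)
  then have "?R v \<bullet> n = 0" by (rule cross3_zero_orth[OF _ v(2) nv(1)])
  with Rv show False by simp
qed

lemma class_map_bend_Compl:
  assumes nz: "\<And>\<rho>. \<rho> \<in> PolT len \<Longrightarrow> bsum I \<rho> \<noteq> 0" and z: "norm z = 1"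
  shows "class_map len (bend (- I) z) = class_map len (bend I z)"
proof (rule class_map_cong[symmetric])
  show "equivariant len (bend I z)" by (rule equivariant_bend[OF nz z])
  show "equivariant len (bend (- I) z)" by (rule equivariant_bend[OF _ z]) (simp add: bsum_Compl nz)
  show "\<exists>f. rotf f \<and> (\<forall>e. bend (- I) z \<rho> $ e = f (bend I z \<rho> $ e))" if "\<rho> \<in> PolT len" for \<rho>
    by (rule bend_Compl[OF that nz[OF that] z])
qed

text \<open>Incompatibility of the splits \<open>{I, - I}\<close> and \<open>{J, - J}\<close>: it
  does not depend on which side names a split.\<close>

definition crossing :: "'e set \<Rightarrow> 'e set \<Rightarrow> bool" where
  "crossing I J \<longleftrightarrow> I \<inter> J \<noteq> {} \<and> I - J \<noteq> {} \<and> J - I \<noteq> {} \<and> - (I \<union> J) \<noteq> {}"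

text \<open>By genericity \<open>I\<close> and its complement have different total lengths. The
  shorter side is the one to be straightened, and passing to it changes neither the bending of
  classes nor the crossing.\<close>

lemma commuting_not_crossing:
  assumes nzI: "\<And>\<rho>. \<rho> \<in> PolT len \<Longrightarrow> bsum I \<rho> \<noteq> 0" and nzJ: "\<And>\<rho>. \<rho> \<in> PolT len \<Longrightarrow> bsum J \<rho> \<noteq> 0"
    and comm: "\<And>p. p \<in> Pol len \<Longrightarrow> class_map len (bend I (- 1)) (class_map len (bend J \<i>) p)
        = class_map len (bend J \<i>) (class_map len (bend I (- 1)) p)"
  shows "\<not> crossing I J"
proof
  assume cr: "crossing I J"
  define \<epsilon> :: "'e \<Rightarrow> real" where "\<epsilon> e = (if e \<in> I then 1 else - 1)" for e
  have "(\<Sum>e\<in>UNIV. \<epsilon> e * len e) = (\<Sum>e\<in>I. len e) - (\<Sum>e\<in>- I. len e)"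
    by (simp add: \<epsilon>_def if_distrib[of "\<lambda>x. x * _"] sum.If_cases sum_negf)
  moreover have "(\<Sum>e\<in>UNIV. \<epsilon> e * len e) \<noteq> 0"
    using generic[unfolded generic_def] by (rule contrapos_nn) (intro exI[of _ \<epsilon>], simp add: \<epsilon>_def)
  ultimately consider "(\<Sum>e\<in>I. len e) < (\<Sum>e\<in>- I. len e)" | "(\<Sum>e\<in>- I. len e) < (\<Sum>e\<in>- (- I). len e)"
    by force
  then show False
  proof cases
    case 1
    then show False using commuting_not_crossing_aux[OF 1 nzI nzJ comm] cr by (simp add: crossing_def)
  next
    case 2
    have m: "class_map len (bend (- I) (- 1)) = class_map len (bend I (- 1))"
      by (rule class_map_bend_Compl[OF nzI]) simp_all
    have c: "- I \<inter> J \<noteq> {}" "- I - J \<noteq> {}" "J - - I \<noteq> {}" "- (- I \<union> J) \<noteq> {}"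
      using cr by (auto simp: crossing_def)
    show False
      by (rule commuting_not_crossing_aux[OF 2 _ nzJ _ c]) (simp_all add: bsum_Compl nzI m comm)
  qed
qed

end

section \<open>Compatible splits\<close>

text \<open>Remove a maximal member \<open>M\<close> and take a partition for the rest. Each of its
  blocks lies in \<open>M\<close> or avoids it, and at least two lie in \<open>M\<close>, since
  \<open>M\<close> is neither a singleton nor among the remaining members. Merging them into
  \<open>M\<close> pays for the one extra member.\<close>

lemma laminar_partition:
  fixes \<L> :: "'a set set"
  assumes "finite S" "\<L> \<subseteq> Pow S" "\<And>A. A \<in> \<L> \<Longrightarrow> 2 \<le> card A"
    and "\<And>A B. A \<in> \<L> \<Longrightarrow> B \<in> \<L> \<Longrightarrow> A \<subseteq> B \<or> B \<subseteq> A \<or> A \<inter> B = {}"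
  shows "\<exists>P. partition_on S P \<and> (\<forall>B\<in>P. B \<in> \<L> \<or> (\<exists>x. B = {x})) \<and> card \<L> + card P \<le> card S"
  using assms(2-)
proof (induction "card \<L>" arbitrary: \<L>)
  case 0
  then have "\<L> = {}" using assms(1) by (metis card_0_eq finite_Pow_iff finite_subset)
  moreover have "card ((\<lambda>x. {x}) ` S) \<le> card S" using assms(1) by (rule card_image_le)
  ultimately show ?case
    by (intro exI[of _ "(\<lambda>x. {x}) ` S"] conjI partition_on_singletons) auto
next
  case (Suc n)
  have fin: "finite \<L>" using Suc.prems(1) assms(1) by (metis finite_Pow_iff finite_subset)
  have "\<L> \<noteq> {}" using Suc.hyps(2) by auto
  then obtain M where M: "M \<in> \<L>" "\<And>B. B \<in> \<L> \<Longrightarrow> M \<subseteq> B \<Longrightarrow> M = B"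
    using finite_has_maximal[OF fin] by blast
  have cM: "2 \<le> card M" "M \<noteq> {}" using Suc.prems(2)[OF M(1)] by auto
  have c': "n = card (\<L> - {M})" using Suc.hyps(2) M(1) fin by simp
  have "\<exists>P. partition_on S P \<and> (\<forall>B\<in>P. B \<in> \<L> - {M} \<or> (\<exists>x. B = {x})) \<and> card (\<L> - {M}) + card P \<le> card S"
  proof (rule Suc.hyps(1)[OF c'])
    show "\<L> - {M} \<subseteq> Pow S" using Suc.prems(1) by blast
    show "2 \<le> card A" if "A \<in> \<L> - {M}" for A using Suc.prems(2)[of A] that by blast
    show "A \<subseteq> B \<or> B \<subseteq> A \<or> A \<inter> B = {}" if "A \<in> \<L> - {M}" "B \<in> \<L> - {M}" for A B
      using Suc.prems(3)[of A B] that by blast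
  qed
  then obtain P' where P': "partition_on S P'" "\<forall>B\<in>P'. B \<in> \<L> - {M} \<or> (\<exists>x. B = {x})" "card (\<L> - {M}) + card P' \<le> card S"
    by (elim exE conjE)
  have finP: "finite P'" using finite_elements[OF assms(1) P'(1)] .
  define P0 where "P0 = {B \<in> P'. B \<inter> M = {}}"
  define P1 where "P1 = {B \<in> P'. B \<subseteq> M}"
  have dich: "B \<subseteq> M \<or> B \<inter> M = {}" if B: "B \<in> P'" for B
  proof (cases "B \<in> \<L> - {M}")
    case True
    then show ?thesis using Suc.prems(3)[OF M(1), of B] M(2)[of B] by blast
  next
    case False
    then obtain x where "B = {x}" using P'(2) B by blast
    then show ?thesis by blast
  qed
  have ne: "B \<noteq> {}" if "B \<in> P'" for B using P'(1) that by (auto simp: partition_on_def)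
  have un: "P' = P0 \<union> P1" using dich unfolding P0_def P1_def by blast
  have dj: "P0 \<inter> P1 = {}" using ne unfolding P0_def P1_def by blast
  have MS: "M \<subseteq> S" using M(1) Suc.prems(1) by blast
  have S: "S = \<Union>P'" using P'(1) by (rule partition_onD1)
  have UP1: "\<Union>P1 = M"
  proof
    show "M \<subseteq> \<Union>P1"
    proof
      fix x assume "x \<in> M"
      then obtain B where "B \<in> P'" "x \<in> B" using MS S by blast
      then show "x \<in> \<Union>P1" using dich[of B] \<open>x \<in> M\<close> by (auto simp: P1_def)
    qed
  qed (auto simp: P1_def)
  have "2 \<le> card P1"
  proof (rule ccontr)
    assume "\<not> 2 \<le> card P1"
    moreover have "card P1 \<noteq> 0" using UP1 cM(2) finP by (auto simp: P1_def)
    ultimately have "card P1 = 1" by linarith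
    then obtain B where "P1 = {B}" by (auto simp: card_1_singleton_iff)
    then have "M \<in> P'" using UP1 by (auto simp: P1_def)
    then obtain x where "M = {x}" using P'(2) by blast
    then show False using cM by simp
  qed
  moreover have "card P' = card P0 + card P1"
    using finP dj unfolding un by (simp add: card_Un_disjoint)
  moreover have "card (insert M P0) \<le> card P0 + 1" by (simp add: card_insert_le_m1 card_insert_if)
  ultimately have "card \<L> + card (insert M P0) \<le> card S"
    using P'(3) c' Suc.hyps(2) by linarith
  moreover have "partition_on S (insert M P0)"
  proof (rule partition_onI)
    show "\<Union>(insert M P0) = S" using S un UP1 by auto
    show "disjnt p q" if "p \<in> insert M P0" "q \<in> insert M P0" "p \<noteq> q" for p q
      using that P'(1) unfolding disjnt_def partition_on_def disjoint_def P0_def by blast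
    show "{} \<notin> insert M P0" using cM(2) ne by (auto simp: P0_def)
  qed
  moreover have "\<forall>B\<in>insert M P0. B \<in> \<L> \<or> (\<exists>x. B = {x})" using P'(2) M(1) by (auto simp: P0_def)
  ultimately show ?case by blast
qed

context polygon_space
begin

text \<open>A side \<open>A\<close> that is minimal among the sides that are not lopsided separates the remaining splits
  into laminar families of subsets of \<open>A\<close> and of \<open>- A\<close>; the first one partitions \<open>A\<close> into lopsided sets,
  and the lopsided set \<open>- A\<close> completes this to a partition of everything.\<close>

lemma compatible_splits_bound:
  assumes compl: "\<And>A. A \<in> \<S> \<Longrightarrow> - A \<in> \<S>" and lop: "\<And>A. A \<in> \<S> \<Longrightarrow> lopsided len A \<or> lopsided len (- A)"
    and sz: "\<And>A. A \<in> \<S> \<Longrightarrow> 2 \<le> card A" and nc: "\<And>A B. A \<in> \<S> \<Longrightarrow> B \<in> \<S> \<Longrightarrow> \<not> crossing A B"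
  shows "\<exists>\<A>\<subseteq>\<S>. (\<forall>A\<in>\<S>. A \<in> \<A> \<or> - A \<in> \<A>) \<and> card \<A> + max 3 (N_lopsided len) \<le> CARD('e)"
proof (cases "\<S> = {}")
  case True
  have "N_lopsided len \<le> card ((\<lambda>e. {e}) ` (UNIV :: 'e set))"
    using lopsided_singleton[OF len_pos] by (intro N_lopsided_le partition_on_singletons) auto
  also have "\<dots> = CARD('e)" by (rule card_image) simp
  finally show ?thesis using True card_ge_3 by (intro exI[of _ "{}"]) simp
next
  case False
  \<comment> \<open>If every side is lopsided, any side of a split serves.\<close>
  have "\<exists>A\<in>\<S>. lopsided len (- A) \<and> (\<forall>B\<in>\<S>. B \<subset> A \<longrightarrow> lopsided len B)"
  proof (cases "\<exists>A\<in>\<S>. \<not> lopsided len A")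
    case True
    then obtain A where "A \<in> {A \<in> \<S>. \<not> lopsided len A}" "\<forall>B\<in>{A \<in> \<S>. \<not> lopsided len A}. B \<subseteq> A \<longrightarrow> A = B"
      using finite_has_minimal[of "{A \<in> \<S>. \<not> lopsided len A}"] by auto
    then show ?thesis using lop by (intro bexI[of _ A]) auto
  next
    case False
    with \<open>\<S> \<noteq> {}\<close> compl show ?thesis by blast
  qed
  then obtain A where A: "A \<in> \<S>" "lopsided len (- A)" "\<And>B. B \<in> \<S> \<Longrightarrow> B \<subset> A \<Longrightarrow> lopsided len B" by blast
  have ne: "A \<noteq> {}" "- A \<noteq> {}" "2 \<le> card A" "2 \<le> card (- A)"
    using sz[OF A(1)] sz[OF compl[OF A(1)]] by auto
  define \<A>1 where "\<A>1 = {B \<in> \<S>. B \<subset> A}"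
  define \<A>2 where "\<A>2 = {B \<in> \<S>. B \<subset> - A}"
  have "\<exists>P. partition_on A P \<and> (\<forall>B\<in>P. B \<in> \<A>1 \<or> (\<exists>x. B = {x})) \<and> card \<A>1 + card P \<le> card A"
  proof (rule laminar_partition)
    show "B \<subseteq> B' \<or> B' \<subseteq> B \<or> B \<inter> B' = {}" if "B \<in> \<A>1" "B' \<in> \<A>1" for B B'
      using nc[of B B'] that ne(2) unfolding crossing_def \<A>1_def by blast
  qed (auto simp: \<A>1_def sz)
  then obtain P1 where P1: "partition_on A P1" "\<forall>B\<in>P1. B \<in> \<A>1 \<or> (\<exists>x. B = {x})" "card \<A>1 + card P1 \<le> card A" by blast
  \<comment> \<open>Counting \<open>- A\<close> itself as a member, and the partition as nonempty,
    gains the 2 in \<open>c2\<close>.\<close>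
  have "\<exists>P. partition_on (- A) P \<and> (\<forall>B\<in>P. B \<in> insert (- A) \<A>2 \<or> (\<exists>x. B = {x})) \<and> card (insert (- A) \<A>2) + card P \<le> card (- A)"
  proof (rule laminar_partition)
    show "B \<subseteq> B' \<or> B' \<subseteq> B \<or> B \<inter> B' = {}" if "B \<in> insert (- A) \<A>2" "B' \<in> insert (- A) \<A>2" for B B'
    proof (cases "B = - A \<or> B' = - A")
      case True
      then show ?thesis using that unfolding \<A>2_def by blast
    next
      case False
      then show ?thesis using nc[of B B'] that ne(1) unfolding crossing_def \<A>2_def by blast
    qed
  qed (use ne(4) sz in \<open>auto simp: \<A>2_def\<close>)
  then obtain P2 where P2: "partition_on (- A) P2" "card (insert (- A) \<A>2) + card P2 \<le> card (- A)" by blast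
  have "P2 \<noteq> {}" using P2(1) ne(2) by (auto simp: partition_on_def)
  then have "card P2 \<ge> 1" by (simp add: Suc_leI card_gt_0_iff)
  moreover have "card (insert (- A) \<A>2) = card \<A>2 + 1" by (simp add: \<A>2_def)
  ultimately have c2: "card \<A>2 + 2 \<le> card (- A)" using P2(2) by linarith
  \<comment> \<open>Only proper subsets of \<open>A\<close> belong to \<open>\<A>1\<close>, so
    \<open>A\<close> is not a block by itself. With the block \<open>- A\<close> this makes three
    blocks, hence the 3 in the maximum.\<close>
  have c1: "2 \<le> card P1"
  proof (rule ccontr)
    assume "\<not> 2 \<le> card P1"
    moreover have "card P1 \<noteq> 0" using P1(1) ne(1) by (auto simp: partition_on_def)
    ultimately have "card P1 = 1" by linarith
    then obtain B where "P1 = {B}" by (auto simp: card_1_singleton_iff)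
    then have "A \<in> P1" using P1(1) by (auto simp: partition_on_def)
    then obtain x where "A = {x}" using P1(2) by (auto simp: \<A>1_def)
    then show False using ne(3) by simp
  qed
  have notin: "- A \<notin> P1" using P1(1) ne(2) by (auto simp: partition_on_def)
  have "partition_on UNIV (insert (- A) P1)"
    using P1(1) ne(2) unfolding partition_on_def disjoint_def by auto
  moreover have "lopsided len B" if "B \<in> insert (- A) P1" for B
  proof -
    consider "B = - A" | "B \<in> \<A>1" | x where "B = {x}" using \<open>B \<in> insert (- A) P1\<close> P1(2) by blast
    then show ?thesis
    proof cases
      case 1 then show ?thesis using A(2) by simp
    next
      case 2 then show ?thesis using A(3) by (simp add: \<A>1_def)
    next
      case 3 then show ?thesis using lopsided_singleton[where len = len, OF len_pos] by simp
    qed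
  qed
  ultimately have "N_lopsided len \<le> card (insert (- A) P1)" by (rule N_lopsided_le)
  then have N: "N_lopsided len \<le> card P1 + 1" using notin by simp
  \<comment> \<open>One side of each split lies in \<open>\<A>\<close>. By the bounds above its size
    is at most \<open>CARD('e) - (card P1 + 1)\<close>, and \<open>card P1 + 1\<close> is at least
    both 3 and \<open>N_lopsided len\<close>.\<close>
  define \<A> where "\<A> = insert A (\<A>1 \<union> \<A>2)"
  have "card \<A> \<le> 1 + (card \<A>1 + card \<A>2)"
    unfolding \<A>_def using card_insert_le_m1[of "1 + (card \<A>1 + card \<A>2)" "\<A>1 \<union> \<A>2" A] card_Un_le[of \<A>1 \<A>2] by simp
  moreover have "CARD('e) = card A + card (- A)"
    using card_Un_disjoint[of A "- A"] by simp
  ultimately have "card \<A> + max 3 (N_lopsided len) \<le> CARD('e)"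
    using N c1 c2 P1(3) by linarith
  moreover have "\<A> \<subseteq> \<S>" using A(1) by (auto simp: \<A>_def \<A>1_def \<A>2_def)
  moreover have "B \<in> \<A> \<or> - B \<in> \<A>" if B: "B \<in> \<S>" for B
  proof -
    have "A \<inter> B = {} \<or> A - B = {} \<or> B - A = {} \<or> - (A \<union> B) = {}"
      using nc[OF A(1) B] unfolding crossing_def by blast
    then have "B \<subset> - A \<or> - B = A \<or> - B \<subset> - A \<or> B = A \<or> B \<subset> A \<or> - B \<subset> A" by blast
    then show ?thesis using B compl[OF B] by (auto simp: \<A>_def \<A>1_def \<A>2_def)
  qed
  ultimately show ?thesis by blast
qed

end

section \<open>The dimension of a bending torus\<close>

lemma homogeneous_system_solution:
  fixes x :: "'a \<Rightarrow> 'k \<Rightarrow> real"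
  assumes "finite A" "finite K" "card A < card K"
  shows "\<exists>c. (\<exists>k\<in>K. c k \<noteq> 0) \<and> (\<forall>a\<in>A. (\<Sum>k\<in>K. c k * x a k) = 0)"
  using assms
proof (induction A arbitrary: K x rule: finite_induct)
  case empty
  then obtain k where "k \<in> K" by (auto simp: card_gt_0_iff)
  then show ?case by (intro exI[of _ "\<lambda>_. 1"]) auto
next
  case (insert a A)
  show ?case
  proof (cases "\<forall>k\<in>K. x a k = 0")
    case True
    obtain c where "\<exists>k\<in>K. c k \<noteq> 0" "\<forall>a\<in>A. (\<Sum>k\<in>K. c k * x a k) = 0"
      using insert.IH[of K x] insert.prems insert.hyps by (auto simp: card_insert_if)
    with True show ?thesis by (intro exI[of _ c]) simp
  next
    case False
    then obtain j where j: "j \<in> K" "x a j \<noteq> 0" by blast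
    \<comment> \<open>Gaussian elimination: equation \<open>a\<close> removes the unknown
      \<open>j\<close>, and \<open>- s\<close> in \<open>c'\<close> below is the value that this
      equation gives it.\<close>
    define y where "y b k = x b k - x a k / x a j * x b j" for b k
    have "card A < card (K - {j})" using insert.prems insert.hyps j by simp
    then obtain c where c: "\<exists>k\<in>K - {j}. c k \<noteq> 0" "\<forall>b\<in>A. (\<Sum>k\<in>K - {j}. c k * y b k) = 0"
      using insert.IH[of "K - {j}" y] insert.prems by auto
    define s where "s = (\<Sum>k\<in>K - {j}. c k * x a k) / x a j"
    define c' where "c' = c(j := - s)"
    have sum: "(\<Sum>k\<in>K. c' k * x b k) = (\<Sum>k\<in>K - {j}. c k * x b k) - s * x b j" for b
    proof -
      have "(\<Sum>k\<in>K - {j}. c' k * x b k) = (\<Sum>k\<in>K - {j}. c k * x b k)"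
        by (intro sum.cong) (auto simp: c'_def)
      then show ?thesis using sum.remove[OF insert.prems(1) j(1), of "\<lambda>k. c' k * x b k"] by (simp add: c'_def)
    qed
    have "(\<Sum>k\<in>K - {j}. c k * y b k) = (\<Sum>k\<in>K - {j}. c k * x b k) - s * x b j" for b
    proof -
      have "(\<Sum>k\<in>K - {j}. c k * y b k) = (\<Sum>k\<in>K - {j}. c k * x b k - (c k * x a k / x a j) * x b j)"
        by (intro sum.cong) (simp_all add: y_def right_diff_distrib)
      then show ?thesis by (simp only: sum_subtractf s_def sum_divide_distrib sum_distrib_right)
    qed
    then have "\<forall>b\<in>A. (\<Sum>k\<in>K. c' k * x b k) = 0" using c(2) sum by simp
    moreover have "(\<Sum>k\<in>K. c' k * x a k) = 0" using j(2) by (simp add: sum s_def)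
    moreover have "\<exists>k\<in>K. c' k \<noteq> 0" using c(1) by (auto simp: c'_def)
    ultimately show ?thesis by (intro exI[of _ c']) simp
  qed
qed

text \<open>The defect \<open>r\<close> is additive and vanishes on the integers, so it is periodic
  and, by continuity, bounded. A bounded additive function is zero.\<close>

lemma additive_continuous_linear:
  fixes \<phi> :: "real \<Rightarrow> real"
  assumes add: "\<And>s t. \<phi> (s + t) = \<phi> s + \<phi> t" and cont: "continuous_on UNIV \<phi>"
  shows "\<phi> t = t * \<phi> 1"
proof -
  define r where "r t = \<phi> t - t * \<phi> 1" for t
  have radd: "r (s + t) = r s + r t" for s t by (simp add: r_def add algebra_simps)
  have r0: "r 0 = 0" using radd[of 0 0] by simp
  have rneg: "r (- t) = - r t" for t using radd[of t "- t"] r0 by simp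
  have rmult: "r (real n * t) = real n * r t" for n t
    by (induction n) (simp_all add: r0 radd algebra_simps)
  have r1: "r 1 = 0" by (simp add: r_def)
  have rn: "r (real n) = 0" for n using rmult[of n 1] r1 by simp
  have ri: "r (of_int m) = 0" for m
  proof (cases "0 \<le> m")
    case True then show ?thesis using rn[of "nat m"] by simp
  next
    case False then show ?thesis using rn[of "nat (- m)"] rneg[of "of_int m"] by simp
  qed
  have "continuous_on {0..1} r"
    unfolding r_def by (intro continuous_intros continuous_on_subset[OF cont]) auto
  then have "compact (r ` {0..1})" by (rule compact_continuous_image) simp
  then have "bounded (r ` {0..1})" by (rule compact_imp_bounded)
  then obtain B where "\<forall>y\<in>r ` {0..1}. norm y \<le> B" unfolding bounded_iff ..
  then have B: "\<bar>r s\<bar> \<le> B" if "s \<in> {0..1}" for s using that by simp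
  have bd: "\<bar>r s\<bar> \<le> B" for s
  proof -
    have "r s = r (frac s) + r (of_int \<lfloor>s\<rfloor>)" using radd[of "frac s" "of_int \<lfloor>s\<rfloor>"] by (simp add: frac_def)
    then show ?thesis using B[of "frac s"] ri frac_ge_0[of s] frac_lt_1[of s] by simp
  qed
  have "r t = 0"
  proof (rule ccontr)
    assume "r t \<noteq> 0"
    then obtain n where "B < real n * \<bar>r t\<bar>" using reals_Archimedean3[of "\<bar>r t\<bar>"] by auto
    then show False using bd[of "real n * t"] by (simp add: rmult abs_mult)
  qed
  then show ?thesis by (simp add: r_def)
qed

lemma integer_valued_continuous_zero:
  fixes \<psi> :: "real \<Rightarrow> real"
  assumes cont: "continuous_on UNIV \<psi>" and int: "\<And>t. \<psi> t \<in> \<int>" and z: "\<psi> 0 = 0"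
  shows "\<psi> t = 0"
proof (rule ccontr)
  assume nz: "\<psi> t \<noteq> 0"
  obtain m where m: "\<psi> t = of_int m" using int[of t] by (auto elim: Ints_cases)
  with nz have m0: "m \<noteq> 0" by auto
  have conn: "connected (range \<psi>)" by (rule connected_continuous_image[OF cont connected_UNIV])
  have "\<exists>s. \<bar>\<psi> s\<bar> = 1 / 2"
  proof (cases "m > 0")
    case True
    have "1 / 2 \<in> range \<psi>"
      by (rule connectedD_interval[OF conn rangeI[of \<psi> 0] rangeI[of \<psi> t]]) (use True in \<open>auto simp: z m\<close>)
    then obtain s where "\<psi> s = 1 / 2" by (metis rangeE)
    then show ?thesis by (intro exI[of _ s]) simp
  next
    case False
    then have "m \<le> - 1" using m0 by simp
    then have "real_of_int m \<le> real_of_int (- 1)" by (simp only: of_int_le_iff)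
    then have "\<psi> t \<le> - 1" by (simp add: m)
    have "- (1 / 2) \<in> range \<psi>"
      by (rule connectedD_interval[OF conn rangeI[of \<psi> t] rangeI[of \<psi> 0]]) (use \<open>\<psi> t \<le> - 1\<close> in \<open>auto simp: z\<close>)
    then obtain s where "\<psi> s = - (1 / 2)" by (metis rangeE)
    then show ?thesis by (intro exI[of _ s]) simp
  qed
  then obtain s where "\<bar>\<psi> s\<bar> = 1 / 2" ..
  then show False using Ints_nonzero_abs_less1[OF int[of s]] by auto
qed

text \<open>A continuous logarithm exists because the line is contractible. Its imaginary part,
  normalised at 0, is additive up to multiples of \<open>2 * pi\<close>; this defect is continuous
  and vanishes at 0, hence vanishes everywhere.\<close>

lemma continuous_circle_hom:
  fixes h :: "real \<Rightarrow> complex"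
  assumes cont: "continuous_on UNIV h" and n: "\<And>t. norm (h t) = 1" and hom: "\<And>s t. h (s + t) = h s * h t"
  shows "\<exists>x. \<forall>t. h t = cis (t * x)"
proof -
  have "h t \<noteq> 0" for t using n[of t] by auto
  then obtain g where g: "continuous_on UNIV g" "\<And>t. h t = exp (g t)"
    using continuous_logarithm_on_contractible[OF cont] convex_imp_contractible[OF convex_UNIV] by auto
  have hc: "h t = cis (Im (g t))" for t
  proof -
    have "exp (Re (g t)) = 1" using n[of t] by (simp add: g(2))
    then show ?thesis by (simp add: g(2) exp_eq_polar)
  qed
  have "h 0 = 1" using hom[of 0 0] n[of 0] by (metis add_0 mult_cancel_left2 norm_zero zero_neq_one)
  define \<phi> where "\<phi> t = Im (g t) - Im (g 0)" for t
  have h\<phi>: "h t = cis (\<phi> t)" for t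
  proof -
    have "cis (\<phi> t) = cis (Im (g t)) / cis (Im (g 0))" by (simp add: \<phi>_def cis_divide)
    then show ?thesis using hc[of t] hc[of 0] \<open>h 0 = 1\<close> by simp
  qed
  have c\<phi>: "continuous_on UNIV \<phi>" unfolding \<phi>_def by (intro continuous_intros g(1))
  have "\<phi> (s + t) = \<phi> s + \<phi> t" for s t
  proof -
    let ?\<psi> = "\<lambda>t. (\<phi> (s + t) - \<phi> s - \<phi> t) / (2 * pi)"
    have "?\<psi> t = 0"
    proof (rule integer_valued_continuous_zero[where \<psi> = "?\<psi>" and t = t])
      show "continuous_on UNIV ?\<psi>"
        by (intro continuous_intros continuous_on_compose2[OF c\<phi>]) auto
      show "?\<psi> t \<in> \<int>" for t
      proof -
        have "cis (\<phi> (s + t) - \<phi> s - \<phi> t) = h (s + t) / (h s * h t)"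
          by (simp add: h\<phi> cis_divide cis_mult diff_diff_add)
        also have "\<dots> = 1" using hom[of s t] n[of "s + t"] by (metis divide_self norm_zero zero_neq_one)
        finally have "cos (\<phi> (s + t) - \<phi> s - \<phi> t) = 1" by (simp add: complex_eq_iff)
        then obtain k :: int where "\<phi> (s + t) - \<phi> s - \<phi> t = of_int k * 2 * pi"
          by (auto simp: cos_one_2pi_int)
        then show ?thesis by simp
      qed
      show "?\<psi> 0 = 0" by (simp add: \<phi>_def)
    qed
    then show ?thesis by simp
  qed
  then have "\<phi> t = t * \<phi> 1" for t using c\<phi> by (rule additive_continuous_linear)
  then show ?thesis using h\<phi> by metis
qed

section \<open>Windings and the upper bound for the dimension\<close>

context polygon_space
begin

lemma crossing_sym: "crossing I J \<longleftrightarrow> crossing J I"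
  unfolding crossing_def by (auto simp: Int_commute Un_commute)

lemma crossing_Compl: "crossing (- I) J \<longleftrightarrow> crossing I J"
  unfolding crossing_def by blast

lemma class_map_bend_trivial:
  assumes "card J = 1" "norm z = 1" shows "class_map len (bend J z) = (\<lambda>p\<in>Pol len. p)"
proof -
  obtain e where J: "J = {e}" using assms(1) by (auto simp: card_1_singleton_iff)
  have "bend J z \<rho> = \<rho>" if "\<rho> \<in> PolT len" for \<rho>
    using rot_sgn_self[OF PolT_nonzero[OF that, of e], of z]
    by (auto simp: vec_eq_iff[of _ \<rho>] bend_nth J bsum_def)
  moreover have "equivariant len (bend J z)"
    by (rule equivariant_bend) (simp_all add: J bsum_def PolT_nonzero assms(2))
  ultimately have "class_map len (bend J z) (pol_class len \<rho>) = pol_class len \<rho>" if "\<rho> \<in> PolT len" for \<rho>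
    using that by (simp add: class_map)
  note id = this
  show ?thesis
  proof (rule extensionalityI[of _ "Pol len"])
    fix p assume "p \<in> Pol len"
    then obtain \<rho> where \<rho>: "\<rho> \<in> PolT len" "p = pol_class len \<rho>" by (rule Pol_cases)
    show "class_map len (bend J z) p = (\<lambda>p\<in>Pol len. p) p"
      unfolding \<rho>(2) id[OF \<rho>(1)] by (rule restrict_apply'[OF pol_class_mem[OF \<rho>(1)], symmetric])
  qed simp_all
qed

text \<open>A torus parametrised by \<open>\<theta>\<close> is compact, so it is embedded in the space of maps with the topology
  of pointwise convergence; hence a one-parameter group of bendings in it is a linear winding.\<close>

lemma bend_winding:
  assumes iso: "\<theta> \<in> iso (torus_group d) ((BijGroup (Pol len))\<lparr>carrier := T\<rparr>)"
    and TB: "T \<subseteq> Bij (Pol len)"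
    and cont: "continuous_map (prod_topology (torus_topology d) (pol_topology len)) (pol_topology len) (\<lambda>(z, p). \<theta> z p)"
    and nz: "\<And>\<rho>. \<rho> \<in> PolT len \<Longrightarrow> bsum A \<rho> \<noteq> 0"
    and inT: "\<And>t. class_map len (bend A (cis t)) \<in> T"
  shows "\<exists>x. \<forall>t. class_map len (bend A (cis t)) = \<theta> (\<lambda>k\<in>{..<d}. cis (t * x k))"
proof -
  let ?C = "carrier (torus_group d)" and ?\<Phi> = "\<lambda>t. class_map len (bend A (cis t))"
  have bij: "bij_betw \<theta> ?C T" and hom: "\<And>z w. z \<in> ?C \<Longrightarrow> w \<in> ?C \<Longrightarrow> \<theta> (z \<otimes>\<^bsub>torus_group d\<^esub> w) = \<theta> z \<otimes>\<^bsub>BijGroup (Pol len)\<^esub> \<theta> w"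
    using iso by (auto simp: iso_def hom_def)
  define g where "g = inv_into ?C \<theta>"
  have g\<theta>: "g (\<theta> z) = z" if "z \<in> ?C" for z
    unfolding g_def using bij that by (simp add: bij_betw_def)
  have \<theta>g: "\<theta> (g f) = f" "g f \<in> ?C" if "f \<in> T" for f
    using that bij by (auto simp: g_def bij_betw_def f_inv_into_f inv_into_into)
  let ?Y = "product_topology (\<lambda>_. pol_topology len) (Pol len)"
  have YH: "Hausdorff_space ?Y"
    unfolding Hausdorff_space_product_topology using Hausdorff_pol_topology by blast
  have "continuous_map (torus_topology d) ?Y \<theta>"
    unfolding continuous_map_componentwise
  proof (intro conjI ballI)
    show "\<theta> ` topspace (torus_topology d) \<subseteq> extensional (Pol len)"
      using bij TB by (auto simp: topspace_torus_topology bij_betw_def Bij_def)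
    fix p assume p: "p \<in> Pol len"
    have "continuous_map (torus_topology d) (prod_topology (torus_topology d) (pol_topology len)) (\<lambda>z. (z, p))"
      unfolding continuous_map_paired using p by simp
    from continuous_map_compose[OF this cont]
    show "continuous_map (torus_topology d) (pol_topology len) (\<lambda>z. \<theta> z p)" by (simp add: o_def)
  qed
  then have gc: "continuous_map (subtopology ?Y T) (torus_topology d) g"
    using bij by (intro continuous_inverse_map[OF compact_torus_topology YH])
      (auto simp: topspace_torus_topology g\<theta> bij_betw_def)
  have e: "equivariant len (bend A (cis t))" for t by (rule equivariant_bend[OF nz]) simp_all
  have "continuous_map euclideanreal ?Y ?\<Phi>"
    unfolding continuous_map_componentwise
  proof (intro conjI ballI)
    show "?\<Phi> ` topspace euclideanreal \<subseteq> extensional (Pol len)" by auto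
    fix p assume "p \<in> Pol len"
    then obtain \<rho> where \<rho>: "\<rho> \<in> PolT len" "p = pol_class len \<rho>" by (rule Pol_cases)
    have "continuous_on UNIV (\<lambda>t. bend A (fst (cis t, \<rho>)) (snd (cis t, \<rho>)))"
      by (rule continuous_on_compose2[OF continuous_on_bend]) (auto intro!: continuous_intros simp: nz \<rho>(1))
    moreover have "bend A (cis t) \<rho> \<in> PolT len" for t by (rule equivariantD[OF e \<rho>(1)])
    ultimately have "continuous_map euclideanreal (top_of_set (PolT len)) (\<lambda>t. bend A (cis t) \<rho>)"
      by (simp add: continuous_map_in_subtopology)
    from continuous_map_compose[OF this continuous_map_pol_class]
    show "continuous_map euclideanreal (pol_topology len) (\<lambda>t. ?\<Phi> t p)"
      by (simp add: o_def \<rho>(2) class_map[OF e \<rho>(1)])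
  qed
  then have "continuous_map euclideanreal (subtopology ?Y T) ?\<Phi>"
    using inT by (auto simp: continuous_map_in_subtopology)
  from continuous_map_compose[OF this gc]
  have hc: "continuous_map euclideanreal (torus_topology d) (\<lambda>t. g (?\<Phi> t))" by (simp add: o_def)
  define h where "h t = g (?\<Phi> t)" for t
  have hC: "h t \<in> ?C" and \<theta>h: "\<theta> (h t) = ?\<Phi> t" for t
    using \<theta>g[OF inT] by (simp_all add: h_def)
  have hadd: "h (s + t) = h s \<otimes>\<^bsub>torus_group d\<^esub> h t" for s t
  proof -
    interpret tg: group "torus_group d" by (rule group_torus_group)
    have "\<theta> (h s \<otimes>\<^bsub>torus_group d\<^esub> h t) = ?\<Phi> s \<otimes>\<^bsub>BijGroup (Pol len)\<^esub> ?\<Phi> t"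
      by (simp add: hom[OF hC hC] \<theta>h)
    also have "\<dots> = compose (Pol len) (?\<Phi> s) (?\<Phi> t)"
      using inT TB by (simp add: BijGroup_def subset_iff)
    also have "\<dots> = class_map len (\<lambda>\<rho>. bend A (cis s) (bend A (cis t) \<rho>))"
      by (rule class_map_comp[OF e e])
    also have "\<dots> = ?\<Phi> (s + t)"
    proof (rule class_map_eqI[OF class_map_extensional e])
      show "class_map len (\<lambda>\<rho>. bend A (cis s) (bend A (cis t) \<rho>)) (pol_class len \<rho>) = pol_class len (bend A (cis (s + t)) \<rho>)"
        if \<rho>: "\<rho> \<in> PolT len" for \<rho>
        unfolding class_map[OF equivariant_comp[OF e e] \<rho>] by (simp add: bend_bend[OF nz[OF \<rho>]] cis_mult)
    qed
    finally have eq: "\<theta> (h s \<otimes>\<^bsub>torus_group d\<^esub> h t) = \<theta> (h (s + t))" by (simp only: \<theta>h)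
    have "h s \<otimes>\<^bsub>torus_group d\<^esub> h t = g (\<theta> (h s \<otimes>\<^bsub>torus_group d\<^esub> h t))"
      by (rule g\<theta>[symmetric], rule tg.m_closed[OF hC hC])
    also have "\<dots> = h (s + t)" unfolding eq by (rule g\<theta>[OF hC])
    finally show ?thesis by (rule sym)
  qed
  have "\<exists>x. \<forall>t. h t k = cis (t * x)" if k: "k < d" for k
  proof (rule continuous_circle_hom)
    have "continuous_map (torus_topology d) (top_of_set (sphere 0 1)) (\<lambda>z. z k)"
      unfolding torus_topology_def using k by (intro continuous_map_product_projection) simp
    from continuous_map_compose[OF hc this]
    show "continuous_on UNIV (\<lambda>t. h t k)" by (simp add: h_def o_def continuous_map_in_subtopology)
    show "norm (h t k) = 1" for t using hC[of t] k by (auto simp: carrier_torus_group PiE_iff)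
    show "h (s + t) k = h s k * h t k" for s t using k by (simp add: hadd mult_torus_group)
  qed
  then have "\<forall>k. \<exists>x. k < d \<longrightarrow> (\<forall>t. h t k = cis (t * x))" by blast
  then obtain x where x: "\<forall>k. k < d \<longrightarrow> (\<forall>t. h t k = cis (t * x k))" by (rule choice[THEN exE])
  have "?\<Phi> t = \<theta> (\<lambda>k\<in>{..<d}. cis (t * x k))" for t
  proof -
    have "h t = (\<lambda>k\<in>{..<d}. cis (t * x k))"
    proof (rule extensionalityI[of _ "{..<d}"])
      show "h t \<in> extensional {..<d}" using hC[of t] by (simp add: carrier_torus_group PiE_def)
    qed (use x in simp_all)
    then show ?thesis using \<theta>h[of t] by simp
  qed
  then show ?thesis by blast
qed

text \<open>If all elements of the torus are products of \<open>card A\<close> windings and \<open>card A < d\<close>, a nontrivial linear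
  form vanishing on all windings takes only countably many values on the torus.\<close>

lemma windings_dimension:
  fixes x :: "'a \<Rightarrow> nat \<Rightarrow> real"
  assumes fin: "finite A"
    and cover: "\<And>y :: nat \<Rightarrow> real. \<exists>\<tau>. \<forall>k<d. cis (y k) = cis (\<Sum>a\<in>A. \<tau> a * x a k)"
  shows "d \<le> card A"
proof (rule ccontr)
  assume "\<not> d \<le> card A"
  then have "card A < card {..<d}" by simp
  then obtain c where c: "\<exists>k\<in>{..<d}. c k \<noteq> 0" "\<forall>a\<in>A. (\<Sum>k<d. c k * x a k) = 0"
    using homogeneous_system_solution[OF fin, of "{..<d}" x] by blast
  then obtain j where j: "j < d" "c j \<noteq> 0" by auto
  let ?V = "\<lambda>m :: nat \<Rightarrow> int. 2 * pi * (\<Sum>k<d. c k * real_of_int (m k))"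
  have "s \<in> ?V ` (\<Pi>\<^sub>E k\<in>{..<d}. UNIV)" for s :: real
  proof -
    \<comment> \<open>This point is chosen so that the linear form \<open>c\<close> takes the
      arbitrary value \<open>s\<close> on it.\<close>
    define y where "y k = (if k = j then s / c j else 0)" for k
    obtain \<tau> where \<tau>: "\<forall>k<d. cis (y k) = cis (\<Sum>a\<in>A. \<tau> a * x a k)" using cover[of y] by blast
    have "\<exists>m :: int. y k = (\<Sum>a\<in>A. \<tau> a * x a k) + 2 * pi * real_of_int m" if "k < d" for k
    proof -
      have "cos (y k) = cos (\<Sum>a\<in>A. \<tau> a * x a k) \<and> sin (y k) = sin (\<Sum>a\<in>A. \<tau> a * x a k)"
        using \<tau> that by (simp add: complex_eq_iff)
      then have "sin (y k) = sin (\<Sum>a\<in>A. \<tau> a * x a k) \<and> cos (y k) = cos (\<Sum>a\<in>A. \<tau> a * x a k)" by simp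
      then obtain n :: int where "y k = (\<Sum>a\<in>A. \<tau> a * x a k) + 2 * pi * n"
        by (subst (asm) sin_cos_eq_iff) blast
      then show ?thesis by blast
    qed
    then have "\<forall>k. \<exists>m :: int. k < d \<longrightarrow> y k = (\<Sum>a\<in>A. \<tau> a * x a k) + 2 * pi * real_of_int m" by blast
    then obtain m :: "nat \<Rightarrow> int" where m: "\<forall>k. k < d \<longrightarrow> y k = (\<Sum>a\<in>A. \<tau> a * x a k) + 2 * pi * real_of_int (m k)"
      by (rule choice[THEN exE])
    have "(\<Sum>k<d. c k * y k) = (\<Sum>k<d. if k = j then s else 0)"
      using j by (intro sum.cong) (auto simp: y_def)
    then have "s = (\<Sum>k<d. c k * y k)" using j(1) by simp
    also have "\<dots> = (\<Sum>k<d. c k * (\<Sum>a\<in>A. \<tau> a * x a k) + 2 * pi * (c k * real_of_int (m k)))"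
      using m by (intro sum.cong) (simp_all add: algebra_simps)
    also have "\<dots> = (\<Sum>k<d. \<Sum>a\<in>A. \<tau> a * (c k * x a k)) + ?V m"
      by (simp add: sum.distrib sum_distrib_left mult.left_commute)
    also have "(\<Sum>k<d. \<Sum>a\<in>A. \<tau> a * (c k * x a k)) = (\<Sum>a\<in>A. \<tau> a * (\<Sum>k<d. c k * x a k))"
      by (subst sum.swap) (simp add: sum_distrib_left)
    also have "\<dots> = 0" using c(2) by simp
    \<comment> \<open>Restricting \<open>m\<close> to finitely many indices places it in a countable
      set.\<close>
    also have "0 + ?V m = ?V (restrict m {..<d})" by simp
    finally have eq: "s = ?V (restrict m {..<d})" .
    show ?thesis by (rule image_eqI[where x = "restrict m {..<d}"]) (fact eq, simp)
  qed
  then have "UNIV \<subseteq> ?V ` (\<Pi>\<^sub>E k\<in>{..<d}. UNIV)" by blast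
  moreover have "countable (?V ` (\<Pi>\<^sub>E k\<in>{..<d}. UNIV))"
    by (intro countable_image countable_PiE) auto
  ultimately have "countable (UNIV :: real set)" by (rule countable_subset)
  then show False using uncountable_UNIV_real by simp
qed

text \<open>The torus is abelian, so the generating blocks do not cross and
  \<open>compatible_splits_bound\<close> selects one side of each nontrivial split. The flows of the
  selected sides are windings, and every element of \<open>T\<close> is a product of these, so
  \<open>windings_dimension\<close> applies.\<close>

lemma bending_torus_dimension:
  assumes bt: "bending_torus len T d" shows "d + max 3 (N_lopsided len) \<le> CARD('e)"
proof -
  let ?G = "BijGroup (Pol len)" and ?C = "carrier (torus_group d)"
  obtain \<I> where \<I>: "\<And>I. I \<in> \<I> \<Longrightarrow> lopsided len I" and T: "T = generate ?G {bending_flow len I t | I t. I \<in> \<I>}"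
    using bt unfolding bending_torus_def by blast
  have ht: "hamiltonian_torus len T d" using bt by (simp add: bending_torus_def)
  obtain \<theta> where iso: "\<theta> \<in> iso (torus_group d) (?G\<lparr>carrier := T\<rparr>)"
    and cont: "continuous_map (prod_topology (torus_topology d) (pol_topology len)) (pol_topology len) (\<lambda>(z, p). \<theta> z p)"
    using ht unfolding hamiltonian_torus_def by blast
  have sub: "subgroup T ?G" using ht by (simp add: hamiltonian_torus_def)
  have TB: "T \<subseteq> Bij (Pol len)" using subgroup.subset[OF sub] by (simp add: BijGroup_def)
  have bij: "bij_betw \<theta> ?C T" and hom: "\<And>z w. z \<in> ?C \<Longrightarrow> w \<in> ?C \<Longrightarrow> \<theta> (z \<otimes>\<^bsub>torus_group d\<^esub> w) = \<theta> z \<otimes>\<^bsub>?G\<^esub> \<theta> w"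
    using iso by (auto simp: iso_def hom_def)
  have nz: "bsum I \<rho> \<noteq> 0" if "I \<in> \<I>" "\<rho> \<in> PolT len" for I \<rho> using \<I> lopsided_bsum_nonzero that by blast
  have flow: "bending_flow len I t = class_map len (bend I (cis t))" if "I \<in> \<I>" for I t
    by (rule bending_flow_eq) (rule nz[OF that])
  have inT: "class_map len (bend I (cis t)) \<in> T" if "I \<in> \<I>" for I t
    unfolding T by (rule generate.incl) (use flow[OF that, of t] that in \<open>simp only: mem_Collect_eq, metis\<close>)
  have mult_comp: "g \<otimes>\<^bsub>?G\<^esub> h = compose (Pol len) g h" if "g \<in> T" "h \<in> T" for g h
    using that TB by (simp add: BijGroup_def subset_iff)
  have comm: "compose (Pol len) g h = compose (Pol len) h g" if gh: "g \<in> T" "h \<in> T" for g h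
  proof -
    obtain z w where zw: "z \<in> ?C" "w \<in> ?C" "g = \<theta> z" "h = \<theta> w" using gh bij by (auto simp: bij_betw_def)
    have "z \<otimes>\<^bsub>torus_group d\<^esub> w = w \<otimes>\<^bsub>torus_group d\<^esub> z" by (simp add: mult_torus_group mult.commute)
    then have "g \<otimes>\<^bsub>?G\<^esub> h = h \<otimes>\<^bsub>?G\<^esub> g" using hom[OF zw(1,2)] hom[OF zw(2,1)] by (simp add: zw(3,4))
    then show ?thesis using mult_comp gh by simp
  qed
  have nc: "\<not> crossing I J" if IJ: "I \<in> \<I>" "J \<in> \<I>" for I J
  proof (rule commuting_not_crossing[OF nz[OF IJ(1)] nz[OF IJ(2)]])
    have "class_map len (bend I (- 1)) \<in> T" using inT[OF IJ(1), of pi] by simp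
    moreover have "class_map len (bend J \<i>) \<in> T" using inT[OF IJ(2), of "pi / 2"] by simp
    ultimately have "compose (Pol len) (class_map len (bend I (- 1))) (class_map len (bend J \<i>))
      = compose (Pol len) (class_map len (bend J \<i>)) (class_map len (bend I (- 1)))" by (rule comm)
    then show "class_map len (bend I (- 1)) (class_map len (bend J \<i>) p) = class_map len (bend J \<i>) (class_map len (bend I (- 1)) p)"
      if "p \<in> Pol len" for p
      using compose_eq[OF that] by metis
  qed
  \<comment> \<open>Splits with a one-element side are left out, since a single vector rotates about
    itself and the bending is trivial.\<close>
  define \<S> where "\<S> = {A. (A \<in> \<I> \<or> - A \<in> \<I>) \<and> 2 \<le> card A \<and> 2 \<le> card (- A)}"
  have "\<exists>\<A>\<subseteq>\<S>. (\<forall>A\<in>\<S>. A \<in> \<A> \<or> - A \<in> \<A>) \<and> card \<A> + max 3 (N_lopsided len) \<le> CARD('e)"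
  proof (rule compatible_splits_bound)
    show "\<not> crossing A B" if "A \<in> \<S>" "B \<in> \<S>" for A B
    proof -
      obtain I J where "I \<in> \<I>" "J \<in> \<I>" "I = A \<or> I = - A" "J = B \<or> J = - B"
        using \<open>A \<in> \<S>\<close> \<open>B \<in> \<S>\<close> unfolding \<S>_def by blast
      then show ?thesis
        using nc[of I J] crossing_Compl[of A B] crossing_Compl[of B A] crossing_Compl[of B "- A"] crossing_sym by metis
    qed
  qed (use \<I> in \<open>auto simp: \<S>_def\<close>)
  then obtain \<A> where \<A>: "\<A> \<subseteq> \<S>" "\<And>A. A \<in> \<S> \<Longrightarrow> A \<in> \<A> \<or> - A \<in> \<A>" "card \<A> + max 3 (N_lopsided len) \<le> CARD('e)"
    by blast
  have Compl: "class_map len (bend (- I) (cis t)) = class_map len (bend I (cis t))" if "I \<in> \<I>" for I t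
    by (rule class_map_bend_Compl[OF nz[OF that]]) simp_all
  have nzA: "bsum A \<rho> \<noteq> 0" if "A \<in> \<A>" "\<rho> \<in> PolT len" for A \<rho>
    using that \<A>(1) nz[of A \<rho>] nz[of "- A" \<rho>] bsum_Compl[OF that(2), of A] by (auto simp: \<S>_def)
  have inTA: "class_map len (bend A (cis t)) \<in> T" if "A \<in> \<A>" for A t
  proof -
    have "A \<in> \<I> \<or> - A \<in> \<I>" using that \<A>(1) by (auto simp: \<S>_def)
    then show ?thesis using inT[of A t] inT[of "- A" t] Compl[of "- A" t] by auto
  qed
  have "\<forall>A. \<exists>x. A \<in> \<A> \<longrightarrow> (\<forall>t. class_map len (bend A (cis t)) = \<theta> (\<lambda>k\<in>{..<d}. cis (t * x k)))"
  proof
    fix A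
    show "\<exists>x. A \<in> \<A> \<longrightarrow> (\<forall>t. class_map len (bend A (cis t)) = \<theta> (\<lambda>k\<in>{..<d}. cis (t * x k)))"
    proof (cases "A \<in> \<A>")
      case True
      have "\<exists>x. \<forall>t. class_map len (bend A (cis t)) = \<theta> (\<lambda>k\<in>{..<d}. cis (t * x k))"
        by (rule bend_winding[OF iso TB cont _ inTA[OF True]]) (rule nzA[OF True])
      then obtain x where "\<forall>t. class_map len (bend A (cis t)) = \<theta> (\<lambda>k\<in>{..<d}. cis (t * x k))" ..
      then show ?thesis by (intro exI[of _ x] impI)
    qed simp
  qed
  then obtain x where x: "\<forall>A. A \<in> \<A> \<longrightarrow> (\<forall>t. class_map len (bend A (cis t)) = \<theta> (\<lambda>k\<in>{..<d}. cis (t * x A k)))"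
    by (rule choice[THEN exE])
  \<comment> \<open>The angles of the product of all selected bendings, the one along
    \<open>A\<close> taken at time \<open>\<tau> A\<close>.\<close>
  define \<kappa> where "\<kappa> \<tau> = (\<lambda>k\<in>{..<d}. cis (\<Sum>A\<in>\<A>. \<tau> A * x A k))" for \<tau> :: "'e set \<Rightarrow> real"
  have \<kappa>C: "\<kappa> \<tau> \<in> ?C" for \<tau> by (simp add: \<kappa>_def carrier_torus_group)
  have \<kappa>add: "\<theta> (\<kappa> \<tau>) \<otimes>\<^bsub>?G\<^esub> \<theta> (\<kappa> \<tau>') = \<theta> (\<kappa> (\<lambda>A. \<tau> A + \<tau>' A))" for \<tau> \<tau>'
  proof -
    have "\<kappa> \<tau> \<otimes>\<^bsub>torus_group d\<^esub> \<kappa> \<tau>' = \<kappa> (\<lambda>A. \<tau> A + \<tau>' A)"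
      by (auto simp: \<kappa>_def mult_torus_group cis_mult sum.distrib distrib_right fun_eq_iff)
    then show ?thesis using hom[OF \<kappa>C \<kappa>C, of \<tau> \<tau>'] by simp
  qed
  interpret G: group ?G by (rule group_BijGroup)
  have \<theta>car: "\<theta> z \<in> carrier ?G" if "z \<in> ?C" for z
    using bij that TB by (auto simp: bij_betw_def BijGroup_def)
  \<comment> \<open>The element is idempotent, and a group has only one such element.\<close>
  have \<kappa>0: "\<theta> (\<kappa> (\<lambda>_. 0)) = \<one>\<^bsub>?G\<^esub>"
  proof -
    have "\<theta> (\<kappa> (\<lambda>_. 0)) \<otimes>\<^bsub>?G\<^esub> \<theta> (\<kappa> (\<lambda>_. 0)) = \<theta> (\<kappa> (\<lambda>_. 0))" by (simp add: \<kappa>add)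
    then show ?thesis using G.r_cancel_one[OF \<theta>car[OF \<kappa>C] \<theta>car[OF \<kappa>C]] by blast
  qed
  have gen: "\<exists>\<tau>. bending_flow len I t = \<theta> (\<kappa> \<tau>)" if I: "I \<in> \<I>" for I t
  proof -
    have main: "\<exists>\<tau>. class_map len (bend A (cis t)) = \<theta> (\<kappa> \<tau>)" if A: "A \<in> \<A>" for A
    proof -
      have "\<kappa> (\<lambda>B. if B = A then t else 0) = (\<lambda>k\<in>{..<d}. cis (t * x A k))"
        using A unfolding \<kappa>_def by (intro restrict_ext) (simp add: if_distrib[of "\<lambda>u. u * _"] cong: if_cong)
      then show ?thesis using x A by metis
    qed
    have triv: "\<exists>\<tau>. (\<lambda>p\<in>Pol len. p) = \<theta> (\<kappa> \<tau>)" using \<kappa>0 by (intro exI[of _ "\<lambda>_. 0"]) (simp add: BijGroup_def)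
    have "I \<noteq> {}" using \<I>[OF I] by (auto simp: lopsided_def)
    then have c1: "card I \<noteq> 0" by simp
    have "- I \<noteq> {}" using \<I>[OF I] not_lopsided_UNIV by (metis Compl_empty_eq double_complement)
    then have c2: "card (- I) \<noteq> 0" by simp
    consider "card I = 1" | "card (- I) = 1" | "2 \<le> card I" "2 \<le> card (- I)" using c1 c2 by linarith
    then show ?thesis
    proof cases
      case 1
      then show ?thesis using triv by (simp add: flow[OF I] class_map_bend_trivial)
    next
      case 2
      then show ?thesis using triv class_map_bend_trivial[OF 2, of "cis t"] by (simp add: flow[OF I] Compl[OF I])
    next
      case 3
      then have "I \<in> \<S>" using I by (simp add: \<S>_def)
      then show ?thesis using \<A>(2)[of I] main[of I] main[of "- I"] by (auto simp: flow[OF I] Compl[OF I])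
    qed
  qed
  have all: "\<exists>\<tau>. f = \<theta> (\<kappa> \<tau>)" if "f \<in> generate ?G {bending_flow len I t | I t. I \<in> \<I>}" for f
    using that
  proof (induction rule: generate.induct)
    case one
    then show ?case using \<kappa>0 by (intro exI[of _ "\<lambda>_. 0"]) simp
  next
    case (incl h)
    then show ?case using gen by blast
  next
    case (inv h)
    then obtain \<tau> where \<tau>: "h = \<theta> (\<kappa> \<tau>)" using gen by blast
    have "\<theta> (\<kappa> (\<lambda>A. - \<tau> A)) \<otimes>\<^bsub>?G\<^esub> \<theta> (\<kappa> \<tau>) = \<one>\<^bsub>?G\<^esub>" by (simp add: \<kappa>add \<kappa>0)
    then have "inv\<^bsub>?G\<^esub> h = \<theta> (\<kappa> (\<lambda>A. - \<tau> A))"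
      unfolding \<tau> by (rule G.inv_equality) (rule \<theta>car[OF \<kappa>C])+
    then show ?case by blast
  next
    case (eng h1 h2)
    then obtain \<tau>1 \<tau>2 where "h1 = \<theta> (\<kappa> \<tau>1)" "h2 = \<theta> (\<kappa> \<tau>2)" by blast
    then show ?case using \<kappa>add by blast
  qed
  have "d \<le> card \<A>"
  proof (rule windings_dimension[of \<A> d x])
    fix y :: "nat \<Rightarrow> real"
    let ?z = "\<lambda>k\<in>{..<d}. cis (y k)"
    have z: "?z \<in> ?C" by (simp add: carrier_torus_group)
    then have "\<theta> ?z \<in> T" using bij by (auto simp: bij_betw_def)
    then obtain \<tau> where "\<theta> ?z = \<theta> (\<kappa> \<tau>)" using all unfolding T by blast
    then have "?z = \<kappa> \<tau>" using bij z \<kappa>C by (auto simp: bij_betw_def inj_on_def)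
    then have "?z k = \<kappa> \<tau> k" for k by (rule fun_cong)
    then have "cis (y k) = cis (\<Sum>A\<in>\<A>. \<tau> A * x A k)" if "k < d" for k
      using that by (simp add: \<kappa>_def restrict_apply') metis
    then show "\<exists>\<tau>. \<forall>k<d. cis (y k) = cis (\<Sum>A\<in>\<A>. \<tau> A * x A k)" by blast
  qed simp
  then show ?thesis using \<A>(3) by linarith
qed

end

text \<open>The bound is a sum in order to avoid truncated subtraction. Applied to the torus of the
  first part, it also shows that the difference there is a true one.\<close>

theorem theoremA:
  fixes len :: "'e::finite \<Rightarrow> real"
  assumes "\<And>e. len e > 0"
    and "generic len"
    and "Pol len \<noteq> {}"
  shows "(\<exists>T. bending_torus len T (CARD('e) - max 3 (N_lopsided len))) \<and>
         (\<forall>T d. bending_torus len T d \<longrightarrow> d + max 3 (N_lopsided len) \<le> CARD('e))"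
proof -
  have "PolT len \<noteq> {}"
    using assms(3) by (auto simp: Pol_def quotient_def)
  then interpret polygon_space len
    using assms(1,2) by unfold_locales
  show ?thesis
    using exists_bending_torus bending_torus_dimension by blast
qed

end
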